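(* Assume that the scaling function and the wavelets are compactly supported, and let $p\in[1,+\infty)$. (i) Let $d=1$, $s>0$ with $1-sp>0$. For every $\beta\in\left(-s,\frac1p-s\right)\setminus\{0\}$ there exists $f\in B_p^{s,1}(\mathbb R)$ such that $\dim_{\mathcal P}\big(\mathcal E^+(\beta,f)\big)>1-sp-\beta p$. (ii) Let $d\ge1$, $s\ge0$ with $d-sp<0$. For every $\beta\in\left(-s,\frac dp-s\right)\setminus\{0\}$ and every $f\in B_p^{s,\infty}(\mathbb R^d)$, $\dim_{\mathcal P}\big(\mathcal E^+(\beta,f)\big)\le d-sp-\beta p$.
   Context: Standing setup. $(V_j)_{j\in\mathbb Z}$ is an orthogonal multiresolution analysis of $L^2(\mathbb R^d)$ with scaling function $\varphi$ (the integer translates of $\varphi$ form an orthonormal basis of $V_0$), and $\psi^{(1)},\dots,\psi^{(2^d-1)}$ are associated wavelets: the functions $2^{dj/2}\psi^{(i)}(2^j\cdot-k)$, $i\in\{1,\dots,2^d-1\}$, $j\in\mathbb Z$, $k\in\mathbb Z^d$, form an orthonormal basis of $L^2(\mathbb R^d)$. The functions $\varphi,\psi^{(i)}$ are smooth (at least $\lfloor s\rfloor+1$ continuous derivatives), and they and these derivatives have fast decay: for every $N\ge0$ there is $C_N$ with $|\psi^{(i)}(x)|\le C_N(1+\|x\|)^{-N}$ for all $x$. $\|\cdot\|$ is the supremum norm on $\mathbb R^d$. For $j\ge0$ and $k\in\mathbb Z^d$, the dyadic cube $\lambda=(j,k)$ is $\prod_{m=1}^d[k_m2^{-j},(k_m+1)2^{-j})$;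 $\Lambda_j$ is the set of dyadic cubes of generation $j$; $\psi^{(i)}_\lambda(x)=\psi^{(i)}(2^jx-k)$. For $f$ in $L^p(\mathbb R^d)$ set $C_k=\int\overline{\varphi(x-k)}f(x)\,dx$ and $c^{(i)}_\lambda=2^{dj}\int\overline{\psi^{(i)}_\lambda(x)}f(x)\,dx$. Define $Q_lf(x)=\sum_{i}\sum_{\lambda\in\Lambda_l}c^{(i)}_\lambda\psi^{(i)}_\lambda(x)$, $P_jf(x)=\sum_kC_k\varphi(x-k)+\sum_{0\le l<j}Q_lf(x)$, and, when $(P_jf(x))_j$ converges, $R_jf(x)=\sum_{l\ge j}Q_lf(x)$. The Besov space $B^{s,q}_p(\mathbb R^d)$ consists of those $f$ with $(C_k)\in\ell^p$ and $(\varepsilon_j)_{j\ge0}\in\ell^q$, where $\varepsilon_j=2^{(s-d/p)j}\big(\sum_i\sum_{\lambda\in\Lambda_j}|c^{(i)}_\lambda|^p\big)^{1/p}$; its norm is $\|(C_k)\|_{\ell^p}+\|(\varepsilon_j)\|_{\ell^q}$. Level set (with $\log0=-\infty$): for $\beta>0$, $\mathcal E^+(\beta,f)=\{x:\liminf_j\frac{\log|P_jf(x)|}{j\log2}\ge\beta\}$; for $\beta<0$, $\mathcal E^+(\beta,f)=\{x:(P_jf(x))_j\text{ converges and }\liminf_j\frac{\log|R_jf(x)|}{j\log2}\ge\beta\}$. $\dim_{\mathcal P}$ denotes packing dimension. *)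

theory Defs
  imports "HOL-Analysis.Analysis"
begin

definition ivec :: "int^'n::finite \<Rightarrow> real^'n" where
  "ivec k = (\<chi> m. real_of_int (k$m))"

definition supnorm :: "real^'n::finite \<Rightarrow> real" where
  "supnorm x = Max (range (\<lambda>m. \<bar>x$m\<bar>))"

definition fast_decay :: "(real^'n::finite \<Rightarrow> complex) \<Rightarrow> bool" where
  "fast_decay g \<longleftrightarrow>
     (\<forall>N::real. N \<ge> 0 \<longrightarrow> (\<exists>C. \<forall>x. cmod (g x) \<le> C * (1 + supnorm x) powr (- N)))"

definition dir_deriv :: "'n::finite \<Rightarrow> (real^'n \<Rightarrow> complex) \<Rightarrow> real^'n \<Rightarrow> complex" where
  "dir_deriv m g x = frechet_derivative g (at x) (axis m 1)"

definition smooth_decay :: "nat \<Rightarrow> (real^'n::finite \<Rightarrow> complex) \<Rightarrow> bool" where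
  "smooth_decay r g \<longleftrightarrow>
     (\<forall>ms::'n list. length ms \<le> r \<longrightarrow>
        (let h = fold dir_deriv ms g in
           continuous_on UNIV h \<and> fast_decay h \<and>
           (length ms < r \<longrightarrow> (\<forall>x. h differentiable (at x)))))"

definition compact_support :: "(real^'n::finite \<Rightarrow> complex) \<Rightarrow> bool" where
  "compact_support g \<longleftrightarrow> compact (closure {x. g x \<noteq> 0})"

definition L2 :: "(real^'n::finite \<Rightarrow> complex) \<Rightarrow> bool" where
  "L2 g \<longleftrightarrow> g \<in> borel_measurable lebesgue \<and> integrable lebesgue (\<lambda>x. (cmod (g x))^2)"

definition l2_inner :: "(real^'n::finite \<Rightarrow> complex) \<Rightarrow> (real^'n \<Rightarrow> complex) \<Rightarrow> complex" where
  "l2_inner g h = (LINT x|lebesgue. g x * cnj (h x))"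

definition ONB_family :: "('i \<Rightarrow> real^'n::finite \<Rightarrow> complex) \<Rightarrow> 'i set \<Rightarrow> bool" where
  "ONB_family F I \<longleftrightarrow>
     (\<forall>i\<in>I. L2 (F i)) \<and>
     (\<forall>i\<in>I. \<forall>j\<in>I. l2_inner (F i) (F j) = (if i = j then 1 else 0)) \<and>
     (\<forall>g. L2 g \<and> (\<forall>i\<in>I. l2_inner g (F i) = 0) \<longrightarrow> (AE x in lebesgue. g x = 0))"

definition wav :: "(nat \<Rightarrow> real^'n::finite \<Rightarrow> complex) \<Rightarrow> nat \<Rightarrow> int \<Rightarrow> int^'n \<Rightarrow> real^'n \<Rightarrow> complex" where
  "wav \<psi> i j k x =
     complex_of_real (2 powr (real CARD('n) * real_of_int j / 2)) *
     \<psi> i ((2 powr real_of_int j) *\<^sub>R x - ivec k)"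

text \<open>phi is the scaling function of an orthogonal MRA of L^2(R^d) and psi^(1..2^d-1)
  are associated wavelets. Encoded as: (a) the wavelets 2^(dj/2) psi^(i)(2^j . - k),
  j in Z, form an ONB of L^2, and (b) the translates phi(. - k) together with the
  wavelets of levels j >= 0 form an ONB of L^2 (equivalently, with V_j the closed span
  of 2^(dj/2) phi(2^j . - k), the V_j form an orthogonal MRA whose wavelet spaces are
  spanned by the psi's).\<close>
definition mra_wavelets :: "(real^'n::finite \<Rightarrow> complex) \<Rightarrow> (nat \<Rightarrow> real^'n \<Rightarrow> complex) \<Rightarrow> bool" where
  "mra_wavelets \<phi> \<psi> \<longleftrightarrow>
     ONB_family (\<lambda>(i, j, k). wav \<psi> i j k)
       ({1..2^CARD('n) - 1} \<times> (UNIV::int set) \<times> (UNIV::(int^'n) set)) \<and>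
     ONB_family (case_sum (\<lambda>k x. \<phi> (x - ivec k)) (\<lambda>(i, j, k). wav \<psi> i (int j) k))
       ((UNIV::(int^'n) set) <+> ({1..2^CARD('n) - 1} \<times> (UNIV::nat set) \<times> (UNIV::(int^'n) set)))"

definition scoef :: "(real^'n::finite \<Rightarrow> complex) \<Rightarrow> (real^'n \<Rightarrow> complex) \<Rightarrow> int^'n \<Rightarrow> complex" where
  "scoef \<phi> f k = (LINT x|lebesgue. cnj (\<phi> (x - ivec k)) * f x)"

definition wcoef :: "(nat \<Rightarrow> real^'n::finite \<Rightarrow> complex) \<Rightarrow> (real^'n \<Rightarrow> complex) \<Rightarrow> nat \<Rightarrow> nat \<Rightarrow> int^'n \<Rightarrow> complex" where
  "wcoef \<psi> f i j k =
     complex_of_real (2 ^ (CARD('n) * j)) *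
     (LINT x|lebesgue. cnj (\<psi> i ((2 ^ j) *\<^sub>R x - ivec k)) * f x)"

definition Qop :: "(nat \<Rightarrow> real^'n::finite \<Rightarrow> complex) \<Rightarrow> (real^'n \<Rightarrow> complex) \<Rightarrow> nat \<Rightarrow> real^'n \<Rightarrow> complex" where
  "Qop \<psi> f l x =
     (\<Sum>i\<in>{1..2^CARD('n) - 1}.
        infsum (\<lambda>k. wcoef \<psi> f i l k * \<psi> i ((2 ^ l) *\<^sub>R x - ivec k)) UNIV)"

definition Pop :: "(real^'n::finite \<Rightarrow> complex) \<Rightarrow> (nat \<Rightarrow> real^'n \<Rightarrow> complex) \<Rightarrow> (real^'n \<Rightarrow> complex) \<Rightarrow> nat \<Rightarrow> real^'n \<Rightarrow> complex" where
  "Pop \<phi> \<psi> f j x =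
     infsum (\<lambda>k. scoef \<phi> f k * \<phi> (x - ivec k)) UNIV + (\<Sum>l<j. Qop \<psi> f l x)"

text \<open>R_j f(x) = sum over l >= j of Q_l f(x) (used only where P_j f(x) converges).\<close>
definition Rop :: "(nat \<Rightarrow> real^'n::finite \<Rightarrow> complex) \<Rightarrow> (real^'n \<Rightarrow> complex) \<Rightarrow> nat \<Rightarrow> real^'n \<Rightarrow> complex" where
  "Rop \<psi> f j x = (\<Sum>l. Qop \<psi> f (l + j) x)"

definition Lp :: "real \<Rightarrow> (real^'n::finite \<Rightarrow> complex) \<Rightarrow> bool" where
  "Lp p f \<longleftrightarrow> f \<in> borel_measurable lebesgue \<and> integrable lebesgue (\<lambda>x. cmod (f x) powr p)"

definition besov_eps :: "(nat \<Rightarrow> real^'n::finite \<Rightarrow> complex) \<Rightarrow> real \<Rightarrow> real \<Rightarrow> (real^'n \<Rightarrow> complex) \<Rightarrow> nat \<Rightarrow> real" where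
  "besov_eps \<psi> s p f j =
     2 powr ((s - real CARD('n) / p) * real j) *
     (\<Sum>i\<in>{1..2^CARD('n) - 1}. infsum (\<lambda>k. cmod (wcoef \<psi> f i j k) powr p) UNIV) powr (1 / p)"

definition besov :: "(real^'n::finite \<Rightarrow> complex) \<Rightarrow> (nat \<Rightarrow> real^'n \<Rightarrow> complex) \<Rightarrow> real \<Rightarrow> real \<Rightarrow> ereal \<Rightarrow> (real^'n \<Rightarrow> complex) \<Rightarrow> bool" where
  "besov \<phi> \<psi> s p q f \<longleftrightarrow>
     Lp p f \<and>
     (\<lambda>k. cmod (scoef \<phi> f k) powr p) summable_on UNIV \<and>
     (\<forall>i\<in>{1..2^CARD('n) - 1}. \<forall>j. (\<lambda>k. cmod (wcoef \<psi> f i j k) powr p) summable_on UNIV) \<and>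
     (if q = \<infinity> then bounded (range (besov_eps \<psi> s p f))
      else summable (\<lambda>j. besov_eps \<psi> s p f j powr real_of_ereal q))"

definition log2rate :: "complex \<Rightarrow> nat \<Rightarrow> ereal" where
  "log2rate z j = (if z = 0 then - \<infinity> else ereal (ln (cmod z) / (real j * ln 2)))"

definition Eplus :: "(real^'n::finite \<Rightarrow> complex) \<Rightarrow> (nat \<Rightarrow> real^'n \<Rightarrow> complex) \<Rightarrow> real \<Rightarrow> (real^'n \<Rightarrow> complex) \<Rightarrow> (real^'n) set" where
  "Eplus \<phi> \<psi> \<beta> f =
     (if \<beta> > 0 then {x. Liminf sequentially (\<lambda>j. log2rate (Pop \<phi> \<psi> f j x) j) \<ge> ereal \<beta>}
      else {x. convergent (\<lambda>j. Pop \<phi> \<psi> f j x) \<and>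
               Liminf sequentially (\<lambda>j. log2rate (Rop \<psi> f j x) j) \<ge> ereal \<beta>})"

definition packing_pre :: "real \<Rightarrow> (real^'n::finite) set \<Rightarrow> ennreal" where
  "packing_pre s E =
     (INF \<delta>\<in>{0<..}. SUP B\<in>{B. finite B \<and> (\<forall>(x, r)\<in>B. x \<in> E \<and> 0 < r \<and> r \<le> \<delta>) \<and>
                              disjoint_family_on (\<lambda>(x, r). cball x r) B}.
        (\<Sum>(x, r)\<in>B. ennreal ((2 * r) powr s)))"

definition packing_measure :: "real \<Rightarrow> (real^'n::finite) set \<Rightarrow> ennreal" where
  "packing_measure s E =
     (INF F\<in>{F :: nat \<Rightarrow> (real^'n) set. E \<subseteq> (\<Union>i. F i)}. (\<Sum>i. packing_pre s (F i)))"

definition packing_dim :: "(real^'n::finite) set \<Rightarrow> ereal" where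
  "packing_dim E = Inf {ereal s | s. 0 \<le> s \<and> packing_measure s E = 0}"

end

theory Submission
  imports Defs
begin

text \<open>
  Part (ii): since \<open>s > d/p\<close>, a remainder \<open>|R\<^sub>j f(x)| \<ge> 2\<^bsup>(\<beta> - \<epsilon>)j\<^esup>\<close> forces a coefficient of size about
  \<open>2\<^bsup>\<beta>j - \<epsilon>l\<^esup>\<close> on a cube of some generation \<open>l \<ge> j\<close> close to \<open>x\<close>. Points at mutual distance \<open>\<gtrsim> 2\<^bsup>-j\<^esup>\<close>
  need different cubes, and the Besov norm bounds the number of such cubes; this controls packings at scale \<open>2\<^bsup>-j\<^esup>\<close>.

  Part (i): \<open>f\<close> has coefficients \<open>c\<^sub>n\<close> on the nodes of generation \<open>l\<^sub>n\<close> of a tree of dyadic intervals. With \<open>c\<^sub>n\<close>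
  geometric, \<open>P\<^sub>j f\<close> (for \<open>\<beta> > 0\<close>) is dominated on the limiting Cantor set by its last term, and \<open>R\<^sub>j f\<close>
  (for \<open>\<beta> < 0\<close>) by its first. The tree does not branch and its generations increase by a constant, except at
  very sparse generations \<open>l\<close>, where the next generation is \<open>(1 + g)l\<close> and every node gets \<open>2\<^bsup>\<theta>l\<^esup>\<close>
  equally spaced children. These are visible at the scale \<open>2\<^bsup>-(1 + \<theta>)l\<^esup>\<close>, long before generation \<open>(1 + g)l\<close>, where
  the Besov condition limits their number; hence the packing dimension is at least \<open>\<theta>/(1 + \<theta>)\<close>. Writing
  \<open>D = 1 - sp - \<beta>p\<close>, one needs \<open>\<theta> > D/(1 - D)\<close>, together with \<open>1 + g < (1 - sp)/(\<beta>p)\<close> and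
  \<open>\<theta> < (1 + g)D\<close> if \<open>\<beta> > 0\<close>, which is possible because \<open>sp > 0\<close>; for \<open>\<beta> < 0\<close> a large \<open>g\<close> does.
\<close>

subsection \<open>Packings and separated sets\<close>

lemma sum_geometric_tail_le:
  fixes q :: real
  assumes "0 \<le> q" "q < 1" "finite S" "S \<subseteq> {j0..}"
  shows "(\<Sum>j\<in>S. q ^ j) \<le> q ^ j0 / (1 - q)"
proof -
  have inj: "inj_on (\<lambda>j. j - j0) S"
    by (intro inj_onI) (metis assms(4) atLeast_iff eq_diff_iff subsetD)
  have "(\<Sum>j\<in>S. q ^ j) = (\<Sum>j\<in>S. q ^ j0 * q ^ (j - j0))"
    using assms(4) by (intro sum.cong) (auto simp flip: power_add)
  also have "\<dots> = q ^ j0 * (\<Sum>i\<in>(\<lambda>j. j - j0) ` S. q ^ i)"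
    by (simp add: sum.reindex[OF inj] sum_distrib_left)
  also have "\<dots> \<le> q ^ j0 * (\<Sum>i. q ^ i)"
    using assms by (intro mult_left_mono sum_le_suminf summable_geometric) auto
  also have "\<dots> = q ^ j0 / (1 - q)"
    using assms by (simp add: suminf_geometric)
  finally show ?thesis .
qed

text \<open>Sort the balls by the dyadic size of their radii. Disjointness separates the centres of
  one level \<open>j\<close> by more than \<open>A * 2 powr (- j)\<close>, so \<open>sep\<close>
  bounds their number, and the contributions of the levels form a geometric series of ratio
  \<open>2 powr (\<tau> - t)\<close> starting at \<open>j0\<close>.\<close>

lemma packing_sum_le:
  fixes F :: "(real^'n::finite) set"
  assumes A: "0 < A" and C: "0 \<le> C" and t: "\<tau> < t" "0 \<le> t"
    and sep: "\<And>j X. \<lbrakk>j0 \<le> j; finite X; X \<subseteq> F;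
        \<And>x y. \<lbrakk>x \<in> X; y \<in> X; x \<noteq> y\<rbrakk> \<Longrightarrow> dist x y > A * 2 powr (- real j)\<rbrakk>
        \<Longrightarrow> real (card X) \<le> C * 2 powr (\<tau> * real j)"
    and B: "finite B" "\<forall>(x, r)\<in>B. x \<in> F \<and> 0 < r \<and> r \<le> 2 * A * 2 powr (- real j0)"
      "disjoint_family_on (\<lambda>(x, r). cball x r) B"
  shows "(\<Sum>(x, r)\<in>B. (2 * r) powr t)
           \<le> C * (4 * A) powr t * ((2 powr (\<tau> - t)) ^ j0 / (1 - 2 powr (\<tau> - t)))"
proof -
  \<comment> \<open>The level of a ball is the \<open>j\<close> with
    \<open>A * 2 powr (- j) < r \<le> 2 * A * 2 powr (- j)\<close>. The bound on the radii gives
    \<open>j0 \<le> j\<close>, so the logarithm is nonnegative and \<open>nat\<close> loses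
    nothing.\<close>
  define lev where "lev = (\<lambda>(x::real^'n, r). nat \<lfloor>log 2 (2 * A / r)\<rfloor>)"
  have lev: "j0 \<le> lev (x, r) \<and> A * 2 powr (- real (lev (x, r))) < r
      \<and> r \<le> 2 * A * 2 powr (- real (lev (x, r)))" if xr: "(x, r) \<in> B" for x r
  proof -
    have r: "0 < r" "r \<le> 2 * A * 2 powr (- real j0)" using B(2) xr by auto
    have "2 powr real j0 \<le> 2 * A / r"
      using r by (simp add: powr_minus field_simps)
    then have ge: "real j0 \<le> log 2 (2 * A / r)"
      using r A by (simp add: le_log_iff)
    then have fl: "real (lev (x, r)) = real_of_int \<lfloor>log 2 (2 * A / r)\<rfloor>"
      unfolding lev_def by simp
    have 1: "j0 \<le> lev (x, r)" using ge unfolding lev_def by (simp add: le_nat_floor)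
    have "real (lev (x, r)) \<le> log 2 (2 * A / r)" using fl by linarith
    then have 2: "2 powr real (lev (x, r)) \<le> 2 * A / r"
      using r A by (simp add: le_log_iff)
    have "log 2 (2 * A / r) < real (lev (x, r)) + 1" using fl by linarith
    then have 3: "2 * A / r < 2 powr (real (lev (x, r)) + 1)"
      using r A by (simp add: log_less_iff)
    show ?thesis using 1 2 3 r by (simp add: powr_minus powr_add field_simps)
  qed
  \<comment> \<open>Disjoint balls cannot share a centre, so counting centres counts balls.\<close>
  have inj: "inj_on fst B"
  proof (rule inj_onI)
    fix a b assume ab: "a \<in> B" "b \<in> B" "fst a = fst b"
    have "0 < snd a" "0 < snd b" using B(2) ab by auto
    then have "fst a \<in> cball (fst a) (snd a) \<inter> cball (fst b) (snd b)"
      using ab by simp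
    then show "a = b" using B(3) ab unfolding disjoint_family_on_def case_prod_beta
      by blast
  qed
  have cnt: "real (card {b \<in> B. lev b = j}) \<le> C * 2 powr (\<tau> * real j)" if "j0 \<le> j" for j
  proof -
    let ?X = "fst ` {b \<in> B. lev b = j}"
    have "card ?X = card {b \<in> B. lev b = j}"
      by (rule card_image) (use inj in \<open>auto intro: inj_on_subset\<close>)
    moreover have "real (card ?X) \<le> C * 2 powr (\<tau> * real j)"
    proof (rule sep[OF that])
      fix x y assume "x \<in> ?X" "y \<in> ?X" and ne: "x \<noteq> y"
      then obtain r r' where r: "(x, r) \<in> B" "lev (x, r) = j" "(y, r') \<in> B" "lev (y, r') = j" by auto
      have "cball x r \<inter> cball y r' = {}"
        using B(3) r ne unfolding disjoint_family_on_def by fastforce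
      moreover have "0 < r'" using B(2) r(3) by auto
      then have "y \<in> cball y r'" by simp
      ultimately have "y \<notin> cball x r" by blast
      then have "r < dist x y" by simp
      then show "dist x y > A * 2 powr (- real j)" using lev[OF r(1)] r by simp
    qed (use B in auto)
    ultimately show ?thesis by simp
  qed
  have "(\<Sum>(x, r)\<in>B. (2 * r) powr t) = (\<Sum>j\<in>lev ` B. \<Sum>b\<in>{b \<in> B. lev b = j}. (2 * snd b) powr t)"
    using sum.image_gen[OF B(1), of "\<lambda>b. (2 * snd b) powr t" lev] by (simp add: case_prod_beta)
  also have "\<dots> \<le> (\<Sum>j\<in>lev ` B. C * (4 * A) powr t * (2 powr (\<tau> - t)) ^ j)"
  proof (rule sum_mono)
    fix j assume "j \<in> lev ` B"
    then have j: "j0 \<le> j" using lev by auto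
    have "(\<Sum>b\<in>{b \<in> B. lev b = j}. (2 * snd b) powr t)
        \<le> (\<Sum>b\<in>{b \<in> B. lev b = j}. (4 * A * 2 powr (- real j)) powr t)"
    proof (rule sum_mono)
      fix b assume b: "b \<in> {b \<in> B. lev b = j}"
      obtain x r where [simp]: "b = (x, r)" by force
      have "(x, r) \<in> B" using b by simp
      from lev[OF this] have "2 * r \<le> 4 * A * 2 powr (- real j)" using b by simp
      moreover have "0 < r" using B(2) b by auto
      ultimately show "(2 * snd b) powr t \<le> (4 * A * 2 powr (- real j)) powr t"
        using t by (auto intro!: powr_mono2)
    qed
    also have "\<dots> = real (card {b \<in> B. lev b = j}) * (4 * A * 2 powr (- real j)) powr t" by simp
    also have "\<dots> \<le> (C * 2 powr (\<tau> * real j)) * (4 * A * 2 powr (- real j)) powr t"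
      by (intro mult_right_mono cnt j) auto
    also have "\<dots> = C * (4 * A) powr t * (2 powr (\<tau> - t)) ^ j"
    proof -
      have "(4 * A * 2 powr (- real j)) powr t = (4 * A) powr t * 2 powr (- real j * t)"
        using A by (simp add: powr_mult powr_powr)
      moreover have "(2 powr (\<tau> - t)) ^ j = 2 powr (\<tau> * real j) * 2 powr (- real j * t)"
        by (simp add: powr_power powr_add[symmetric] algebra_simps)
      ultimately show ?thesis by simp
    qed
    finally show "(\<Sum>b\<in>{b \<in> B. lev b = j}. (2 * snd b) powr t)
        \<le> C * (4 * A) powr t * (2 powr (\<tau> - t)) ^ j" .
  qed
  also have "\<dots> = C * (4 * A) powr t * (\<Sum>j\<in>lev ` B. (2 powr (\<tau> - t)) ^ j)"
    by (simp add: sum_distrib_left)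
  also have "\<dots> \<le> C * (4 * A) powr t * ((2 powr (\<tau> - t)) ^ j0 / (1 - 2 powr (\<tau> - t)))"
    using B(1) lev C t by (intro mult_left_mono sum_geometric_tail_le) (auto simp: powr_less_one)
  finally show ?thesis .
qed

text \<open>The radius \<open>2 * A * 2 powr (- j0)\<close> is an admissible \<open>\<delta>\<close>
  for every \<open>j0 \<ge> J\<close>, and the geometric tail in the resulting bound tends to 0 as
  \<open>j0\<close> grows.\<close>

lemma packing_pre_eq_0:
  fixes F :: "(real^'n::finite) set"
  assumes A: "0 < A" and C: "0 \<le> C" and t: "\<tau> < t" "0 \<le> t"
    and sep: "\<And>j X. \<lbrakk>J \<le> j; finite X; X \<subseteq> F;
        \<And>x y. \<lbrakk>x \<in> X; y \<in> X; x \<noteq> y\<rbrakk> \<Longrightarrow> dist x y > A * 2 powr (- real j)\<rbrakk>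
        \<Longrightarrow> real (card X) \<le> C * 2 powr (\<tau> * real j)"
  shows "packing_pre t F = 0"
proof -
  define q where "q = (2::real) powr (\<tau> - t)"
  have q: "0 < q" "q < 1" unfolding q_def using t by (auto simp: powr_less_one)
  have bound: "packing_pre t F \<le> ennreal (C * (4 * A) powr t * (q ^ j0 / (1 - q)))" if "J \<le> j0" for j0
    unfolding packing_pre_def
  proof (rule INF_lower2[where i = "2 * A * 2 powr (- real j0)"])
    show "2 * A * 2 powr (- real j0) \<in> {0<..}" using A by simp
    show "(SUP B\<in>{B. finite B \<and> (\<forall>(x, r)\<in>B. x \<in> F \<and> 0 < r \<and> r \<le> 2 * A * 2 powr (- real j0)) \<and>
                              disjoint_family_on (\<lambda>(x, r). cball x r) B}.
        (\<Sum>(x, r)\<in>B. ennreal ((2 * r) powr t))) \<le> ennreal (C * (4 * A) powr t * (q ^ j0 / (1 - q)))"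
    proof (rule SUP_least, clarify)
      fix B :: "((real^'n) \<times> real) set"
      assume B: "finite B" "\<forall>(x, r)\<in>B. x \<in> F \<and> 0 < r \<and> r \<le> 2 * A * 2 powr (- real j0)"
         "disjoint_family_on (\<lambda>(x, r). cball x r) B"
      have "(\<Sum>(x, r)\<in>B. ennreal ((2 * r) powr t)) = ennreal (\<Sum>(x, r)\<in>B. (2 * r) powr t)"
        using sum_ennreal[of B "\<lambda>b. (2 * snd b) powr t"] unfolding case_prod_beta by simp
      also have "\<dots> \<le> ennreal (C * (4 * A) powr t * (q ^ j0 / (1 - q)))"
        unfolding q_def using that by (intro ennreal_leI packing_sum_le[OF A C t sep B]) auto
      finally show "(\<Sum>(x, r)\<in>B. ennreal ((2 * r) powr t)) \<le> ennreal (C * (4 * A) powr t * (q ^ j0 / (1 - q)))" .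
    qed
  qed
  have lim: "(\<lambda>j0. ennreal (C * (4 * A) powr t * (q ^ j0 / (1 - q)))) \<longlonglongrightarrow> ennreal (C * (4 * A) powr t * (0 / (1 - q)))"
    using q by (intro tendsto_intros LIMSEQ_power_zero) auto
  have "packing_pre t F \<le> ennreal (C * (4 * A) powr t * (0 / (1 - q)))"
    by (rule LIMSEQ_le_const[OF lim]) (use bound in blast)
  then show ?thesis by simp
qed

text \<open>The premeasure is not countably subadditive, so it is the pieces of a countable cover,
  chosen for each \<open>t\<close>, that have to be null.\<close>

lemma packing_dim_le:
  fixes E :: "(real^'n::finite) set"
  assumes "0 \<le> D" and "\<And>t. D < t \<Longrightarrow> \<exists>F :: nat \<Rightarrow> (real^'n) set. E \<subseteq> (\<Union>i. F i) \<and> (\<forall>i. packing_pre t (F i) = 0)"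
  shows "packing_dim E \<le> ereal D"
proof -
  have "packing_dim E \<le> ereal t" if "D < t" for t
  proof -
    obtain F :: "nat \<Rightarrow> (real^'n) set" where F: "E \<subseteq> (\<Union>i. F i)" "\<forall>i. packing_pre t (F i) = 0"
      using assms(2)[OF \<open>D < t\<close>] by blast
    have "packing_measure t E \<le> (\<Sum>i. packing_pre t (F i))"
      unfolding packing_measure_def using F(1) by (intro INF_lower) auto
    also have "\<dots> = 0" using F(2) by simp
    finally have "packing_measure t E = 0" by simp
    then show ?thesis unfolding packing_dim_def using that assms(1) by (intro Inf_lower) auto
  qed
  then have "packing_dim E \<le> ereal D + ereal e" if "0 < e" for e
    using that by simp
  then show ?thesis by (rule ereal_le_epsilon2)
qed

subsection \<open>Upper bound for the packing dimension\<close>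

lemma finite_int_vec_box: "finite {k :: int^'n::finite. \<forall>m. \<bar>k $ m\<bar> \<le> b}"
proof -
  have "{k :: int^'n. \<forall>m. \<bar>k $ m\<bar> \<le> b} \<subseteq> vec_lambda ` (UNIV \<rightarrow>\<^sub>E {-b..b})"
  proof
    fix k :: "int^'n" assume "k \<in> {k. \<forall>m. \<bar>k $ m\<bar> \<le> b}"
    then have "k $ m \<in> {-b..b}" for m by (simp add: abs_le_iff minus_le_iff)
    then have "vec_nth k \<in> UNIV \<rightarrow>\<^sub>E {-b..b}" by auto
    moreover have "k = vec_lambda (vec_nth k)" by simp
    ultimately show "k \<in> vec_lambda ` (UNIV \<rightarrow>\<^sub>E {-b..b})" by blast
  qed
  then show ?thesis by (rule finite_subset) (auto intro!: finite_imageI finite_PiE)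
qed

text \<open>The bound is uniform in the centre \<open>y\<close> because translating by the integer
  part of \<open>y\<close> moves all candidates into one fixed box. It limits the number of wavelets
  of one generation that are nonzero at a point.\<close>

lemma lattice_ball_card:
  "\<exists>N. \<forall>y. finite {k :: int^'n::finite. norm (y - ivec k) \<le> R} \<and> card {k :: int^'n. norm (y - ivec k) \<le> R} \<le> N"
proof -
  define S where "S = {k :: int^'n. \<forall>m. \<bar>k $ m\<bar> \<le> \<lceil>R\<rceil> + 1}"
  have fin: "finite S" unfolding S_def by (rule finite_int_vec_box)
  have sub: "{k :: int^'n. norm (y - ivec k) \<le> R} \<subseteq> (\<lambda>k. (\<chi> m. \<lfloor>y $ m\<rfloor>) + k) ` S" for y :: "real^'n"
  proof
    fix k :: "int^'n" assume "k \<in> {k. norm (y - ivec k) \<le> R}"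
    then have k: "\<bar>y $ m - real_of_int (k $ m)\<bar> \<le> R" for m
      using component_le_norm_cart[of "y - ivec k" m] by (simp add: ivec_def)
    have "\<bar>k $ m - \<lfloor>y $ m\<rfloor>\<bar> \<le> \<lceil>R\<rceil> + 1" for m
    proof -
      have "\<bar>real_of_int (k $ m) - real_of_int \<lfloor>y $ m\<rfloor>\<bar> \<le> R + 1" using k[of m] by linarith
      then have "real_of_int \<bar>k $ m - \<lfloor>y $ m\<rfloor>\<bar> \<le> real_of_int (\<lceil>R\<rceil> + 1)"
        using le_of_int_ceiling[of R] by (simp del: le_of_int_ceiling)
      then show ?thesis by linarith
    qed
    then have "k - (\<chi> m. \<lfloor>y $ m\<rfloor>) \<in> S" unfolding S_def by simp
    moreover have "k = (\<chi> m. \<lfloor>y $ m\<rfloor>) + (k - (\<chi> m. \<lfloor>y $ m\<rfloor>))" by simp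
    ultimately show "k \<in> (\<lambda>k. (\<chi> m. \<lfloor>y $ m\<rfloor>) + k) ` S" by blast
  qed
  have "finite {k :: int^'n. norm (y - ivec k) \<le> R} \<and> card {k :: int^'n. norm (y - ivec k) \<le> R} \<le> card S" for y :: "real^'n"
  proof
    show "finite {k :: int^'n. norm (y - ivec k) \<le> R}"
      using finite_subset[OF sub] fin by blast
    show "card {k :: int^'n. norm (y - ivec k) \<le> R} \<le> card S"
      using card_mono[OF _ sub[of y]] card_image_le[OF fin, of "\<lambda>k. (\<chi> m. \<lfloor>y $ m\<rfloor>) + k"] fin
      by (meson finite_imageI le_trans)
  qed
  then show ?thesis by blast
qed

lemma compact_support_norm_le:
  assumes "compact_support g"
  shows "\<exists>R. \<forall>x. g x \<noteq> 0 \<longrightarrow> norm x \<le> R"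
proof -
  have "bounded (closure {x. g x \<noteq> 0})"
    using assms unfolding compact_support_def by (rule compact_imp_bounded)
  then obtain R where "\<forall>x\<in>closure {x. g x \<noteq> 0}. norm x \<le> R"
    unfolding bounded_iff by auto
  moreover have "x \<in> closure {x. g x \<noteq> 0}" if "g x \<noteq> 0" for x
    using that closure_subset[of "{x. g x \<noteq> 0}"] by auto
  ultimately show ?thesis by auto
qed

lemma smooth_decay_continuous:
  assumes "smooth_decay r g" shows "continuous_on UNIV g"
  using assms unfolding smooth_decay_def by (auto simp: Let_def dest!: spec[where x = "[]"])

lemma smooth_decay_bounded:
  fixes g :: "real^'n::finite \<Rightarrow> complex"
  assumes "smooth_decay r g"
  shows "\<exists>B. \<forall>x. cmod (g x) \<le> B"
proof -
  have "fast_decay g"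
    using assms unfolding smooth_decay_def by (auto simp: Let_def dest!: spec[where x = "[]"])
  then obtain C where C: "\<And>x. cmod (g x) \<le> C * (1 + supnorm x) powr (- 0)"
    unfolding fast_decay_def by (metis order_refl)
  \<comment> \<open>Decay of order 0 is boundedness by \<open>C\<close>, because
    \<open>y powr 0 = 1\<close> for \<open>y \<noteq> 0\<close>, and the base
    \<open>1 + supnorm x\<close> is positive.\<close>
  have "0 \<le> supnorm x" for x :: "real^'n"
    unfolding supnorm_def by (rule order_trans[OF abs_ge_zero Max_ge]) auto
  then have "0 < 1 + supnorm x" for x :: "real^'n"
    by (metis add_pos_nonneg zero_less_one)
  then have "cmod (g x) \<le> C" for x
    using C[of x] by (metis minus_zero mult.right_neutral powr_zero_eq_one less_irrefl)
  then show ?thesis by blast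
qed

lemma uniform_support_bound:
  fixes \<psi> :: "nat \<Rightarrow> real^'n::finite \<Rightarrow> complex"
  assumes "finite I" "\<forall>i\<in>I. compact_support (\<psi> i)" "\<forall>i\<in>I. smooth_decay r (\<psi> i)"
  shows "\<exists>R B. 0 < R \<and> 0 < B \<and> (\<forall>i\<in>I. \<forall>x. cmod (\<psi> i x) \<le> B \<and> (\<psi> i x \<noteq> 0 \<longrightarrow> norm x \<le> R))"
proof -
  have "\<forall>i\<in>I. \<exists>R. \<forall>x. \<psi> i x \<noteq> 0 \<longrightarrow> norm x \<le> R"
    using assms(2) compact_support_norm_le by blast
  then obtain R where R: "\<And>i x. i \<in> I \<Longrightarrow> \<psi> i x \<noteq> 0 \<Longrightarrow> norm x \<le> R i" by metis
  have "\<forall>i\<in>I. \<exists>B. \<forall>x. cmod (\<psi> i x) \<le> B"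
    using assms(3) smooth_decay_bounded by blast
  then obtain B where B: "\<And>i x. i \<in> I \<Longrightarrow> cmod (\<psi> i x) \<le> B i" by metis
  \<comment> \<open>Inserting 1 keeps both maxima positive, and defined when \<open>I\<close> is
    empty.\<close>
  define R' B' where "R' = Max (insert 1 (R ` I))" and "B' = Max (insert 1 (B ` I))"
  have "1 \<le> R'" "1 \<le> B'" unfolding R'_def B'_def using assms(1) by auto
  moreover have "R i \<le> R'" "B i \<le> B'" if "i \<in> I" for i
    unfolding R'_def B'_def using assms(1) that by auto
  ultimately have "0 < R'" "0 < B'" "\<forall>i\<in>I. \<forall>x. cmod (\<psi> i x) \<le> B' \<and> (\<psi> i x \<noteq> 0 \<longrightarrow> norm x \<le> R')"
    using order_trans[OF R] order_trans[OF B] by auto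
  then show ?thesis by blast
qed

lemma infsum_finite_support:
  fixes f :: "'a \<Rightarrow> 'b::{topological_comm_monoid_add, t2_space}"
  assumes "finite S" "\<And>k. k \<notin> S \<Longrightarrow> f k = 0"
  shows "infsum f UNIV = sum f S"
proof -
  have "infsum f UNIV = infsum f S"
    by (rule infsum_cong_neutral) (use assms in auto)
  then show ?thesis using assms(1) by simp
qed

text \<open>At a given point at most \<open>N\<close> translates per wavelet index are nonzero, so
  only their coefficients matter. The resulting constant depends neither on the generation nor on
  the point.\<close>

lemma Qop_bound:
  fixes \<psi> :: "nat \<Rightarrow> real^'n::finite \<Rightarrow> complex"
  defines "I \<equiv> {1..2^CARD('n) - 1 :: nat}"
  assumes N: "\<And>y. finite {k :: int^'n. norm (y - ivec k) \<le> R} \<and> card {k :: int^'n. norm (y - ivec k) \<le> R} \<le> N"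
    and RB: "\<And>i x. i \<in> I \<Longrightarrow> cmod (\<psi> i x) \<le> B \<and> (\<psi> i x \<noteq> 0 \<longrightarrow> norm x \<le> R)"
    and \<tau>: "0 \<le> \<tau>" and B: "0 \<le> B"
    and le: "\<And>i k. i \<in> I \<Longrightarrow> \<psi> i ((2 ^ l) *\<^sub>R x - ivec k) \<noteq> 0 \<Longrightarrow> cmod (wcoef \<psi> f i l k) \<le> \<tau>"
  shows "cmod (Qop \<psi> f l x) \<le> real (card I) * (real N * (\<tau> * B))"
proof -
  define S where "S = {k :: int^'n. norm ((2 ^ l) *\<^sub>R x - ivec k) \<le> R}"
  have S: "finite S" "card S \<le> N" unfolding S_def using N by auto
  have zero: "wcoef \<psi> f i l k * \<psi> i ((2 ^ l) *\<^sub>R x - ivec k) = 0" if "i \<in> I" "k \<notin> S" for i k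
    using RB[OF that(1)] that(2) unfolding S_def by fastforce
  have "cmod (Qop \<psi> f l x) \<le> (\<Sum>i\<in>I. cmod (infsum (\<lambda>k. wcoef \<psi> f i l k * \<psi> i ((2 ^ l) *\<^sub>R x - ivec k)) UNIV))"
    unfolding Qop_def I_def by (rule norm_sum)
  also have "\<dots> \<le> (\<Sum>i\<in>I. real N * (\<tau> * B))"
  proof (rule sum_mono)
    fix i assume i: "i \<in> I"
    have "cmod (infsum (\<lambda>k. wcoef \<psi> f i l k * \<psi> i ((2 ^ l) *\<^sub>R x - ivec k)) UNIV)
       = cmod (\<Sum>k\<in>S. wcoef \<psi> f i l k * \<psi> i ((2 ^ l) *\<^sub>R x - ivec k))"
      by (subst infsum_finite_support[OF S(1)]) (use zero[OF i] in auto)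
    also have "\<dots> \<le> (\<Sum>k\<in>S. \<tau> * B)"
    proof (rule order_trans[OF norm_sum sum_mono])
      fix k assume "k \<in> S"
      show "cmod (wcoef \<psi> f i l k * \<psi> i ((2 ^ l) *\<^sub>R x - ivec k)) \<le> \<tau> * B"
      proof (cases "\<psi> i ((2 ^ l) *\<^sub>R x - ivec k) = 0")
        case False
        then show ?thesis using le[OF i] RB[OF i] \<tau> by (simp add: norm_mult mult_mono)
      qed (use \<tau> B in simp)
    qed
    also have "\<dots> = real (card S) * (\<tau> * B)" by simp
    also have "\<dots> \<le> real N * (\<tau> * B)" using S(2) \<tau> B by (intro mult_right_mono) auto
    finally show "cmod (infsum (\<lambda>k. wcoef \<psi> f i l k * \<psi> i ((2 ^ l) *\<^sub>R x - ivec k)) UNIV) \<le> real N * (\<tau> * B)" .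
  qed
  finally show ?thesis by simp
qed

text \<open>Chebyshev's inequality for the weighted \<open>p\<close>-sum of the coefficients of one
  generation. The constant is the \<open>p\<close>-th power of a bound of \<open>besov_eps\<close>,
  hence the same for all generations and thresholds.\<close>

lemma besov_card_large:
  fixes \<psi> :: "nat \<Rightarrow> real^'n::finite \<Rightarrow> complex"
  assumes p: "1 \<le> p" and f: "besov \<phi> \<psi> s p \<infinity> f"
  shows "\<exists>K\<ge>0. \<forall>l \<tau> G. 0 < \<tau> \<longrightarrow> finite G \<longrightarrow> G \<subseteq> {1..2^CARD('n) - 1} \<times> UNIV \<longrightarrow>
            (\<forall>(i, k)\<in>G. \<tau> \<le> cmod (wcoef \<psi> f i l k)) \<longrightarrow>
            real (card G) * \<tau> powr p \<le> K * 2 powr ((real CARD('n) - s * p) * real l)"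
proof -
  let ?I = "{1..2^CARD('n) - 1 :: nat}"
  have sm: "(\<lambda>k. cmod (wcoef \<psi> f i j k) powr p) summable_on UNIV" if "i \<in> ?I" for i j
    using f that unfolding besov_def by blast
  from f have "bounded (range (besov_eps \<psi> s p f))" unfolding besov_def by simp
  then obtain K0 where K0: "\<And>j. \<bar>besov_eps \<psi> s p f j\<bar> \<le> K0"
    unfolding bounded_iff by auto
  have "real (card G) * \<tau> powr p \<le> \<bar>K0\<bar> powr p * 2 powr ((real CARD('n) - s * p) * real l)"
    if \<tau>: "0 < \<tau>" and G: "finite G" "G \<subseteq> ?I \<times> UNIV" "\<forall>(i, k)\<in>G. \<tau> \<le> cmod (wcoef \<psi> f i l k)" for l \<tau> G
  proof -
    define \<Sigma> where "\<Sigma> = (\<Sum>i\<in>?I. infsum (\<lambda>k. cmod (wcoef \<psi> f i l k) powr p) UNIV)"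
    have "real (card G) * \<tau> powr p = (\<Sum>(i, k)\<in>G. \<tau> powr p)" by simp
    also have "\<dots> \<le> (\<Sum>(i, k)\<in>G. cmod (wcoef \<psi> f i l k) powr p)"
      using G(3) \<tau> p by (intro sum_mono) (auto intro!: powr_mono2)
    also have "\<dots> \<le> (\<Sum>(i, k)\<in>?I \<times> snd ` G. cmod (wcoef \<psi> f i l k) powr p)"
      using G by (intro sum_mono2) (force intro: rev_image_eqI)+
    also have "\<dots> = (\<Sum>i\<in>?I. \<Sum>k\<in>snd ` G. cmod (wcoef \<psi> f i l k) powr p)"
      by (simp add: sum.cartesian_product)
    also have "\<dots> \<le> \<Sigma>" unfolding \<Sigma>_def
    proof (rule sum_mono)
      fix i assume "i \<in> ?I"
      from finite_sum_le_infsum[OF sm[OF this, of l], of "snd ` G"] G(1)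
      show "(\<Sum>k\<in>snd ` G. cmod (wcoef \<psi> f i l k) powr p) \<le> infsum (\<lambda>k. cmod (wcoef \<psi> f i l k) powr p) UNIV"
        by simp
    qed
    finally have 1: "real (card G) * \<tau> powr p \<le> \<Sigma>" .
    have \<Sigma>0: "0 \<le> \<Sigma>" unfolding \<Sigma>_def by (intro sum_nonneg infsum_nonneg) auto
    define e where "e = (s - real CARD('n) / p) * real l"
    have "2 powr e * \<Sigma> powr (1 / p) \<le> \<bar>K0\<bar>"
      using K0[of l] unfolding besov_eps_def \<Sigma>_def[symmetric] e_def by simp
    then have "(2 powr e * \<Sigma> powr (1 / p)) powr p \<le> \<bar>K0\<bar> powr p"
      using p by (intro powr_mono2) auto
    moreover have "(2 powr e * \<Sigma> powr (1 / p)) powr p = 2 powr (e * p) * \<Sigma>"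
      using p \<Sigma>0 by (simp add: powr_mult powr_powr)
    moreover have "e * p = - ((real CARD('n) - s * p) * real l)"
      using p unfolding e_def by (simp add: field_simps)
    ultimately have "2 powr (- ((real CARD('n) - s * p) * real l)) * \<Sigma> \<le> \<bar>K0\<bar> powr p"
      by metis
    then have "\<Sigma> \<le> \<bar>K0\<bar> powr p * 2 powr ((real CARD('n) - s * p) * real l)"
      unfolding powr_minus by (simp add: divide_simps mult.commute)
    with 1 show ?thesis by linarith
  qed
  then show ?thesis by (intro exI[of _ "\<bar>K0\<bar> powr p"]) simp
qed

text \<open>Zero has rate \<open>- \<infinity>\<close>, so a rate above a real number already
  excludes \<open>z = 0\<close>.\<close>

lemma log2rate_gt_imp:
  assumes "ereal a < log2rate z j" "0 < j"
  shows "2 powr (a * real j) < cmod z"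
proof -
  have z: "z \<noteq> 0" "a < ln (cmod z) / (real j * ln 2)"
    using assms(1) unfolding log2rate_def by (auto split: if_splits)
  then have "a * real j * ln 2 < ln (cmod z)"
    using assms(2) by (simp add: pos_less_divide_eq mult.assoc)
  then have "exp (a * real j * ln 2) < exp (ln (cmod z))" by simp
  then show ?thesis using z(1) by (simp add: powr_def)
qed

text \<open>Giving up \<open>\<epsilon>\<close> turns the lower limit into an inequality valid from
  some index \<open>J\<close> on. The union over \<open>J\<close> is the countable cover that bounds
  the packing measure.\<close>

lemma Eplus_neg_subset:
  assumes "\<beta> < 0" "0 < \<epsilon>"
  shows "Eplus \<phi> \<psi> \<beta> f \<subseteq> (\<Union>J. {x. \<forall>j\<ge>J. 2 powr ((\<beta> - \<epsilon>) * real j) \<le> cmod (Rop \<psi> f j x)})"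
proof
  fix x assume "x \<in> Eplus \<phi> \<psi> \<beta> f"
  then have "ereal \<beta> \<le> Liminf sequentially (\<lambda>j. log2rate (Rop \<psi> f j x) j)"
    using assms unfolding Eplus_def by auto
  then have "eventually (\<lambda>j. ereal (\<beta> - \<epsilon>) < log2rate (Rop \<psi> f j x) j) sequentially"
    using assms(2) unfolding le_Liminf_iff by simp
  then have "eventually (\<lambda>j. 2 powr ((\<beta> - \<epsilon>) * real j) \<le> cmod (Rop \<psi> f j x)) sequentially"
    using eventually_gt_at_top[of 0] by eventually_elim (auto dest: log2rate_gt_imp)
  then show "x \<in> (\<Union>J. {x. \<forall>j\<ge>J. 2 powr ((\<beta> - \<epsilon>) * real j) \<le> cmod (Rop \<psi> f j x)})"
    unfolding eventually_sequentially by auto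
qed

text \<open>On one piece of the cover, points separated at scale \<open>j\<close> are assigned
  distinct coefficients of generations \<open>l \<ge> j\<close>, of size at least
  \<open>c0 * 2 powr (\<beta> * j - \<epsilon> * l)\<close>. Counting these by
  \<open>besov_card_large\<close> and summing over \<open>l\<close> gives the exponent
  \<open>d - s * p - \<beta> * p + \<epsilon> * p\<close>, which is below \<open>t\<close>.\<close>

lemma packing_dim_Eplus_le:
  fixes \<phi> :: "real^'n::finite \<Rightarrow> complex" and \<psi> :: "nat \<Rightarrow> real^'n \<Rightarrow> complex"
  defines "d \<equiv> real CARD('n)" and "I \<equiv> {1..2^CARD('n) - 1 :: nat}"
  assumes supp: "\<forall>i\<in>I. compact_support (\<psi> i)" and smooth: "\<forall>i\<in>I. smooth_decay r (\<psi> i)"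
    and p: "1 \<le> p" and neg: "d - s * p < 0" and \<beta>: "\<beta> < d / p - s"
    and f: "besov \<phi> \<psi> s p \<infinity> f"
  shows "packing_dim (Eplus \<phi> \<psi> \<beta> f) \<le> ereal (d - s * p - \<beta> * p)"
proof (rule packing_dim_le)
  have "d / p - s < 0" using neg p by (simp add: field_simps)
  then have \<beta>0: "\<beta> < 0" using \<beta> by simp
  show "0 \<le> d - s * p - \<beta> * p" using \<beta> p by (simp add: field_simps)
  fix t assume t: "d - s * p - \<beta> * p < t"
  obtain R B where RB: "0 < R" "0 < B"
    "\<And>i x. i \<in> I \<Longrightarrow> cmod (\<psi> i x) \<le> B \<and> (\<psi> i x \<noteq> 0 \<longrightarrow> norm x \<le> R)"
    using uniform_support_bound[OF _ supp smooth] unfolding I_def by blast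
  obtain N where N: "\<And>y. finite {k :: int^'n. norm (y - ivec k) \<le> R} \<and> card {k :: int^'n. norm (y - ivec k) \<le> R} \<le> N"
    using lattice_ball_card by blast
  obtain K where K: "0 \<le> K" "\<And>l \<tau> G. \<lbrakk>0 < \<tau>; finite G; G \<subseteq> I \<times> UNIV;
      \<forall>(i, k)\<in>G. \<tau> \<le> cmod (wcoef \<psi> f i l k)\<rbrakk> \<Longrightarrow> real (card G) * \<tau> powr p \<le> K * 2 powr ((d - s * p) * real l)"
    using besov_card_large[OF p f] unfolding I_def d_def by blast
  \<comment> \<open>The summand 1 makes \<open>Cq\<close> positive even when the other term
    vanishes.\<close>
  define Cq where "Cq = real (card I) * (real N * B) + 1"
  have Cq: "0 < Cq" unfolding Cq_def using RB(2) by (simp add: add_nonneg_pos)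
  have Qb: "cmod (Qop \<psi> f l x) \<le> Cq * \<tau>"
    if "0 \<le> \<tau>" "\<And>i k. i \<in> I \<Longrightarrow> \<psi> i ((2 ^ l) *\<^sub>R x - ivec k) \<noteq> 0 \<Longrightarrow> cmod (wcoef \<psi> f i l k) \<le> \<tau>" for l x \<tau>
  proof -
    have "cmod (Qop \<psi> f l x) \<le> real (card I) * (real N * (\<tau> * B))"
      unfolding I_def by (rule Qop_bound[of R]) (use N RB that in \<open>auto simp: I_def\<close>)
    also have "\<dots> \<le> Cq * \<tau>" unfolding Cq_def using that by (simp add: algebra_simps)
    finally show ?thesis .
  qed
  \<comment> \<open>The first term of the minimum keeps the counting exponent below
    \<open>t\<close>, the second keeps \<open>d - s * p + \<epsilon> * p\<close> negative, so that
    the counts can be summed over the generations.\<close>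
  define \<epsilon> where "\<epsilon> = min ((t - (d - s * p - \<beta> * p)) / (2 * p)) ((s * p - d) / (2 * p))"
  have \<epsilon>: "0 < \<epsilon>" unfolding \<epsilon>_def using t neg p by simp
  have \<epsilon>1: "d - s * p - \<beta> * p + \<epsilon> * p < t"
  proof -
    have "\<epsilon> * p \<le> (t - (d - s * p - \<beta> * p)) / (2 * p) * p" unfolding \<epsilon>_def using p by (intro mult_right_mono) auto
    also have "\<dots> = (t - (d - s * p - \<beta> * p)) / 2" using p by simp
    finally have "2 * (\<epsilon> * p) \<le> t - (d - s * p - \<beta> * p)" by simp
    then show ?thesis using t by linarith
  qed
  have \<epsilon>2: "d - s * p + \<epsilon> * p < 0"
  proof -
    have "\<epsilon> * p \<le> (s * p - d) / (2 * p) * p" unfolding \<epsilon>_def using p by (intro mult_right_mono) auto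
    also have "\<dots> = (s * p - d) / 2" using p by simp
    finally have "2 * (\<epsilon> * p) \<le> s * p - d" by simp
    then show ?thesis using neg by linarith
  qed
  define w where "w = (2::real) powr (- \<epsilon>)"
  have w: "0 < w" "w < 1" unfolding w_def using \<epsilon> by (auto simp: powr_less_one)
  \<comment> \<open>Chosen so that coefficients below the threshold add up to at most half of the
    assumed size of the remainder.\<close>
  define c0 where "c0 = (1 - w) / (2 * Cq)"
  have c0: "0 < c0" unfolding c0_def using w Cq by simp
  define q where "q = (2::real) powr (d - s * p + \<epsilon> * p)"
  have q: "0 < q" "q < 1" unfolding q_def using \<epsilon>2 by (auto simp: powr_less_one)
  let ?F = "\<lambda>J. {x. \<forall>j\<ge>J. 2 powr ((\<beta> - \<epsilon>) * real j) \<le> cmod (Rop \<psi> f j x)}"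
  \<comment> \<open>The threshold decreases by the factor \<open>w\<close> per generation and is
    therefore summable; if no active coefficient reached it, the remainder would be too
    small.\<close>
  have large: "\<exists>l i k. j \<le> l \<and> i \<in> I \<and> \<psi> i ((2 ^ l) *\<^sub>R x - ivec k) \<noteq> 0
      \<and> c0 * 2 powr (\<beta> * real j - \<epsilon> * real l) \<le> cmod (wcoef \<psi> f i l k)"
    if x: "2 powr ((\<beta> - \<epsilon>) * real j) \<le> cmod (Rop \<psi> f j x)" for x j
  proof (rule ccontr)
    assume no: "\<not> ?thesis"
    have Q: "cmod (Qop \<psi> f (n + j) x) \<le> Cq * (c0 * 2 powr ((\<beta> - \<epsilon>) * real j)) * w ^ n" for n
    proof -
      have "cmod (Qop \<psi> f (n + j) x) \<le> Cq * (c0 * 2 powr (\<beta> * real j - \<epsilon> * real (n + j)))"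
      proof (rule Qb)
        fix i k assume "i \<in> I" "\<psi> i ((2 ^ (n + j)) *\<^sub>R x - ivec k) \<noteq> 0"
        then show "cmod (wcoef \<psi> f i (n + j) k) \<le> c0 * 2 powr (\<beta> * real j - \<epsilon> * real (n + j))"
          using no le_add2[of j n] by (metis linear)
      qed (use c0 in simp)
      also have "2 powr (\<beta> * real j - \<epsilon> * real (n + j)) = 2 powr ((\<beta> - \<epsilon>) * real j) * w ^ n"
        unfolding w_def by (simp add: powr_power powr_add[symmetric] algebra_simps)
      finally show ?thesis by simp
    qed
    have "cmod (Rop \<psi> f j x) \<le> (\<Sum>n. Cq * (c0 * 2 powr ((\<beta> - \<epsilon>) * real j)) * w ^ n)"
      unfolding Rop_def using w by (intro norm_suminf_le Q summable_mult summable_geometric) auto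
    also have "\<dots> = Cq * (c0 * 2 powr ((\<beta> - \<epsilon>) * real j)) / (1 - w)"
      using w by (simp add: suminf_mult suminf_geometric summable_geometric)
    also have "\<dots> = 2 powr ((\<beta> - \<epsilon>) * real j) / 2"
      unfolding c0_def using Cq w by (simp add: field_simps)
    also have "\<dots> < 2 powr ((\<beta> - \<epsilon>) * real j)" by simp
    finally show False using x by simp
  qed
  \<comment> \<open>The constant \<open>2 * R\<close> is chosen because points more than
    \<open>2 * R * 2 powr (- j)\<close> apart cannot both see wavelets of one cube of generation at
    least \<open>j\<close>.\<close>
  have "packing_pre t (?F J) = 0" for J
  proof (rule packing_pre_eq_0[where A = "2 * R" and C = "K * c0 powr (- p) / (1 - q)"
          and \<tau> = "d - s * p - \<beta> * p + \<epsilon> * p" and J = J])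
    show "0 < 2 * R" using RB by simp
    show "0 \<le> K * c0 powr (- p) / (1 - q)" using K q by simp
    show "d - s * p - \<beta> * p + \<epsilon> * p < t" by fact
    show "0 \<le> t" using t \<open>0 \<le> d - s * p - \<beta> * p\<close> by simp
    fix j and X :: "(real^'n) set"
    assume j: "J \<le> j" and X: "finite X" "X \<subseteq> ?F J"
      and sep: "\<And>x y. \<lbrakk>x \<in> X; y \<in> X; x \<noteq> y\<rbrakk> \<Longrightarrow> 2 * R * 2 powr (- real j) < dist x y"
    have "\<forall>x\<in>X. \<exists>l i k. j \<le> l \<and> i \<in> I \<and> \<psi> i ((2 ^ l) *\<^sub>R x - ivec k) \<noteq> 0
      \<and> c0 * 2 powr (\<beta> * real j - \<epsilon> * real l) \<le> cmod (wcoef \<psi> f i l k)"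
      using X(2) j by (intro ballI large) auto
    then obtain L \<iota> \<kappa> where LIK: "\<And>x. x \<in> X \<Longrightarrow> j \<le> L x \<and> \<iota> x \<in> I \<and> \<psi> (\<iota> x) ((2 ^ L x) *\<^sub>R x - ivec (\<kappa> x)) \<noteq> 0
      \<and> c0 * 2 powr (\<beta> * real j - \<epsilon> * real (L x)) \<le> cmod (wcoef \<psi> f (\<iota> x) (L x) (\<kappa> x))"
      by metis
    \<comment> \<open>Generation and position determine the point. The wavelet index need not agree,
      since all wavelets vanish outside the same ball of radius \<open>R\<close>.\<close>
    have inj: "x = y" if xy: "x \<in> X" "y \<in> X" "L x = L y" "\<kappa> x = \<kappa> y" for x y
    proof (rule ccontr)
      assume ne: "x \<noteq> y"
      have "norm ((2 ^ L x) *\<^sub>R x - ivec (\<kappa> x)) \<le> R" "norm ((2 ^ L x) *\<^sub>R y - ivec (\<kappa> x)) \<le> R"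
        using LIK[OF xy(1)] LIK[OF xy(2)] RB(3) xy by auto
      then have "norm ((2 ^ L x) *\<^sub>R x - ivec (\<kappa> x) - ((2 ^ L x) *\<^sub>R y - ivec (\<kappa> x))) \<le> R + R"
        by (meson add_mono norm_triangle_ineq4 order_trans)
      moreover have "(2 ^ L x) *\<^sub>R x - ivec (\<kappa> x) - ((2 ^ L x) *\<^sub>R y - ivec (\<kappa> x)) = (2 ^ L x) *\<^sub>R (x - y)"
        by (simp add: algebra_simps)
      ultimately have "2 ^ L x * dist x y \<le> 2 * R" by (simp add: dist_norm)
      moreover have "(2::real) ^ j \<le> 2 ^ L x" using LIK[OF xy(1)] by (intro power_increasing) auto
      ultimately have "2 ^ j * dist x y \<le> 2 * R"
        by (meson mult_right_mono order_trans zero_le_dist)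
      moreover have "2 * R < 2 ^ j * dist x y"
        using sep[OF xy(1,2) ne] by (simp add: powr_minus powr_realpow field_simps)
      ultimately show False by simp
    qed
    \<comment> \<open>Lowering the threshold with \<open>l\<close> costs the factor
      \<open>2 powr (\<epsilon> * p * l)\<close>, which \<open>q\<close> absorbs;
      \<open>\<epsilon>2\<close> is what keeps \<open>q < 1\<close>.\<close>
    have cnt: "real (card {x \<in> X. L x = l}) \<le> K * c0 powr (- p) * 2 powr (- \<beta> * p * real j) * q ^ l" for l
    proof -
      let ?G = "(\<lambda>x. (\<iota> x, \<kappa> x)) ` {x \<in> X. L x = l}"
      let ?\<tau> = "c0 * 2 powr (\<beta> * real j - \<epsilon> * real l)"
      have "card ?G = card {x \<in> X. L x = l}"
        by (rule card_image) (auto intro!: inj_onI inj)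
      moreover have "real (card ?G) * ?\<tau> powr p \<le> K * 2 powr ((d - s * p) * real l)"
        by (rule K(2)) (use X(1) LIK c0 in auto)
      moreover have "?\<tau> powr p = c0 powr p * 2 powr ((\<beta> * real j - \<epsilon> * real l) * p)"
        using c0 by (simp add: powr_mult powr_powr)
      ultimately have "real (card {x \<in> X. L x = l}) * (c0 powr p * 2 powr ((\<beta> * real j - \<epsilon> * real l) * p))
          \<le> K * 2 powr ((d - s * p) * real l)" by simp
      then have "real (card {x \<in> X. L x = l}) \<le> K * 2 powr ((d - s * p) * real l) / (c0 powr p * 2 powr ((\<beta> * real j - \<epsilon> * real l) * p))"
        using c0 by (simp add: pos_le_divide_eq)
      also have "\<dots> = K * c0 powr (- p) * (2 powr ((d - s * p) * real l) / 2 powr ((\<beta> * real j - \<epsilon> * real l) * p))"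
        by (simp add: powr_minus divide_simps)
      also have "2 powr ((d - s * p) * real l) / 2 powr ((\<beta> * real j - \<epsilon> * real l) * p)
          = 2 powr (- \<beta> * p * real j) * q ^ l"
        unfolding q_def by (simp add: powr_power powr_diff[symmetric] powr_add[symmetric] algebra_simps)
      finally show ?thesis by simp
    qed
    have "real (card X) = (\<Sum>x\<in>X. 1)" by simp
    also have "\<dots> = (\<Sum>l\<in>L ` X. \<Sum>x\<in>{x \<in> X. L x = l}. 1)" by (rule sum.image_gen[OF X(1)])
    also have "\<dots> = (\<Sum>l\<in>L ` X. real (card {x \<in> X. L x = l}))" by simp
    also have "\<dots> \<le> (\<Sum>l\<in>L ` X. K * c0 powr (- p) * 2 powr (- \<beta> * p * real j) * q ^ l)"
      by (intro sum_mono cnt)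
    also have "\<dots> = K * c0 powr (- p) * 2 powr (- \<beta> * p * real j) * (\<Sum>l\<in>L ` X. q ^ l)"
      by (simp add: sum_distrib_left)
    \<comment> \<open>Every generation that occurs is at least \<open>j\<close>, so the sum is a
      geometric tail, and its leading factor \<open>q ^ j\<close> supplies the part
      \<open>d - s * p + \<epsilon> * p\<close> of the exponent.\<close>
    also have "\<dots> \<le> K * c0 powr (- p) * 2 powr (- \<beta> * p * real j) * (q ^ j / (1 - q))"
      using K q X(1) LIK by (intro mult_left_mono sum_geometric_tail_le) auto
    also have "\<dots> = K * c0 powr (- p) / (1 - q) * (2 powr (- \<beta> * p * real j) * q ^ j)" by simp
    also have "2 powr (- \<beta> * p * real j) * q ^ j = 2 powr ((d - s * p - \<beta> * p + \<epsilon> * p) * real j)"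
      unfolding q_def by (simp add: powr_power powr_add[symmetric] algebra_simps)
    finally show "real (card X) \<le> K * c0 powr (- p) / (1 - q) * 2 powr ((d - s * p - \<beta> * p + \<epsilon> * p) * real j)" .
  qed
  then show "\<exists>F. Eplus \<phi> \<psi> \<beta> f \<subseteq> (\<Union>i. F i) \<and> (\<forall>i::nat. packing_pre t (F i) = 0)"
    using Eplus_neg_subset[OF \<beta>0 \<epsilon>] by (intro exI[of _ ?F]) blast
qed

subsection \<open>A dyadic Cantor set\<close>

text \<open>Nodes of depth \<open>n\<close> are dyadic intervals of generation \<open>l n\<close>
  with \<open>2 ^ e n\<close> children each. Their cells have relative left end \<open>u\<close> and
  relative width \<open>1 / 2 ^ r\<close>, and \<open>2 ^ w\<close> is a lower bound for the
  distance of nodes of equal depth. \<open>scale_step\<close> leaves room for the children inside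
  the parent cell.\<close>

locale dyadic_tree =
  fixes l e :: "nat \<Rightarrow> nat" and r w :: nat and u :: real
  assumes scale_step: "l n + e n + r + w \<le> l (Suc n)" and w_pos: "1 \<le> w"
begin

text \<open>In units of generation \<open>l (Suc n)\<close> a cell of depth \<open>n\<close> has
  width \<open>2 ^ (gap n + e n)\<close>, so its \<open>2 ^ e n\<close> children can be spaced by
  \<open>2 ^ gap n\<close>.\<close>

definition gap :: "nat \<Rightarrow> nat" where "gap n = l (Suc n) - l n - e n - r"

text \<open>The least integer offset for which the first child cell, itself starting at relative
  position \<open>u\<close>, does not stick out to the left of the parent cell.\<close>

definition shift :: "nat \<Rightarrow> int" where "shift n = \<lceil>(2 ^ (l (Suc n) - l n) - 1) * u\<rceil>"

definition child :: "nat \<Rightarrow> int \<Rightarrow> nat \<Rightarrow> int" where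
  "child n k i = 2 ^ (l (Suc n) - l n) * k + shift n + 2 ^ gap n * int i"

primrec nodes :: "nat \<Rightarrow> int set" where
  "nodes 0 = {0}"
| "nodes (Suc n) = (\<lambda>(k, i). child n k i) ` (nodes n \<times> {..<2 ^ e n})"

text \<open>The points at which the wavelet at node \<open>k\<close> has its argument in the
  interval from \<open>u\<close> to \<open>u + 1 / 2 ^ r\<close>, where it will be bounded away from
  0.\<close>

definition cell :: "nat \<Rightarrow> int \<Rightarrow> real set" where
  "cell n k = {x. u \<le> 2 ^ l n * x - real_of_int k \<and> 2 ^ l n * x - real_of_int k \<le> u + 1 / 2 ^ r}"

definition cantor :: "real set" where
  "cantor = (\<Inter>n. \<Union>k\<in>nodes n. cell n k)"

lemma scale_diff: "l (Suc n) - l n = gap n + e n + r"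
  using scale_step[of n] unfolding gap_def by simp

lemma scale_Suc: "l (Suc n) = l n + gap n + e n + r"
  using scale_step[of n] unfolding gap_def by simp

lemma gap_ge: "w \<le> gap n"
  using scale_step[of n] unfolding gap_def by simp

lemma strict_mono_scale: "strict_mono l"
  unfolding strict_mono_Suc_iff using scale_step w_pos by (metis add.commute add_leD1 add_le_mono less_add_one
      less_le_trans add.assoc le_add1 order_trans)

lemma scale_ge: "n \<le> l n"
  using strict_mono_scale by (rule strict_mono_imp_increasing)

lemma finite_nodes: "finite (nodes n)"
  by (induction n) auto

lemma card_nodes_le: "card (nodes n) \<le> 2 ^ (\<Sum>i<n. e i)"
proof (induction n)
  case (Suc n)
  have "card (nodes (Suc n)) \<le> card (nodes n \<times> {..<2 ^ e n :: nat})"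
    unfolding nodes.simps by (intro card_image_le finite_cartesian_product finite_nodes) auto
  also have "\<dots> \<le> 2 ^ (\<Sum>i<n. e i) * 2 ^ e n" using Suc by (simp add: card_cartesian_product)
  finally show ?case by (simp add: power_add)
qed simp

lemma child_in_nodes: "k \<in> nodes n \<Longrightarrow> i < 2 ^ e n \<Longrightarrow> child n k i \<in> nodes (Suc n)"
  by (auto intro!: image_eqI[where x = "(k, i)"])

text \<open>In units of the finer generation the largest child offset is \<open>2 ^ gap n\<close>
  short of the parent width. The rounding error of \<open>shift\<close> and the width of the child
  cell are at most 1 each, and \<open>2 \<le> 2 ^ gap n\<close> absorbs both.\<close>

lemma cell_child: 
  assumes "i < 2 ^ e n"
  shows "cell (Suc n) (child n k i) \<subseteq> cell n k"
proof
  fix x assume x: "x \<in> cell (Suc n) (child n k i)"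
  define P where "P = (2::real) ^ (l (Suc n) - l n)"
  have P: "P = 2 ^ gap n * 2 ^ e n * 2 ^ r" unfolding P_def scale_diff by (simp add: power_add)
  have P0: "0 < P" unfolding P_def by simp
  have sc: "(2::real) ^ l (Suc n) = P * 2 ^ l n"
    unfolding P_def using scale_Suc[of n] by (simp add: power_add[symmetric])
  have sh: "(P - 1) * u \<le> shift n" "shift n \<le> (P - 1) * u + 1"
    unfolding shift_def P_def by linarith+
  have key: "P * (2 ^ l n * x - k) = (2 ^ l (Suc n) * x - child n k i) + shift n + 2 ^ gap n * real i"
    unfolding child_def sc by (simp add: P_def algebra_simps)
  have lo: "u \<le> 2 ^ l (Suc n) * x - child n k i" and hi: "2 ^ l (Suc n) * x - child n k i \<le> u + 1 / 2 ^ r"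
    using x unfolding cell_def by auto
  have gi: "0 \<le> 2 ^ gap n * real i" by simp
  have "P * u \<le> P * (2 ^ l n * x - k)" 
  proof -
    have "P * u \<le> u + shift n" using sh(1) by (simp add: algebra_simps)
    then show ?thesis unfolding key using lo gi by linarith
  qed
  then have 1: "u \<le> 2 ^ l n * x - k" using P0 by simp
  have "(2::real) ^ 1 \<le> 2 ^ gap n" using gap_ge[of n] w_pos by (intro power_increasing) auto
  then have g2: "2 \<le> (2::real) ^ gap n" by simp
  have "real i + 1 \<le> 2 ^ e n" using assms by (metis Suc_leI of_nat_Suc of_nat_le_iff of_nat_numeral of_nat_power add.commute)
  then have "2 ^ gap n * (real i + 1) \<le> 2 ^ gap n * 2 ^ e n" by (intro mult_left_mono) auto
  then have i: "2 ^ gap n * real i \<le> 2 ^ gap n * 2 ^ e n - 2" using g2 by (simp add: algebra_simps)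
  have r1: "1 / 2 ^ r \<le> (1::real)" by simp
  have "P * (2 ^ l n * x - k) \<le> P * u + 2 ^ gap n * 2 ^ e n"
  proof -
    have "shift n \<le> P * u - u + 1" using sh(2) by (simp add: algebra_simps)
    then show ?thesis unfolding key using hi i r1 by linarith
  qed
  also have "\<dots> = P * (u + 1 / 2 ^ r)" unfolding P by (simp add: algebra_simps)
  finally have 2: "2 ^ l n * x - k \<le> u + 1 / 2 ^ r" using P0 by simp
  show "x \<in> cell n k" using 1 2 unfolding cell_def by simp
qed

text \<open>Siblings differ by a multiple of \<open>2 ^ gap n\<close>, and
  \<open>w \<le> gap n\<close>. Otherwise the parents are at least 2 apart by induction, which
  amounts to two parent lengths in the finer unit, and the offsets of the children take back at most
  one of them.\<close>

lemma nodes_spaced: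
  "\<lbrakk>k \<in> nodes n; k' \<in> nodes n; k \<noteq> k'\<rbrakk> \<Longrightarrow> 2 ^ w \<le> \<bar>k - k'\<bar>"
proof (induction n arbitrary: k k')
  case (Suc n)
  from Suc.prems obtain a i a' i' where
    a: "k = child n a i" "a \<in> nodes n" "i < 2 ^ e n" "k' = child n a' i'" "a' \<in> nodes n" "i' < 2 ^ e n"
    by auto
  let ?P = "2 ^ gap n * 2 ^ e n * 2 ^ r :: int"
  have P: "2 ^ (l (Suc n) - l n) = ?P" unfolding scale_diff by (simp add: power_add)
  have kk: "k - k' = ?P * (a - a') + 2 ^ gap n * (int i - int i')"
    unfolding a(1,4) child_def P by (simp add: algebra_simps)
  have gw: "(2::int) ^ w \<le> 2 ^ gap n" using gap_ge by (intro power_increasing) auto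
  show ?case
  proof (cases "a = a'")
    case True
    then have "int i \<noteq> int i'" using Suc.prems(3) a(1,4) by auto
    then have "1 \<le> \<bar>int i - int i'\<bar>" by linarith
    then have "2 ^ gap n * 1 \<le> 2 ^ gap n * \<bar>int i - int i'\<bar>" by (intro mult_left_mono) auto
    moreover have "\<bar>k - k'\<bar> = 2 ^ gap n * \<bar>int i - int i'\<bar>" using True kk by (simp add: abs_mult)
    ultimately show ?thesis using gw by linarith
  next
    case False
    have "2 \<le> (2::int) ^ w" using w_pos by (metis power_increasing one_le_numeral power_one_right)
    then have a2: "2 \<le> \<bar>a - a'\<bar>" using Suc.IH[OF a(2,5) False] by linarith
    have "int i < 2 ^ e n" "int i' < 2 ^ e n" using a(3,6) by (metis of_nat_less_iff of_nat_numeral of_nat_power)+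
    then have "\<bar>int i - int i'\<bar> \<le> 2 ^ e n" by linarith
    then have i: "\<bar>2 ^ gap n * (int i - int i')\<bar> \<le> 2 ^ gap n * 2 ^ e n" by (simp add: abs_mult)
    have "2 ^ gap n * 2 ^ e n * 1 \<le> ?P" by (intro mult_left_mono) auto
    with i have i': "\<bar>2 ^ gap n * (int i - int i')\<bar> \<le> ?P" by linarith
    have "?P * 2 \<le> ?P * \<bar>a - a'\<bar>" using a2 by (intro mult_left_mono) auto
    then have "?P * 2 \<le> \<bar>?P * (a - a')\<bar>" by (simp add: abs_mult)
    then have "?P \<le> \<bar>k - k'\<bar>" unfolding kk using i' by linarith
    moreover have "2 ^ gap n * 1 \<le> 2 ^ gap n * (2 ^ e n * 2 ^ r :: int)"
      by (intro mult_left_mono) (auto simp: power_add[symmetric])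
    ultimately have "2 ^ gap n \<le> \<bar>k - k'\<bar>" unfolding mult.assoc by linarith
    then show ?thesis using gw by linarith
  qed
qed simp

text \<open>Siblings are at least \<open>2 ^ gap n\<close> units of the finer generation apart, and
  cells are at most one unit wide. Since \<open>l (Suc n) = l n + gap n + e n + r\<close>, the gap
  cancels: the bound depends on the parent's generation and the branching, not on how far away the
  next generation is.\<close>

lemma siblings_separated:
  assumes "x \<in> cell (Suc n) (child n k i)" "y \<in> cell (Suc n) (child n k i')" "i \<noteq> i'"
  shows "1 / 2 ^ (l n + e n + r + 1) \<le> \<bar>x - y\<bar>"
proof -
  let ?L = "(2::real) ^ l (Suc n)"
  have "1 \<le> \<bar>real i - real i'\<bar>" using assms(3) by linarith
  then have "2 ^ gap n * 1 \<le> 2 ^ gap n * \<bar>real i - real i'\<bar>" by (intro mult_left_mono) auto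
  then have g: "2 ^ gap n \<le> \<bar>real_of_int (child n k i) - child n k i'\<bar>"
    unfolding child_def by (simp add: abs_mult right_diff_distrib[symmetric])
  have r1: "1 / 2 ^ r \<le> (1::real)" by simp
  have "\<bar>(?L * x - child n k i) - (?L * y - child n k i')\<bar> \<le> 1"
    using assms(1,2) r1 unfolding cell_def mem_Collect_eq by linarith
  then have "2 ^ gap n - 1 \<le> \<bar>?L * x - ?L * y\<bar>" using g by linarith
  moreover have "(2::real) ^ 1 \<le> 2 ^ gap n" using gap_ge[of n] w_pos by (intro power_increasing) auto
  ultimately have "2 ^ gap n / 2 \<le> \<bar>?L * (x - y)\<bar>" by (simp add: algebra_simps)
  also have "\<dots> = ?L * \<bar>x - y\<bar>" by (simp add: abs_mult)
  also have "?L = 2 ^ gap n * 2 ^ (l n + e n + r)" using scale_Suc[of n] by (simp add: power_add)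
  finally have "1 / 2 \<le> 2 ^ (l n + e n + r) * \<bar>x - y\<bar>" by simp
  then show ?thesis by (simp add: field_simps)
qed

lemma descendant:
  assumes "k \<in> nodes n" "n \<le> n'"
  shows "\<exists>k'\<in>nodes n'. cell n' k' \<subseteq> cell n k"
  using assms(2)
proof (induction n' rule: dec_induct)
  case (step m)
  then obtain k' where "k' \<in> nodes m" "cell m k' \<subseteq> cell n k" by blast
  then show ?case using child_in_nodes[of k' m 0] cell_child[of 0 m k'] by (intro bexI[of _ "child m k' 0"]) auto
qed (use assms in auto)

lemma layer_antimono: "n \<le> m \<Longrightarrow> (\<Union>k\<in>nodes m. cell m k) \<subseteq> (\<Union>k\<in>nodes n. cell n k)"
proof (induction m rule: dec_induct)
  case (step m)
  have "(\<Union>k\<in>nodes (Suc m). cell (Suc m) k) \<subseteq> (\<Union>k\<in>nodes m. cell m k)"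
    using cell_child by fastforce
  then show ?case using step by blast
qed simp

lemma cell_eq: "cell n k = {(u + k) / 2 ^ l n .. (u + 1 / 2 ^ r + k) / 2 ^ l n}"
  unfolding cell_def by (auto simp: field_simps)

lemma cell_ne: "cell n k \<noteq> {}"
  unfolding cell_eq by (auto intro!: divide_right_mono)

text \<open>The Baire category argument for the Cantor set, by hand.\<close>
lemma cantor_not_covered:
  assumes avoid: "\<And>i n k. k \<in> nodes n \<Longrightarrow> \<exists>n' k'. n < n' \<and> k' \<in> nodes n' \<and> cell n' k' \<subseteq> cell n k \<and> cell n' k' \<inter> F i = {}"
  shows "\<exists>x\<in>cantor. \<forall>i::nat. x \<notin> F i"
proof -
  define Q where "Q = (\<lambda>i (a :: nat \<times> int) b. fst a < fst b \<and> cell (fst b) (snd b) \<subseteq> cell (fst a) (snd a)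
      \<and> cell (fst b) (snd b) \<inter> F i = {})"
  have "\<exists>a. (\<forall>i. (snd (a i) \<in> nodes (fst (a i)))) \<and> (\<forall>i. Q i (a i) (a (Suc i)))"
  proof -
    have "\<exists>a. \<forall>i. (snd (a i) \<in> nodes (fst (a i))) \<and> Q i (a i) (a (Suc i))"
    proof (rule dependent_nat_choice)
      show "\<exists>x. snd x \<in> nodes (fst x)" by (rule exI[of _ "(0, 0)"]) simp
      fix x :: "nat \<times> int" and i assume "snd x \<in> nodes (fst x)"
      from avoid[OF this, of i] show "\<exists>y. snd y \<in> nodes (fst y) \<and> Q i x y"
        unfolding Q_def by fastforce
    qed
    then show ?thesis by blast
  qed
  then obtain a where a: "\<And>i. snd (a i) \<in> nodes (fst (a i))" "\<And>i. Q i (a i) (a (Suc i))" by blast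
  define C where "C = (\<lambda>i. cell (fst (a i)) (snd (a i)))"
  have dec: "C (Suc i) \<subseteq> C i" "C (Suc i) \<inter> F i = {}" for i
    using a(2)[of i] unfolding Q_def C_def by auto
  have "(\<Inter>i. C i) \<noteq> {}"
  proof (rule compact_nest)
    show "compact (C n)" for n unfolding C_def cell_eq by simp
    show "C n \<noteq> {}" for n unfolding C_def by (rule cell_ne)
    show "C n \<subseteq> C m" if "m \<le> n" for m n using lift_Suc_antimono_le[of C] dec(1) that by blast
  qed
  then obtain x where x: "\<And>i. x \<in> C i" by blast
  \<comment> \<open>The depths increase strictly, so the point lies in cells of arbitrarily large
    depth and thus, by \<open>layer_antimono\<close>, in every layer.\<close>
  have "i \<le> fst (a i)" for i
  proof (induction i)
    case (Suc i)
    then show ?case using a(2)[of i] unfolding Q_def by simp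
  qed simp
  then have "x \<in> (\<Union>k\<in>nodes n. cell n k)" for n
    using layer_antimono[of n "fst (a n)"] x[of n] a(1)[of n] unfolding C_def by blast
  then have "x \<in> cantor" unfolding cantor_def by blast
  then show ?thesis using x dec(2) by blast
qed

end

section \<open>Lower bound for the packing dimension of the Cantor set\<close>

lemma dist_eq_abs_nth:
  fixes x y :: "real^'n::finite"
  assumes "CARD('n) = 1"
  shows "dist x y = \<bar>x $ ax - y $ ax\<bar>"
proof -
  have U: "(UNIV :: 'n set) = {ax}"
    using assms by (metis UNIV_I card_1_singletonE singletonD)
  then show ?thesis by (simp add: dist_vec_def L2_set_def dist_real_def U)
qed

context dyadic_tree
begin

text \<open>Some late branching node lies below \<open>k\<close>, and \<open>F\<close> has a point
  in each of its child cells. These points are so far apart that balls of radius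
  \<open>\<rho>\<close> around them are disjoint, and \<open>large\<close> says that these balls
  alone contribute at least 1.\<close>

lemma packing_pre_ge_1:
  fixes F :: "(real^'n::finite) set"
  assumes card: "CARD('n) = 1" and t: "0 \<le> t"
    and large: "\<And>N. \<exists>n\<ge>N. t * (real (l n) + real (e n) + real r + 2) \<le> real (e n)"
    and k: "k \<in> nodes n"
    and meets: "\<And>n' k'. \<lbrakk>n < n'; k' \<in> nodes n'; cell n' k' \<subseteq> cell n k\<rbrakk> \<Longrightarrow> \<exists>x\<in>F. x $ ax \<in> cell n' k'"
  shows "1 \<le> packing_pre t F"
  unfolding packing_pre_def
proof (rule INF_greatest)
  fix \<delta> :: real assume "\<delta> \<in> {0<..}"
  then have \<delta>: "0 < \<delta>" by simp
  \<comment> \<open>Since \<open>n' \<le> l n'\<close>, a depth beyond \<open>N1\<close> forces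
    \<open>\<rho> \<le> \<delta>\<close>.\<close>
  obtain N1 where N1: "(1/2) ^ N1 < \<delta>" using real_arch_pow_inv[OF \<delta>, of "1/2"] by auto
  obtain n' where n': "max n N1 \<le> n'" and ln: "t * (real (l n') + real (e n') + real r + 2) \<le> real (e n')"
    using large by blast
  \<comment> \<open>A quarter of the distance in \<open>siblings_separated\<close>; the diameter
    \<open>2 * \<rho>\<close> then has the exponent that appears in \<open>large\<close>.\<close>
  define \<rho> where "\<rho> = (1::real) / 2 ^ (l n' + e n' + r + 3)"
  have \<rho>0: "0 < \<rho>" unfolding \<rho>_def by simp
  have "\<rho> = (1/2) ^ (l n' + e n' + r + 3)" unfolding \<rho>_def by (simp add: power_one_over)
  also have "\<dots> \<le> (1/2) ^ N1" using scale_ge[of n'] n' by (intro power_decreasing) auto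
  finally have \<rho>\<delta>: "\<rho> \<le> \<delta>" using N1 by simp
  obtain k' where k': "k' \<in> nodes n'" "cell n' k' \<subseteq> cell n k" using descendant[OF k] n' by auto
  have "\<exists>x\<in>F. x $ ax \<in> cell (Suc n') (child n' k' i)" if "i < 2 ^ e n'" for i
    using that n' k' cell_child[OF that] by (intro meets child_in_nodes) auto
  then obtain X where X: "\<And>i. i < 2 ^ e n' \<Longrightarrow> X i \<in> F \<and> X i $ ax \<in> cell (Suc n') (child n' k' i)"
    by metis
  have \<rho>4: "4 * \<rho> = 1 / 2 ^ (l n' + e n' + r + 1)" unfolding \<rho>_def by (simp add: power_add)
  have far: "4 * \<rho> \<le> dist (X i) (X i')" if "i < 2 ^ e n'" "i' < 2 ^ e n'" "i \<noteq> i'" for i i'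
    using siblings_separated[of "X i $ ax" n' k' i "X i' $ ax" i'] X that
    unfolding dist_eq_abs_nth[OF card, of _ _ ax] \<rho>4 by blast
  define B where "B = (\<lambda>i. (X i, \<rho>)) ` {..<2 ^ e n'}"
  have inj: "inj_on (\<lambda>i. (X i, \<rho>)) {..<2 ^ e n'}"
    using far \<rho>0 by (auto intro!: inj_onI) (metis dist_self not_le mult_pos_pos zero_less_numeral)
  have "disjoint_family_on (\<lambda>(x, r). cball x r) B"
    unfolding disjoint_family_on_def
  proof (intro ballI impI)
    fix a b assume ab: "a \<in> B" "b \<in> B" "a \<noteq> b"
    then obtain i i' where i: "a = (X i, \<rho>)" "b = (X i', \<rho>)" "i < 2 ^ e n'" "i' < 2 ^ e n'" "i \<noteq> i'"
      unfolding B_def by auto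
    have "\<not> (dist (X i) z \<le> \<rho> \<and> dist (X i') z \<le> \<rho>)" for z
      using far[OF i(3-5)] dist_triangle2[of "X i" "X i'" z] \<rho>0 by linarith
    then show "(case a of (x, r) \<Rightarrow> cball x r) \<inter> (case b of (x, r) \<Rightarrow> cball x r) = {}"
      using i by auto
  qed
  then have B: "B \<in> {B. finite B \<and> (\<forall>(x, r)\<in>B. x \<in> F \<and> 0 < r \<and> r \<le> \<delta>) \<and> disjoint_family_on (\<lambda>(x, r). cball x r) B}"
    using X \<rho>0 \<rho>\<delta> unfolding B_def by auto
  have "1 \<le> 2 powr (real (e n') - t * (real (l n') + real (e n') + real r + 2))"
    using ln by (simp add: ge_one_powr_ge_zero)
  also have "\<dots> = 2 ^ e n' * (2 * \<rho>) powr t"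
  proof -
    have "2 * \<rho> = 2 powr (- (real (l n') + real (e n') + real r + 2))"
    proof -
      have "real (l n') + real (e n') + real r + 2 = real (l n' + e n' + r + 2)" by simp
      then show ?thesis unfolding \<rho>_def powr_minus by (simp only: powr_realpow zero_less_numeral) (simp add: power_add field_simps)
    qed
    then have "(2 * \<rho>) powr t = 2 powr (- (t * (real (l n') + real (e n') + real r + 2)))"
      by (simp only: powr_powr) (simp add: algebra_simps)
    moreover have "(2::real) ^ e n' = 2 powr real (e n')" by (simp add: powr_realpow)
    ultimately show ?thesis by (simp only: powr_add[symmetric] diff_conv_add_uminus)
  qed
  finally have "1 \<le> ennreal (2 ^ e n' * (2 * \<rho>) powr t)" by simp
  also have "\<dots> = (\<Sum>(x, r)\<in>B. ennreal ((2 * r) powr t))"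
    unfolding B_def by (subst sum.reindex[OF inj]) (simp add: ennreal_mult flip: ennreal_power)
  also have "\<dots> \<le> (SUP B\<in>{B. finite B \<and> (\<forall>(x, r)\<in>B. x \<in> F \<and> 0 < r \<and> r \<le> \<delta>) \<and> disjoint_family_on (\<lambda>(x, r). cball x r) B}.
       \<Sum>(x, r)\<in>B. ennreal ((2 * r) powr t))"
    by (rule SUP_upper[OF B])
  finally show "1 \<le> (SUP B\<in>{B. finite B \<and> (\<forall>(x, r)\<in>B. x \<in> F \<and> 0 < r \<and> r \<le> \<delta>) \<and> disjoint_family_on (\<lambda>(x, r). cball x r) B}.
       \<Sum>(x, r)\<in>B. ennreal ((2 * r) powr t))" .
qed

text \<open>In a countable cover of total premeasure below 1 each piece has premeasure below 1. By
  \<open>packing_pre_ge_1\<close> every cell then contains a smaller cell avoiding the given piece,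
  and the category argument produces an uncovered point of the Cantor set.\<close>

lemma packing_measure_pos:
  fixes E :: "(real^'n::finite) set"
  assumes card: "CARD('n) = 1" and t: "0 \<le> t"
    and large: "\<And>N. \<exists>n\<ge>N. t * (real (l n) + real (e n) + real r + 2) \<le> real (e n)"
    and E: "{x. x $ ax \<in> cantor} \<subseteq> E"
  shows "packing_measure t E \<noteq> 0"
proof
  assume "packing_measure t E = 0"
  then have "packing_measure t E < 1" by simp
  then obtain F where F: "E \<subseteq> (\<Union>i. F i)" "(\<Sum>i. packing_pre t (F i)) < 1"
    unfolding packing_measure_def INF_less_iff by auto
  have small: "packing_pre t (F i) < 1" for i
    using F(2) ennreal_suminf_lessD[of "\<lambda>i. packing_pre t (F i)" 1 i] by blast
  have avoid: "\<exists>n' k'. n < n' \<and> k' \<in> nodes n' \<and> cell n' k' \<subseteq> cell n k \<and> cell n' k' \<inter> (\<lambda>x. x $ ax) ` F i = {}"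
    if k: "k \<in> nodes n" for i n k
  proof (rule ccontr)
    assume "\<not> ?thesis"
    then have "1 \<le> packing_pre t (F i)"
      by (intro packing_pre_ge_1[OF card t large k, where ax = ax]) blast
    then show False using small[of i] by simp
  qed
  obtain x where x: "x \<in> cantor" "\<And>i. x \<notin> (\<lambda>x. x $ ax) ` F i"
    using cantor_not_covered[where F = "\<lambda>i. (\<lambda>x. x $ ax) ` F i", OF avoid] by blast
  have "(\<chi> i. x) \<in> E" using E x(1) by auto
  then obtain i where "(\<chi> i. x) \<in> F i" using F(1) by blast
  then have "(\<chi> i. x) $ ax \<in> (\<lambda>x. x $ ax) ` F i" by (rule imageI)
  then show False using x(2)[of i] by simp
qed

text \<open>If \<open>t < \<theta> / (1 + \<theta>)\<close>, then \<open>\<theta> * l n\<close>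
  exceeds \<open>t * (l n + \<theta> * l n)\<close> by a positive multiple of \<open>l n\<close>,
  which eventually outweighs the constants; so \<open>packing_measure_pos\<close> applies to
  \<open>t\<close>.\<close>

lemma packing_dim_ge:
  fixes E :: "(real^'n::finite) set"
  assumes card: "CARD('n) = 1" and \<theta>: "0 < \<theta>"
    and large: "\<And>N. \<exists>n\<ge>N. \<theta> * real (l n) - 1 \<le> real (e n)"
    and E: "{x. x $ ax \<in> cantor} \<subseteq> E"
  shows "ereal (\<theta> / (1 + \<theta>)) \<le> packing_dim E"
  unfolding packing_dim_def
proof (rule Inf_greatest, clarify)
  fix t assume t: "0 \<le> t" "packing_measure t E = 0"
  show "ereal (\<theta> / (1 + \<theta>)) \<le> ereal t"
  proof (rule ccontr)
    assume "\<not> ?thesis"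
    then have t1: "t < \<theta> / (1 + \<theta>)" by simp
    then have h: "0 < \<theta> - t * (1 + \<theta>)" using \<theta> by (simp add: pos_less_divide_eq)
    have "\<theta> / (1 + \<theta>) < 1" using \<theta> by (simp add: divide_less_eq)
    then have t2: "t < 1" using t1 by linarith
    have "\<exists>n\<ge>N. t * (real (l n) + real (e n) + real r + 2) \<le> real (e n)" for N
    proof -
      \<comment> \<open>From \<open>l n \<ge> M\<close> on, the surplus
        \<open>l n * (\<theta> - t * (1 + \<theta>))\<close> pays for the rounding of
        \<open>e n\<close> and for the term \<open>t * (r + 2)\<close>.\<close>
      obtain M :: nat where M: "(1 + t * (real r + 2)) / (\<theta> - t * (1 + \<theta>)) \<le> real M"
        using real_arch_simple by blast
      obtain n where n: "max N M \<le> n" "\<theta> * real (l n) - 1 \<le> real (e n)" using large by blast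
      have "real M \<le> real (l n)" using n(1) scale_ge[of n] by simp
      then have "1 + t * (real r + 2) \<le> real (l n) * (\<theta> - t * (1 + \<theta>))"
      proof -
        have "1 + t * (real r + 2) \<le> real M * (\<theta> - t * (1 + \<theta>))"
          using M h by (simp add: pos_divide_le_eq)
        also have "\<dots> \<le> real (l n) * (\<theta> - t * (1 + \<theta>))"
          using \<open>real M \<le> real (l n)\<close> h by (intro mult_right_mono) auto
        finally show ?thesis .
      qed
      moreover have "(\<theta> * real (l n) - 1) * (1 - t) \<le> real (e n) * (1 - t)"
        using n(2) t2 by (intro mult_right_mono) auto
      ultimately have "t * (real (l n) + real (e n) + real r + 2) \<le> real (e n)"
        using t by (simp add: algebra_simps)
      then show ?thesis using n(1) by auto
    qed
    from packing_measure_pos[OF card t(1) this E] show False using t(2) by simp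
  qed
qed

end

subsection \<open>Lacunary wavelet series\<close>

text \<open>\<open>R_less\<close> makes wavelets at distinct nodes of one depth active at disjoint
  sets of points, and \<open>lower\<close> makes them large on the cells. The exponent sum in
  \<open>decay\<close> and \<open>thin\<close> bounds the logarithm of the number of nodes:
  \<open>decay\<close> controls the \<open>p\<close>-th power of the Besov quantity of generation
  \<open>l n\<close>, and \<open>thin\<close> the measure of the set where the \<open>n\<close>-th
  piece lives.\<close>

locale lacunary_wavelet_series = dyadic_tree l e r w u for l e r w u +
  fixes \<phi> :: "real^'n::finite \<Rightarrow> complex" and \<psi> :: "nat \<Rightarrow> real^'n \<Rightarrow> complex" and ax :: 'n
    and c :: "nat \<Rightarrow> real" and p s B R \<eta> C \<kappa> :: real
  assumes card1: "CARD('n) = 1" and mra: "mra_wavelets \<phi> \<psi>"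
    and cont_phi: "continuous_on UNIV \<phi>" and bound_phi: "\<And>x. cmod (\<phi> x) \<le> B"
    and cont_psi: "continuous_on UNIV (\<psi> 1)" and bound_psi: "\<And>x. cmod (\<psi> 1 x) \<le> B"
    and supp_psi: "\<And>x. \<psi> 1 x \<noteq> 0 \<Longrightarrow> norm x \<le> R"
    and R_pos: "0 < R" and B_pos: "0 < B" and \<eta>_pos: "0 < \<eta>" and R_less: "2 * R < 2 ^ w"
    and lower: "\<And>x. u \<le> x $ ax \<Longrightarrow> x $ ax \<le> u + 1 / 2 ^ r \<Longrightarrow> \<eta> \<le> cmod (\<psi> 1 x)"
    and p: "1 \<le> p" and s: "0 < s" and \<kappa>: "0 < \<kappa>" and c_pos: "\<And>n. 0 < c n" and C_pos: "0 < C"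
    and decay: "\<And>n. c n powr p * 2 powr (real (\<Sum>i<n. e i) - (1 - s * p) * real (l n)) \<le> C * 2 powr (- \<kappa> * real n)"
    and thin: "\<And>n. 2 powr (real (\<Sum>i<n. e i) - real (l n)) \<le> C * 2 powr (- \<kappa> * real n)"
begin

definition pos :: "int \<Rightarrow> int^'n" where "pos k = (\<chi> i. k)"

definition piece :: "nat \<Rightarrow> real^'n \<Rightarrow> complex" where
  "piece n x = complex_of_real (c n) * (\<Sum>k\<in>nodes n. \<psi> 1 ((2 ^ l n) *\<^sub>R x - ivec (pos k)))"

definition series :: "real^'n \<Rightarrow> complex" where
  "series x = (\<Sum>n. piece n x)"

definition supports :: "nat \<Rightarrow> (real^'n) set" where
  "supports n = (\<Union>k\<in>nodes n. {x. norm ((2 ^ l n) *\<^sub>R x - ivec (pos k)) \<le> R})"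

lemma UNIV_ax: "(UNIV :: 'n set) = {ax}"
  using card1 by (metis UNIV_I card_1_singletonE singletonD)

lemma all_ax: "(i :: 'n) = ax"
  using UNIV_ax by blast

lemma pos_nth [simp]: "pos (k $ ax) = k"
  unfolding pos_def by (simp add: vec_eq_iff) (metis all_ax)

lemma inj_pos: "inj pos"
  unfolding pos_def by (auto simp: inj_def vec_eq_iff)

lemma pos_nth' [simp]: "pos k $ i = k"
  unfolding pos_def by simp

lemma ivec_nth [simp]: "ivec k $ i = real_of_int (k $ i)"
  unfolding ivec_def by simp

lemma norm_ax: "norm (x :: real^'n) = \<bar>x $ ax\<bar>"
  using dist_eq_abs_nth[OF card1, of x 0 ax] by simp

lemma finite_pos_nodes: "finite (pos ` nodes n)"
  using finite_nodes by blast

lemma wav_1: "wav \<psi> 1 (int j) k x = complex_of_real (2 powr (real j / 2)) * \<psi> 1 ((2 ^ j) *\<^sub>R x - ivec k)"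
  unfolding wav_def by (simp add: card1 powr_realpow)

lemma orthonormal:
  "l2_inner (wav \<psi> 1 (int j') k') (wav \<psi> 1 (int j) k) = (if j' = j \<and> k' = k then 1 else 0)"
  "l2_inner (wav \<psi> 1 (int j') k') (\<lambda>x. \<phi> (x - ivec k)) = 0"
proof -
  have *: "\<forall>i\<in>UNIV <+> {1::nat} \<times> UNIV \<times> UNIV. \<forall>j\<in>UNIV <+> {1::nat} \<times> UNIV \<times> UNIV.
    l2_inner (case_sum (\<lambda>k x. \<phi> (x - ivec k)) (\<lambda>(i, j, k). wav \<psi> i (int j) k) i)
       (case_sum (\<lambda>k x. \<phi> (x - ivec k)) (\<lambda>(i, j, k). wav \<psi> i (int j) k) j) = (if i = j then 1 else 0)"
    using mra unfolding mra_wavelets_def ONB_family_def by (simp add: card1)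
  have mem: "Inr (1, j, k) \<in> UNIV <+> {1::nat} \<times> UNIV \<times> UNIV" "Inl k \<in> UNIV <+> {1::nat} \<times> UNIV \<times> UNIV"
    for j :: nat and k :: "int^'n" by auto
  show "l2_inner (wav \<psi> 1 (int j') k') (wav \<psi> 1 (int j) k) = (if j' = j \<and> k' = k then 1 else 0)"
    using *[rule_format, OF mem(1)[of j' k'] mem(1)[of j k]] by simp
  show "l2_inner (wav \<psi> 1 (int j') k') (\<lambda>x. \<phi> (x - ivec k)) = 0"
    using *[rule_format, OF mem(1)[of j' k'] mem(2)[of k]] by simp
qed

text \<open>The wavelets of the series are not normalised in the square mean, which leaves the
  factor \<open>1 / 2 ^ j\<close>; it will cancel against the prefactor in
  \<open>wcoef\<close>.\<close>

lemma integral_psi_psi: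
  "(LINT x|lebesgue. cnj (\<psi> 1 ((2 ^ j) *\<^sub>R x - ivec k)) * \<psi> 1 ((2 ^ j') *\<^sub>R x - ivec k'))
    = (if j' = j \<and> k' = k then 1 / 2 ^ j else 0)" (is "?I = _")
proof -
  have "l2_inner (wav \<psi> 1 (int j') k') (wav \<psi> 1 (int j) k)
      = (LINT x|lebesgue. (complex_of_real (2 powr (real j' / 2)) * complex_of_real (2 powr (real j / 2)))
          * (cnj (\<psi> 1 ((2 ^ j) *\<^sub>R x - ivec k)) * \<psi> 1 ((2 ^ j') *\<^sub>R x - ivec k')))"
    unfolding l2_inner_def wav_1 by (simp add: mult_ac)
  also have "\<dots> = (complex_of_real (2 powr (real j' / 2)) * complex_of_real (2 powr (real j / 2))) * ?I"
    by (rule integral_mult_right_zero)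
  finally have eq: "(complex_of_real (2 powr (real j' / 2)) * complex_of_real (2 powr (real j / 2))) * ?I
     = (if j' = j \<and> k' = k then 1 else 0)" using orthonormal(1) by simp
  show ?thesis
  proof (cases "j' = j \<and> k' = k")
    case True
    have "2 powr (real j / 2) * 2 powr (real j / 2) = (2::real) ^ j"
      by (simp add: powr_add[symmetric] powr_realpow)
    then have "complex_of_real (2 powr (real j / 2)) * complex_of_real (2 powr (real j / 2)) = 2 ^ j"
      by (metis of_real_mult of_real_numeral of_real_power)
    then show ?thesis using eq True by (simp add: field_simps)
  next
    case False
    then show ?thesis using eq by (simp add: if_splits)
  qed
qed

lemma integral_phi_psi:
  "(LINT x|lebesgue. cnj (\<phi> (x - ivec k)) * \<psi> 1 ((2 ^ j') *\<^sub>R x - ivec k')) = 0" (is "?I = _")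
proof -
  have "l2_inner (wav \<psi> 1 (int j') k') (\<lambda>x. \<phi> (x - ivec k))
      = (LINT x|lebesgue. complex_of_real (2 powr (real j' / 2))
          * (cnj (\<phi> (x - ivec k)) * \<psi> 1 ((2 ^ j') *\<^sub>R x - ivec k')))"
    unfolding l2_inner_def wav_1 by (simp add: mult_ac)
  also have "\<dots> = complex_of_real (2 powr (real j' / 2)) * ?I"
    by (rule integral_mult_right_zero)
  finally show ?thesis using orthonormal(2) by simp
qed

text \<open>Nodes of equal depth are at least \<open>2 ^ w > 2 * R\<close> apart, so at most one
  term of a piece is active at any point.\<close>

lemma node_unique:
  assumes "k \<in> nodes n" "k' \<in> nodes n" "norm (y - ivec (pos k)) \<le> R" "norm (y - ivec (pos k')) \<le> R"
  shows "k = k'"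
proof (rule ccontr)
  assume "k \<noteq> k'"
  then have "2 ^ w \<le> \<bar>k - k'\<bar>" using nodes_spaced assms by blast
  then have "real_of_int (2 ^ w) \<le> real_of_int \<bar>k - k'\<bar>" by linarith
  then show False using assms(3,4) R_less unfolding norm_ax by simp
qed

lemma piece_eq:
  assumes "k \<in> nodes n" "norm ((2 ^ l n) *\<^sub>R x - ivec (pos k)) \<le> R"
  shows "piece n x = complex_of_real (c n) * \<psi> 1 ((2 ^ l n) *\<^sub>R x - ivec (pos k))"
proof -
  have "(\<Sum>k'\<in>nodes n. \<psi> 1 ((2 ^ l n) *\<^sub>R x - ivec (pos k')))
      = (\<Sum>k'\<in>{k}. \<psi> 1 ((2 ^ l n) *\<^sub>R x - ivec (pos k')))"
    using finite_nodes assms node_unique[OF assms(1)] supp_psi by (intro sum.mono_neutral_right) blast+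
  then show ?thesis unfolding piece_def by simp
qed

lemma piece_eq_0: "x \<notin> supports n \<Longrightarrow> piece n x = 0"
  unfolding piece_def supports_def using supp_psi by (auto intro!: sum.neutral)

lemma piece_le: "cmod (piece n x) \<le> B * (c n * indicator (supports n) x)"
proof (cases "x \<in> supports n")
  case True
  then obtain k where "k \<in> nodes n" "norm ((2 ^ l n) *\<^sub>R x - ivec (pos k)) \<le> R" unfolding supports_def by blast
  then show ?thesis using piece_eq bound_psi c_pos[of n] True by (simp add: norm_mult mult.commute)
qed (simp add: piece_eq_0)

lemma cell_support:
  assumes "k \<in> nodes n" "x $ ax \<in> cell n k"
  shows "norm ((2 ^ l n) *\<^sub>R x - ivec (pos k)) \<le> R" "\<eta> * c n \<le> cmod (piece n x)"
proof -
  have \<eta>: "\<eta> \<le> cmod (\<psi> 1 ((2 ^ l n) *\<^sub>R x - ivec (pos k)))"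
    using assms(2) unfolding cell_def by (intro lower) auto
  then show 1: "norm ((2 ^ l n) *\<^sub>R x - ivec (pos k)) \<le> R" using \<eta>_pos by (intro supp_psi) auto
  show "\<eta> * c n \<le> cmod (piece n x)"
    unfolding piece_eq[OF assms(1) 1] using \<eta> c_pos[of n] by (simp add: norm_mult)
qed

lemma piece_ge_cantor: "x $ ax \<in> cantor \<Longrightarrow> \<eta> * c n \<le> cmod (piece n x)"
  unfolding cantor_def using cell_support(2) by blast

lemma ball_lmeasurable:
  fixes y :: "real^'n"
  assumes "0 < a"
  shows "{x. norm (a *\<^sub>R x - y) \<le> R} \<in> lmeasurable" "measure lebesgue {x. norm (a *\<^sub>R x - y) \<le> R} \<le> 2 * R / a"
proof -
  let ?z = "y /\<^sub>R a"
  let ?b = "cbox (\<chi> i. ?z $ i - R / a) (\<chi> i. ?z $ i + R / a)"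
  have eq: "{x. norm (a *\<^sub>R x - y) \<le> R} = ?b"
  proof -
    have *: "\<bar>a * t - y $ ax\<bar> \<le> R \<longleftrightarrow> ?z $ ax - R / a \<le> t \<and> t \<le> ?z $ ax + R / a" for t
      using assms by (auto simp: abs_le_iff field_simps)
    have **: "(\<forall>i. P i) \<longleftrightarrow> P ax" for P :: "'n \<Rightarrow> bool" using all_ax by metis
    show ?thesis
    proof (rule set_eqI)
      fix x
      show "x \<in> {x. norm (a *\<^sub>R x - y) \<le> R} \<longleftrightarrow> x \<in> ?b"
        unfolding mem_Collect_eq norm_ax mem_box_cart ** using *[of "x $ ax"] by simp
    qed
  qed
  show "{x. norm (a *\<^sub>R x - y) \<le> R} \<in> lmeasurable" unfolding eq by simp
  have "?b \<noteq> {}" using R_pos assms by (auto simp: interval_ne_empty_cart)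
  then have "measure lborel ?b = (\<Prod>i\<in>(UNIV :: 'n set). 2 * R / a)" by (simp add: content_cbox_cart)
  then show "measure lebesgue {x. norm (a *\<^sub>R x - y) \<le> R} \<le> 2 * R / a"
    unfolding eq by (simp add: card1)
qed

lemma supports_lmeasurable: "supports n \<in> lmeasurable"
  unfolding supports_def by (intro fmeasurable.finite_UN finite_nodes ball_lmeasurable) simp

lemma measurable_supports [measurable]: "supports n \<in> sets lebesgue"
  using supports_lmeasurable by (rule fmeasurableD)

lemma measure_supports_le:
  "measure lebesgue (supports n) \<le> 2 * R * 2 powr (real (\<Sum>i<n. e i) - real (l n))"
proof -
  have "measure lebesgue (supports n) \<le> (\<Sum>k\<in>nodes n. measure lebesgue {x. norm ((2 ^ l n) *\<^sub>R x - ivec (pos k)) \<le> R})"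
    unfolding supports_def using ball_lmeasurable(1) by (intro measure_UNION_le finite_nodes) (auto dest: fmeasurableD)
  also have "\<dots> \<le> (\<Sum>k\<in>nodes n. 2 * R / 2 ^ l n)" by (intro sum_mono ball_lmeasurable(2)) simp
  also have "\<dots> = real (card (nodes n)) * (2 * R / 2 ^ l n)" by simp
  also have "\<dots> \<le> 2 ^ (\<Sum>i<n. e i) * (2 * R / 2 ^ l n)"
  proof (rule mult_right_mono)
    show "real (card (nodes n)) \<le> 2 ^ (\<Sum>i<n. e i)"
      using of_nat_mono[OF card_nodes_le[of n]] by (simp only: of_nat_power of_nat_numeral)
  qed (use R_pos in simp)
  also have "\<dots> = 2 * R * 2 powr (real (\<Sum>i<n. e i) - real (l n))"
    by (simp add: powr_diff powr_realpow[symmetric] del: of_nat_sum)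
  finally show ?thesis .
qed

lemma measure_supports_summable:
  "measure lebesgue (supports n) \<le> 2 * R * C * 2 powr (- \<kappa> * real n)"
  "c n powr p * measure lebesgue (supports n) \<le> 2 * R * C * 2 powr (- \<kappa> * real n)"
proof -
  let ?b = "real (\<Sum>i<n. e i)"
  show "measure lebesgue (supports n) \<le> 2 * R * C * 2 powr (- \<kappa> * real n)"
    using measure_supports_le[of n] mult_left_mono[OF thin[of n], of "2 * R"] R_pos
    unfolding mult.assoc by linarith
  \<comment> \<open>Because \<open>s * p > 0\<close>, replacing \<open>l n\<close> by
    \<open>(1 - s * p) * l n\<close> enlarges the power and produces the quantity bounded by
    \<open>decay\<close>.\<close>
  have "2 powr (?b - real (l n)) \<le> 2 powr (?b - (1 - s * p) * real (l n))"
    using s p by (intro powr_mono) (auto simp: algebra_simps)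
  then have "2 * R * 2 powr (?b - real (l n)) \<le> 2 * R * 2 powr (?b - (1 - s * p) * real (l n))"
    using R_pos by (intro mult_left_mono) auto
  then have "measure lebesgue (supports n) \<le> 2 * R * 2 powr (?b - (1 - s * p) * real (l n))"
    using measure_supports_le[of n] by linarith
  then have "c n powr p * measure lebesgue (supports n) \<le> c n powr p * (2 * R * 2 powr (?b - (1 - s * p) * real (l n)))"
    by (intro mult_left_mono) auto
  also have "\<dots> = 2 * R * (c n powr p * 2 powr (?b - (1 - s * p) * real (l n)))" by (simp add: mult_ac)
  also have "\<dots> \<le> 2 * R * (C * 2 powr (- \<kappa> * real n))" using decay[of n] R_pos by (intro mult_left_mono) auto
  finally show "c n powr p * measure lebesgue (supports n) \<le> 2 * R * C * 2 powr (- \<kappa> * real n)" by simp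
qed

lemma powr_geometric_summable: "0 < a \<Longrightarrow> summable (\<lambda>n. 2 powr (- a * real n) :: real)"
proof -
  assume a: "0 < a"
  have "2 powr (- a * real n) = (2 powr (- a)) ^ n" for n by (simp add: powr_power mult.commute)
  moreover have "summable (\<lambda>n. (2 powr (- a)) ^ n :: real)"
    using a by (intro summable_geometric) (auto simp: powr_less_one)
  ultimately show ?thesis by simp
qed

text \<open>Borel-Cantelli: the measures of the supports are summable. Almost everywhere the series
  therefore has only finitely many nonzero terms.\<close>

lemma AE_eventually_outside: "AE x in lebesgue. eventually (\<lambda>n. x \<notin> supports n) sequentially"
proof -
  have "summable (\<lambda>n. measure lebesgue (supports n))"
    by (rule summable_comparison_test'[of "\<lambda>n. 2 * R * C * 2 powr (- \<kappa> * real n)" 0])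
      (use measure_supports_summable(1) powr_geometric_summable[OF \<kappa>] in \<open>auto intro: summable_mult\<close>)
  then have "AE x in lebesgue. eventually (\<lambda>n. x \<in> space lebesgue - supports n) sequentially"
    using supports_lmeasurable by (intro borel_cantelli_AE1) (auto simp: fmeasurable_def)
  then show ?thesis by simp
qed

text \<open>The weight \<open>q0\<close> splits the decay rate \<open>\<kappa>\<close> so that both the \<open>L\<^sup>1\<close> and the \<open>L\<^sup>p\<close> sums converge.\<close>

definition q0 :: real where "q0 = 2 powr (- \<kappa> / (2 * p))"

lemma q0: "0 < q0" "q0 < 1"
  unfolding q0_def using p \<kappa> by (auto simp: powr_less_one)

lemma q0_powr: "(q0 ^ n) powr (- p) = 2 powr (\<kappa> / 2 * real n)"
  unfolding q0_def using p by (simp add: powr_power powr_powr field_simps)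

text \<open>The weight uses up half of the decay rate, and the other half still gives a convergent
  geometric series.\<close>

lemma Lp_terms_summable:
  "summable (\<lambda>n. 2 powr (\<kappa> / 2 * real n) * c n powr p * measure lebesgue (supports n))"
proof (rule summable_comparison_test'[of "\<lambda>n. 2 * R * C * 2 powr (- (\<kappa> / 2) * real n)" 0])
  show "summable (\<lambda>n. 2 * R * C * 2 powr (- (\<kappa> / 2) * real n))"
    using powr_geometric_summable[of "\<kappa> / 2"] \<kappa> by (intro summable_mult) auto
  fix n
  have "2 powr (\<kappa> / 2 * real n) * (c n powr p * measure lebesgue (supports n))
     \<le> 2 powr (\<kappa> / 2 * real n) * (2 * R * C * 2 powr (- \<kappa> * real n))"
    using measure_supports_summable(2)[of n] by (intro mult_left_mono) auto
  also have "\<dots> = 2 * R * C * 2 powr (- (\<kappa> / 2) * real n)"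
    by (simp add: powr_add[symmetric] mult.left_commute)
  finally show "norm (2 powr (\<kappa> / 2 * real n) * c n powr p * measure lebesgue (supports n)) \<le> 2 * R * C * 2 powr (- (\<kappa> / 2) * real n)"
    by (simp add: mult.assoc)
qed

text \<open>If \<open>c n\<close> exceeds \<open>q0 ^ n\<close>, their quotient is at least 1 and
  can only grow when raised to the power \<open>p\<close>. This reduces sums of \<open>c n\<close>
  to sums of \<open>c n powr p\<close>.\<close>

lemma coeff_le: "c n \<le> q0 ^ n + 2 powr (\<kappa> / 2 * real n) * c n powr p"
proof (cases "c n \<le> q0 ^ n")
  case False
  have q: "0 < q0 ^ n" "q0 ^ n \<le> 1" using q0 by (auto simp: power_le_one)
  have "1 \<le> c n / q0 ^ n" using False q by (simp add: pos_le_divide_eq)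
  then have "(c n / q0 ^ n) powr 1 \<le> (c n / q0 ^ n) powr p" using p by (intro powr_mono) auto
  then have "c n / q0 ^ n \<le> c n powr p * (q0 ^ n) powr (- p)"
    using q c_pos[of n] by (simp add: powr_divide powr_minus_divide)
  moreover have "c n \<le> c n / q0 ^ n" using q c_pos[of n] by (simp add: pos_le_divide_eq mult_left_le)
  ultimately have "c n \<le> 2 powr (\<kappa> / 2 * real n) * c n powr p" unfolding q0_powr by (simp add: mult.commute)
  then show ?thesis using q by linarith
qed (simp add: add_increasing2)

text \<open>By \<open>coeff_le\<close> the terms split into a geometric part, the measures being
  bounded, and the terms of \<open>Lp_terms_summable\<close>. It justifies integrating the series
  term by term.\<close>

lemma L1_terms_summable: "summable (\<lambda>n. c n * measure lebesgue (supports n))"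
proof (rule summable_comparison_test'[of "\<lambda>n. 2 * R * C * q0 ^ n + 2 powr (\<kappa> / 2 * real n) * c n powr p * measure lebesgue (supports n)" 0])
  show "summable (\<lambda>n. 2 * R * C * q0 ^ n + 2 powr (\<kappa> / 2 * real n) * c n powr p * measure lebesgue (supports n))"
    using q0 by (intro summable_add Lp_terms_summable summable_mult summable_geometric) auto
  fix n
  have "2 powr (- \<kappa> * real n) \<le> 1" using \<kappa> powr_mono[of "- \<kappa> * real n" 0 2] by simp
  then have "2 * R * C * 2 powr (- \<kappa> * real n) \<le> 2 * R * C"
    using R_pos C_pos by (simp add: mult_left_le)
  then have m: "measure lebesgue (supports n) \<le> 2 * R * C" using measure_supports_summable(1)[of n] by linarith
  have "c n * measure lebesgue (supports n) \<le> (q0 ^ n + 2 powr (\<kappa> / 2 * real n) * c n powr p) * measure lebesgue (supports n)"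
    using coeff_le by (intro mult_right_mono) auto
  also have "\<dots> \<le> 2 * R * C * q0 ^ n + 2 powr (\<kappa> / 2 * real n) * c n powr p * measure lebesgue (supports n)"
    using mult_left_mono[OF m, of "q0 ^ n"] q0 by (simp add: algebra_simps)
  finally show "norm (c n * measure lebesgue (supports n)) \<le> 2 * R * C * q0 ^ n + 2 powr (\<kappa> / 2 * real n) * c n powr p * measure lebesgue (supports n)"
    using c_pos[of n] by simp
qed

end

section \<open>Scaling and wavelet coefficients of the series\<close>

context lacunary_wavelet_series
begin

lemma measurable_compose_affine:
  fixes g :: "real^'n \<Rightarrow> complex"
  assumes "continuous_on UNIV g"
  shows "(\<lambda>x. g (a *\<^sub>R x - y)) \<in> borel_measurable lebesgue"
proof -
  have "continuous_on UNIV (\<lambda>x. g (a *\<^sub>R x - y))"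
    by (intro continuous_on_compose2[OF assms] continuous_intros) auto
  then have "(\<lambda>x. g (a *\<^sub>R x - y)) \<in> borel_measurable borel" by (rule borel_measurable_continuous_onI)
  then show ?thesis by (intro measurable_completion) simp
qed

lemma measurable_cnj_compose_affine:
  fixes g :: "real^'n \<Rightarrow> complex"
  assumes "continuous_on UNIV g"
  shows "(\<lambda>x. cnj (g (a *\<^sub>R x - y))) \<in> borel_measurable lebesgue"
  by (rule measurable_compose_affine) (intro continuous_intros assms)

lemma measurable_piece [measurable]: "piece n \<in> borel_measurable lebesgue"
  unfolding piece_def[abs_def] using measurable_compose_affine[OF cont_psi] by measurable

lemma measurable_series [measurable]: "series \<in> borel_measurable lebesgue"
  unfolding series_def[abs_def] by measurable

lemma summable_indicator:
  assumes "eventually (\<lambda>n. x \<notin> supports n) sequentially"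
  shows "summable (\<lambda>n. a n * indicator (supports n) x :: real)"
proof -
  have "eventually (\<lambda>n. a n * indicator (supports n) x = (0::real)) sequentially"
    using assms by eventually_elim simp
  then show ?thesis by (subst summable_cong[where g = "\<lambda>_. 0"]) auto
qed

lemma integrable_indicator_supports: "integrable lebesgue (\<lambda>x. a * indicator (supports n) x :: real)"
  using supports_lmeasurable[of n] by (simp add: lmeasurable_iff_integrable)

text \<open>The function \<open>h\<close> stands for the conjugates of the translates of
  \<open>\<phi>\<close> and of the dilated wavelets, against which the coefficients are
  computed.\<close>

context
  fixes h :: "real^'n \<Rightarrow> complex" and M :: real
  assumes h [measurable]: "h \<in> borel_measurable lebesgue" and hM: "\<And>x. cmod (h x) \<le> M"
begin

lemma mult_piece_le: "cmod (h x * piece n x) \<le> M * B * c n * indicator (supports n) x"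
proof -
  have "cmod (h x) * cmod (piece n x) \<le> M * (B * (c n * indicator (supports n) x))"
    using hM[of x] piece_le[of n x] order_trans[OF norm_ge_zero hM[of x]] by (intro mult_mono) auto
  then show ?thesis by (simp add: norm_mult mult.assoc)
qed

lemma integrable_mult_piece: "integrable lebesgue (\<lambda>x. h x * piece n x)"
proof (rule Bochner_Integration.integrable_bound[OF integrable_indicator_supports[of "M * B * c n" n]])
  show "AE x in lebesgue. norm (h x * piece n x) \<le> norm (M * B * c n * indicator (supports n) x)"
    using mult_piece_le[of _ n] by (auto intro!: AE_I2 order_trans[OF _ abs_ge_self])
qed measurable

text \<open>Termwise integration: the series converges absolutely almost everywhere because its
  terms eventually vanish, and the integrals of the absolute values are summable by
  \<open>L1_terms_summable\<close>.\<close>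

lemma integral_mult_series: "(\<lambda>n. LINT x|lebesgue. h x * piece n x) sums (LINT x|lebesgue. h x * series x)"
proof -
  have AEs: "AE x in lebesgue. summable (\<lambda>n. norm (h x * piece n x))"
    using AE_eventually_outside
  proof eventually_elim
    case (elim x)
    show ?case
      by (rule summable_comparison_test'[OF summable_indicator[OF elim], of 0 _ "\<lambda>n. M * B * c n"])
        (use mult_piece_le in simp)
  qed
  have L1: "summable (\<lambda>n. LINT x|lebesgue. norm (h x * piece n x))"
  proof (rule summable_comparison_test'[of "\<lambda>n. M * B * (c n * measure lebesgue (supports n))" 0])
    show "summable (\<lambda>n. M * B * (c n * measure lebesgue (supports n)))"
      by (intro summable_mult L1_terms_summable)
    fix n
    have "(LINT x|lebesgue. norm (h x * piece n x)) \<le> (LINT x|lebesgue. M * B * c n * indicator (supports n) x)"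
      by (rule integral_mono) (use integrable_mult_piece integrable_indicator_supports mult_piece_le in auto)
    then show "norm (LINT x|lebesgue. norm (h x * piece n x)) \<le> M * B * (c n * measure lebesgue (supports n))"
      by (simp add: mult.assoc)
  qed
  have "(\<lambda>n. LINT x|lebesgue. h x * piece n x) sums (LINT x|lebesgue. (\<Sum>n. h x * piece n x))"
    by (rule sums_integral[OF integrable_mult_piece AEs L1])
  also have "(LINT x|lebesgue. (\<Sum>n. h x * piece n x)) = (LINT x|lebesgue. h x * series x)"
  proof (rule integral_cong_AE)
    show "AE x in lebesgue. (\<Sum>n. h x * piece n x) = h x * series x"
      using AE_eventually_outside
    proof eventually_elim
      case (elim x)
      have "summable (\<lambda>n. piece n x)"
        by (rule summable_comparison_test'[OF summable_indicator[OF elim], of 0 _ "\<lambda>n. B * c n"])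
          (use piece_le in \<open>simp add: mult.assoc\<close>)
      then show ?case unfolding series_def by (rule suminf_mult)
    qed
  qed measurable
  finally show ?thesis .
qed

lemma integral_mult_piece:
  "(LINT x|lebesgue. h x * piece n x)
     = complex_of_real (c n) * (\<Sum>k\<in>nodes n. LINT x|lebesgue. h x * \<psi> 1 ((2 ^ l n) *\<^sub>R x - ivec (pos k)))"
proof -
  have int: "integrable lebesgue (\<lambda>x. h x * \<psi> 1 ((2 ^ l n) *\<^sub>R x - ivec (pos k)))" if "k \<in> nodes n" for k
  proof (rule Bochner_Integration.integrable_bound[OF integrable_indicator_supports[of "M * B" n]])
    have M: "0 \<le> M" using order_trans[OF norm_ge_zero hM] by blast
    have "cmod (h x * \<psi> 1 ((2 ^ l n) *\<^sub>R x - ivec (pos k))) \<le> M * B * indicator (supports n) x" for x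
    proof (cases "\<psi> 1 ((2 ^ l n) *\<^sub>R x - ivec (pos k)) = 0")
      case True
      then show ?thesis using M B_pos by simp
    next
      case False
      then have "x \<in> supports n" unfolding supports_def using supp_psi that by blast
      then show ?thesis using hM bound_psi M by (simp add: norm_mult mult_mono)
    qed
    then show "AE x in lebesgue. norm (h x * \<psi> 1 ((2 ^ l n) *\<^sub>R x - ivec (pos k))) \<le> norm (M * B * indicator (supports n) x)"
      by (auto intro!: AE_I2 order_trans[OF _ abs_ge_self])
    show "(\<lambda>x. h x * \<psi> 1 ((2 ^ l n) *\<^sub>R x - ivec (pos k))) \<in> borel_measurable lebesgue"
      using measurable_compose_affine[OF cont_psi] by measurable
  qed
  have "(LINT x|lebesgue. h x * piece n x)
     = (LINT x|lebesgue. complex_of_real (c n) * (\<Sum>k\<in>nodes n. h x * \<psi> 1 ((2 ^ l n) *\<^sub>R x - ivec (pos k))))"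
    unfolding piece_def by (simp add: sum_distrib_left mult_ac)
  also have "\<dots> = complex_of_real (c n) * (LINT x|lebesgue. (\<Sum>k\<in>nodes n. h x * \<psi> 1 ((2 ^ l n) *\<^sub>R x - ivec (pos k))))"
    by (rule integral_mult_right_zero)
  also have "(LINT x|lebesgue. (\<Sum>k\<in>nodes n. h x * \<psi> 1 ((2 ^ l n) *\<^sub>R x - ivec (pos k))))
      = (\<Sum>k\<in>nodes n. LINT x|lebesgue. h x * \<psi> 1 ((2 ^ l n) *\<^sub>R x - ivec (pos k)))"
    using int by (rule Bochner_Integration.integral_sum)
  finally show ?thesis .
qed

end

lemma scoef_series: "scoef \<phi> series k = 0"
proof -
  let ?h = "\<lambda>x. cnj (\<phi> (x - ivec k))"
  have h: "?h \<in> borel_measurable lebesgue" "\<And>x. cmod (?h x) \<le> B"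
    using measurable_cnj_compose_affine[OF cont_phi, of 1 "ivec k"] bound_phi by auto
  have "(LINT x|lebesgue. ?h x * piece n x) = 0" for n
    unfolding integral_mult_piece[OF h] by (simp add: integral_phi_psi del: One_nat_def)
  then show ?thesis
    using integral_mult_series[OF h] unfolding scoef_def using sums_unique2[OF sums_zero] by simp
qed

lemma integral_psi_piece:
  "(LINT x|lebesgue. cnj (\<psi> 1 ((2 ^ j) *\<^sub>R x - ivec k)) * piece n x)
     = (if l n = j \<and> k $ ax \<in> nodes n then complex_of_real (c n) / 2 ^ j else 0)"
proof -
  let ?h = "\<lambda>x. cnj (\<psi> 1 ((2 ^ j) *\<^sub>R x - ivec k))"
  have h: "?h \<in> borel_measurable lebesgue" "\<And>x. cmod (?h x) \<le> B"
    using measurable_cnj_compose_affine[OF cont_psi, of "2 ^ j" "ivec k"] bound_psi by auto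
  have eq: "pos k' = k \<longleftrightarrow> k' = k $ ax" for k' using pos_nth by auto
  have "(\<Sum>k'\<in>nodes n. if l n = j \<and> k' = k $ ax then 1 / 2 ^ j else 0)
      = (if l n = j \<and> k $ ax \<in> nodes n then 1 / 2 ^ j else (0::complex))"
    by (cases "l n = j") (simp_all add: sum.delta finite_nodes)
  then show ?thesis
    unfolding integral_mult_piece[OF h] integral_psi_psi eq by simp
qed

text \<open>As \<open>l\<close> is injective, at most one piece has a nonzero integral against a
  given wavelet, so the series of integrals has at most one nonzero term.\<close>

lemma wcoef_series:
  "wcoef \<psi> series 1 (l n) k = (if k $ ax \<in> nodes n then complex_of_real (c n) else 0)"
  "j \<notin> range l \<Longrightarrow> wcoef \<psi> series 1 j k = 0"
proof -
  have sums: "(\<lambda>n. if l n = j \<and> k $ ax \<in> nodes n then complex_of_real (c n) / 2 ^ j else 0)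
     sums (LINT x|lebesgue. cnj (\<psi> 1 ((2 ^ j) *\<^sub>R x - ivec k)) * series x)" for j
    unfolding integral_psi_piece[symmetric]
    by (rule integral_mult_series[of _ B])
      (use measurable_cnj_compose_affine[OF cont_psi, of "2 ^ j" "ivec k"] bound_psi in auto)
  have inj: "l m = l n \<longleftrightarrow> m = n" for m using strict_mono_eq[OF strict_mono_scale] by blast
  have "(LINT x|lebesgue. cnj (\<psi> 1 ((2 ^ l n) *\<^sub>R x - ivec k)) * series x)
     = (if k $ ax \<in> nodes n then complex_of_real (c n) / 2 ^ l n else 0)"
  proof (rule sums_unique2[OF sums])
    have "(\<lambda>m. if l m = l n \<and> k $ ax \<in> nodes m then complex_of_real (c m) / 2 ^ l n else 0)
        = (\<lambda>m. if m = n then if k $ ax \<in> nodes m then complex_of_real (c m) / 2 ^ l n else 0 else 0)"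
      using inj by auto
    then show "(\<lambda>m. if l m = l n \<and> k $ ax \<in> nodes m then complex_of_real (c m) / 2 ^ l n else 0)
       sums (if k $ ax \<in> nodes n then complex_of_real (c n) / 2 ^ l n else 0)"
      using sums_single[of n "\<lambda>m. if k $ ax \<in> nodes m then complex_of_real (c m) / 2 ^ l n else 0"] by simp
  qed
  then show "wcoef \<psi> series 1 (l n) k = (if k $ ax \<in> nodes n then complex_of_real (c n) else 0)"
    unfolding wcoef_def by (simp add: card1)
  assume "j \<notin> range l"
  then have "l n \<noteq> j" for n by blast
  then have "(\<lambda>n. if l n = j \<and> k $ ax \<in> nodes n then complex_of_real (c n) / 2 ^ j else 0) = (\<lambda>_. 0)" by simp
  with sums[of j] have "(\<lambda>_. 0) sums (LINT x|lebesgue. cnj (\<psi> 1 ((2 ^ j) *\<^sub>R x - ivec k)) * series x)"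
    by simp
  then have "(LINT x|lebesgue. cnj (\<psi> 1 ((2 ^ j) *\<^sub>R x - ivec k)) * series x) = 0"
    by (rule sums_unique2) (rule sums_zero)
  then show "wcoef \<psi> series 1 j k = 0" unfolding wcoef_def by simp
qed

lemma I_single: "{1..2 ^ CARD('n) - 1 :: nat} = {1}"
  by (simp add: card1)

lemma mem_pos_image: "k \<in> pos ` A \<longleftrightarrow> k $ ax \<in> A"
  by (metis image_eqI imageE pos_nth pos_nth')

lemma Qop_series: "Qop \<psi> series (l n) x = piece n x" "j \<notin> range l \<Longrightarrow> Qop \<psi> series j x = 0"
proof -
  have "infsum (\<lambda>k. wcoef \<psi> series 1 (l n) k * \<psi> 1 ((2 ^ l n) *\<^sub>R x - ivec k)) UNIV
     = (\<Sum>k\<in>pos ` nodes n. wcoef \<psi> series 1 (l n) k * \<psi> 1 ((2 ^ l n) *\<^sub>R x - ivec k))"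
    by (rule infsum_finite_support[OF finite_pos_nodes]) (simp add: wcoef_series(1) mem_pos_image del: One_nat_def)
  also have "\<dots> = piece n x"
    unfolding piece_def by (subst sum.reindex) (auto simp: inj_on_def wcoef_series(1) sum_distrib_left dest: injD[OF inj_pos] simp del: One_nat_def)
  finally show "Qop \<psi> series (l n) x = piece n x" unfolding Qop_def I_single by simp
  show "j \<notin> range l \<Longrightarrow> Qop \<psi> series j x = 0" unfolding Qop_def I_single by (simp add: wcoef_series(2) del: One_nat_def)
qed

subsection \<open>Membership in the Besov space\<close>

text \<open>The integrable majorant \<open>T\<close> carries the weights
  \<open>(q0 ^ n) powr (- p)\<close>. Each of its terms is at most \<open>T\<close>, hence
  \<open>c n \<le> q0 ^ n * T x powr (1 / p)\<close> on the supports, and summing this geometric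
  bound gives a multiple of \<open>T\<close> above the \<open>p\<close>-th power of the
  series.\<close>

lemma Lp_series: "Lp p series"
proof -
  define T where "T = (\<lambda>x. \<Sum>n. 2 powr (\<kappa> / 2 * real n) * c n powr p * indicator (supports n) x :: real)"
  have intT: "integrable lebesgue T"
    unfolding T_def
  proof (rule integrable_suminf)
    show "AE x in lebesgue. summable (\<lambda>n. norm (2 powr (\<kappa> / 2 * real n) * c n powr p * indicator (supports n) x :: real))"
      using AE_eventually_outside
      by eventually_elim (use summable_indicator[of _ "\<lambda>n. 2 powr (\<kappa> / 2 * real n) * c n powr p"] in simp)
    show "summable (\<lambda>n. LINT x|lebesgue. norm (2 powr (\<kappa> / 2 * real n) * c n powr p * indicator (supports n) x :: real))"
      using Lp_terms_summable by simp
  qed (rule integrable_indicator_supports)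
  have bound: "AE x in lebesgue. cmod (series x) powr p \<le> (B / (1 - q0)) powr p * T x"
    using AE_eventually_outside
  proof eventually_elim
    case (elim x)
    have smT: "summable (\<lambda>n. 2 powr (\<kappa> / 2 * real n) * c n powr p * indicator (supports n) x :: real)"
      by (rule summable_indicator[OF elim])
    have T0: "0 \<le> T x" unfolding T_def by (intro suminf_nonneg smT) auto
    have y: "c n * indicator (supports n) x \<le> q0 ^ n * T x powr (1 / p)" for n
    proof (cases "x \<in> supports n")
      case True
      have "2 powr (\<kappa> / 2 * real n) * c n powr p \<le> T x"
        unfolding T_def using sum_le_suminf[OF smT, of "{n}"] True by simp
      then have "(c n / q0 ^ n) powr p \<le> T x"
        unfolding q0_powr[symmetric] using c_pos[of n] q0 by (simp add: powr_divide powr_minus_divide)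
      then have "((c n / q0 ^ n) powr p) powr (1 / p) \<le> T x powr (1 / p)"
        using p by (intro powr_mono2) auto
      then have "c n / q0 ^ n \<le> T x powr (1 / p)"
        using p c_pos[of n] q0 by (simp add: powr_powr)
      then show ?thesis using True q0 by (simp add: divide_le_eq mult.commute)
    qed (use q0 in simp)
    have "cmod (series x) \<le> (\<Sum>n. B * T x powr (1 / p) * q0 ^ n)"
      unfolding series_def
    proof (rule norm_suminf_le)
      show "norm (piece n x) \<le> B * T x powr (1 / p) * q0 ^ n" for n
      proof -
        have "norm (piece n x) \<le> B * (q0 ^ n * T x powr (1 / p))"
          using order_trans[OF piece_le[of n x] mult_left_mono[OF y[of n], of B]] B_pos by simp
        then show ?thesis by (simp add: mult_ac)
      qed
    qed (use q0 in \<open>auto intro!: summable_mult summable_geometric\<close>)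
    also have "\<dots> = B / (1 - q0) * T x powr (1 / p)"
      using q0 by (subst suminf_mult) (auto simp: suminf_geometric intro: summable_geometric)
    finally have "cmod (series x) powr p \<le> (B / (1 - q0) * T x powr (1 / p)) powr p"
      using p by (intro powr_mono2) auto
    also have "\<dots> = (B / (1 - q0)) powr p * T x"
      using p T0 q0 B_pos by (subst powr_mult) (auto simp: powr_powr)
    finally show ?case .
  qed
  have "integrable lebesgue (\<lambda>x. cmod (series x) powr p)"
  proof (rule Bochner_Integration.integrable_bound)
    show "integrable lebesgue (\<lambda>x. (B / (1 - q0)) powr p * T x)" using intT by simp
    show "AE x in lebesgue. norm (cmod (series x) powr p) \<le> norm ((B / (1 - q0)) powr p * T x)"
      using bound by eventually_elim (auto intro: order_trans[OF _ abs_ge_self])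
  qed measurable
  then show ?thesis unfolding Lp_def by simp
qed

lemma wcoef_powr_infsum:
  "(\<lambda>k. cmod (wcoef \<psi> series 1 j k) powr p) summable_on UNIV"
  "infsum (\<lambda>k. cmod (wcoef \<psi> series 1 (l n) k) powr p) UNIV = real (card (nodes n)) * c n powr p"
proof -
  have "finite {k. cmod (wcoef \<psi> series 1 j k) powr p \<noteq> 0}"
  proof (cases "j \<in> range l")
    case True
    then obtain n where [simp]: "j = l n" by blast
    have "{k. cmod (wcoef \<psi> series 1 j k) powr p \<noteq> 0} \<subseteq> pos ` nodes n"
      by (auto simp: wcoef_series(1) mem_pos_image simp del: One_nat_def split: if_splits)
    then show ?thesis using finite_pos_nodes finite_subset by blast
  qed (simp add: wcoef_series(2) del: One_nat_def)
  then show "(\<lambda>k. cmod (wcoef \<psi> series 1 j k) powr p) summable_on UNIV"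
    by (intro finite_nonzero_values_imp_summable_on) simp
  have "infsum (\<lambda>k. cmod (wcoef \<psi> series 1 (l n) k) powr p) UNIV
     = (\<Sum>k\<in>pos ` nodes n. cmod (wcoef \<psi> series 1 (l n) k) powr p)"
    by (rule infsum_finite_support[OF finite_pos_nodes]) (simp add: wcoef_series(1) mem_pos_image del: One_nat_def)
  also have "\<dots> = (\<Sum>k\<in>pos ` nodes n. c n powr p)"
    using c_pos[of n] by (intro sum.cong) (auto simp: wcoef_series(1) simp del: One_nat_def)
  also have "\<dots> = real (card (nodes n)) * c n powr p"
    using card_image[OF inj_on_subset[OF inj_pos], of "nodes n"] by simp
  finally show "infsum (\<lambda>k. cmod (wcoef \<psi> series 1 (l n) k) powr p) UNIV = real (card (nodes n)) * c n powr p" .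
qed

lemma besov_eps_series:
  "besov_eps \<psi> s p series (l n) \<le> C powr (1 / p) * 2 powr (- (\<kappa> / p) * real n)"
  "j \<notin> range l \<Longrightarrow> besov_eps \<psi> s p series j = 0"
proof -
  let ?b = "real (\<Sum>i<n. e i)"
  have "real (card (nodes n)) \<le> 2 ^ (\<Sum>i<n. e i)"
    using of_nat_mono[OF card_nodes_le[of n]] by (simp only: of_nat_power of_nat_numeral)
  also have "\<dots> = 2 powr ?b" by (simp add: powr_realpow[symmetric] del: of_nat_sum)
  finally have card: "real (card (nodes n)) \<le> 2 powr ?b" .
  have "2 powr ((s * p - 1) * real (l n)) * (real (card (nodes n)) * c n powr p)
     \<le> 2 powr ((s * p - 1) * real (l n)) * (2 powr ?b * c n powr p)"
    using card by (intro mult_left_mono mult_right_mono) auto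
  also have "\<dots> = c n powr p * 2 powr (?b - (1 - s * p) * real (l n))"
    by (simp add: powr_add[symmetric] algebra_simps del: of_nat_sum)
  also have "\<dots> \<le> C * 2 powr (- \<kappa> * real n)" by (rule decay)
  finally have "(2 powr ((s * p - 1) * real (l n)) * (real (card (nodes n)) * c n powr p)) powr (1 / p)
      \<le> (C * 2 powr (- \<kappa> * real n)) powr (1 / p)"
    using p by (intro powr_mono2) auto
  moreover have "(2 powr ((s * p - 1) * real (l n))) powr (1 / p) = 2 powr ((s - 1 / p) * real (l n))"
    using p by (simp add: powr_powr field_simps)
  moreover have "(2 powr (- \<kappa> * real n)) powr (1 / p) = 2 powr (- (\<kappa> / p) * real n)"
    by (simp add: powr_powr)
  ultimately have "2 powr ((s - 1 / p) * real (l n)) * (real (card (nodes n)) * c n powr p) powr (1 / p)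
     \<le> C powr (1 / p) * 2 powr (- (\<kappa> / p) * real n)"
    using C_pos by (simp add: powr_mult)
  then show "besov_eps \<psi> s p series (l n) \<le> C powr (1 / p) * 2 powr (- (\<kappa> / p) * real n)"
    unfolding besov_eps_def I_single by (simp add: wcoef_powr_infsum(2) card1 del: One_nat_def)
  show "j \<notin> range l \<Longrightarrow> besov_eps \<psi> s p series j = 0"
    unfolding besov_eps_def I_single using p by (simp add: wcoef_series(2) del: One_nat_def)
qed

lemma besov_series: "besov \<phi> \<psi> s p 1 series"
proof -
  have nn: "0 \<le> besov_eps \<psi> s p series j" for j unfolding besov_eps_def by simp
  have "summable (\<lambda>n. besov_eps \<psi> s p series (l n))"
  proof (rule summable_comparison_test'[of "\<lambda>n. C powr (1 / p) * 2 powr (- (\<kappa> / p) * real n)" 0])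
    show "summable (\<lambda>n. C powr (1 / p) * 2 powr (- (\<kappa> / p) * real n))"
      using \<kappa> p by (intro summable_mult powr_geometric_summable) simp
  qed (use besov_eps_series(1) nn in simp)
  \<comment> \<open>Generations outside \<open>range l\<close> contribute 0, so summing along the
    subsequence \<open>l\<close> is enough.\<close>
  then have "summable (besov_eps \<psi> s p series)"
    using summable_mono_reindex[OF strict_mono_scale, of "besov_eps \<psi> s p series"] besov_eps_series(2) by simp
  then show ?thesis
    unfolding besov_def I_single using Lp_series wcoef_powr_infsum(1) nn p by (simp add: scoef_series del: One_nat_def)
qed

end

subsection \<open>Growth along the Cantor set\<close>

text \<open>With \<open>\<delta> = \<eta> / (2 * B)\<close>, fast growth of \<open>c\<close> makes
  the sum of all earlier coefficients at most \<open>\<delta> * c n\<close>, so the earlier terms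
  cancel at most half of the last one.\<close>

lemma head_dominates:
  fixes a :: "nat \<Rightarrow> complex" and c :: "nat \<Rightarrow> real"
  assumes lo: "\<And>n. \<eta> * c n \<le> cmod (a n)" and hi: "\<And>n. cmod (a n) \<le> B * c n"
    and c: "\<And>n. 0 \<le> c n" "\<And>n. c n \<le> q * c (Suc n)" and B: "0 < B" and \<eta>: "0 < \<eta>"
    and q: "q * (1 + \<eta> / (2 * B)) \<le> \<eta> / (2 * B)"
  shows "\<eta> / 2 * c n \<le> cmod (\<Sum>i\<le>n. a i)"
proof -
  define \<delta> where "\<delta> = \<eta> / (2 * B)"
  have \<delta>: "0 < \<delta>" unfolding \<delta>_def using B \<eta> by simp
  \<comment> \<open>The hypothesis \<open>q * (1 + \<delta>) \<le> \<delta>\<close> is exactly what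
    closes this induction.\<close>
  have sum: "(\<Sum>i<n. c i) \<le> \<delta> * c n" for n
  proof (induction n)
    case 0
    then show ?case using \<delta> c(1)[of 0] by simp
  next
    case (Suc n)
    have "(\<Sum>i<Suc n. c i) \<le> (1 + \<delta>) * c n" using Suc by (simp add: algebra_simps)
    also have "\<dots> \<le> (1 + \<delta>) * (q * c (Suc n))" using c(2)[of n] \<delta> by (intro mult_left_mono) auto
    also have "\<dots> = (q * (1 + \<delta>)) * c (Suc n)" by simp
    also have "\<dots> \<le> \<delta> * c (Suc n)" using q c(1)[of "Suc n"] unfolding \<delta>_def by (intro mult_right_mono) auto
    finally show ?case .
  qed
  have "cmod (\<Sum>i<n. a i) \<le> (\<Sum>i<n. B * c i)" by (rule order_trans[OF norm_sum sum_mono]) (rule hi)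
  also have "\<dots> \<le> B * (\<delta> * c n)" using sum[of n] B by (simp add: sum_distrib_left[symmetric])
  also have "\<dots> = \<eta> / 2 * c n" unfolding \<delta>_def using B by simp
  finally have 1: "cmod (\<Sum>i<n. a i) \<le> \<eta> / 2 * c n" .
  have "a n = (\<Sum>i\<le>n. a i) - (\<Sum>i<n. a i)" by (simp add: lessThan_Suc_atMost[symmetric])
  then have "cmod (a n) \<le> cmod (\<Sum>i\<le>n. a i) + cmod (\<Sum>i<n. a i)" by (metis norm_triangle_ineq4)
  then show ?thesis using 1 lo[of n] by linarith
qed

text \<open>The terms after the first are bounded by a geometric series with sum
  \<open>B * c n * q / (1 - q)\<close>. The condition on \<open>q\<close> says
  \<open>q / (1 - q) \<le> \<eta> / (2 * B)\<close>, so they cancel at most half of the first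
  term.\<close>

lemma tail_dominates:
  fixes a :: "nat \<Rightarrow> complex" and c :: "nat \<Rightarrow> real"
  assumes lo: "\<eta> * c n \<le> cmod (a n)" and hi: "\<And>n. cmod (a n) \<le> B * c n"
    and c: "0 \<le> c n" "\<And>i. n \<le> i \<Longrightarrow> c (Suc i) \<le> q * c i" and B: "0 < B" and \<eta>: "0 < \<eta>"
    and q: "0 < q" "q * (1 + \<eta> / (2 * B)) \<le> \<eta> / (2 * B)"
  shows "summable (\<lambda>i. a (i + n))" "\<eta> / 2 * c n \<le> cmod (\<Sum>i. a (i + n))"
proof -
  define \<delta> where "\<delta> = \<eta> / (2 * B)"
  have \<delta>: "0 < \<delta>" unfolding \<delta>_def using B \<eta> by simp
  have q\<delta>: "q * (1 + \<delta>) \<le> \<delta>" using q(2) unfolding \<delta>_def .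
  then have q1: "q < 1" using \<delta> q(1) by (smt (verit) mult_less_cancel_right2 mult_le_cancel_right1)
  have ci: "c (i + n) \<le> c n * q ^ i" for i
  proof (induction i)
    case (Suc i)
    have "c (Suc i + n) \<le> q * c (i + n)" using c(2)[of "i + n"] by simp
    also have "\<dots> \<le> q * (c n * q ^ i)" using Suc q(1) by (intro mult_left_mono) auto
    finally show ?case by (simp add: mult_ac)
  qed simp
  have ai: "cmod (a (i + n)) \<le> B * c n * q ^ i" for i
    using order_trans[OF hi mult_left_mono[OF ci[of i], of B]] B by (simp add: mult_ac)
  have sm: "summable (\<lambda>i. B * c n * q ^ i)" using q(1) q1 by (intro summable_mult summable_geometric) auto
  show s: "summable (\<lambda>i. a (i + n))"
    by (rule summable_comparison_test'[OF sm]) (rule ai)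
  have "cmod (\<Sum>i. a (Suc i + n)) \<le> (\<Sum>i. B * c n * q * q ^ i)"
  proof (rule norm_suminf_le)
    show "cmod (a (Suc i + n)) \<le> B * c n * q * q ^ i" for i using ai[of "Suc i"] by (simp add: mult_ac)
  qed (use q(1) q1 in \<open>auto intro!: summable_mult summable_geometric\<close>)
  also have "\<dots> = B * c n * (q / (1 - q))"
    using q(1) q1 by (subst suminf_mult) (auto simp: suminf_geometric intro: summable_geometric)
  also have "\<dots> \<le> B * c n * \<delta>"
  proof (rule mult_left_mono)
    show "q / (1 - q) \<le> \<delta>" using q\<delta> q1 by (simp add: pos_divide_le_eq algebra_simps)
  qed (use B c(1) in simp)
  also have "\<dots> = \<eta> / 2 * c n" unfolding \<delta>_def using B by simp
  finally have 1: "cmod (\<Sum>i. a (Suc i + n)) \<le> \<eta> / 2 * c n" .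
  have "a n = (\<Sum>i. a (i + n)) - (\<Sum>i. a (Suc i + n))" using suminf_split_head[OF s] by simp
  then have "cmod (a n) \<le> cmod (\<Sum>i. a (i + n)) + cmod (\<Sum>i. a (Suc i + n))" by (metis norm_triangle_ineq4)
  then show "\<eta> / 2 * c n \<le> cmod (\<Sum>i. a (i + n))" using 1 lo by linarith
qed

text \<open>The constant \<open>K\<close> changes the rate only by \<open>ln K / (j * ln 2)\<close>,
  which tends to 0.\<close>

lemma Liminf_log2rate_ge:
  assumes K: "0 < K" and ev: "eventually (\<lambda>j. K * 2 powr (\<beta> * real j) \<le> cmod (z j)) sequentially"
  shows "ereal \<beta> \<le> Liminf sequentially (\<lambda>j. log2rate (z j) j)"
proof -
  have "(\<lambda>j. \<beta> + ln K / ln 2 * (1 / real j)) \<longlonglongrightarrow> \<beta> + ln K / ln 2 * 0"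
    by (intro tendsto_intros lim_1_over_n)
  then have "(\<lambda>j. ereal (\<beta> + ln K / ln 2 * (1 / real j))) \<longlonglongrightarrow> ereal \<beta>" by simp
  then have "ereal \<beta> = Liminf sequentially (\<lambda>j. ereal (\<beta> + ln K / ln 2 * (1 / real j)))"
    by (intro lim_imp_Liminf[symmetric]) auto
  also have "\<dots> \<le> Liminf sequentially (\<lambda>j. log2rate (z j) j)"
  proof (rule Liminf_mono)
    show "\<forall>\<^sub>F j in sequentially. ereal (\<beta> + ln K / ln 2 * (1 / real j)) \<le> log2rate (z j) j"
      using ev eventually_gt_at_top[of 0]
    proof eventually_elim
      case (elim j)
      have pos: "0 < K * 2 powr (\<beta> * real j)" using K by simp
      then have z: "z j \<noteq> 0" using elim(1) by auto
      have "ln (K * 2 powr (\<beta> * real j)) \<le> ln (cmod (z j))"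
        using pos elim(1) z by (subst ln_le_cancel_iff) auto
      then have "ln K + \<beta> * real j * ln 2 \<le> ln (cmod (z j))" using K by (simp add: ln_mult ln_powr)
      then have "(ln K + \<beta> * real j * ln 2) / (real j * ln 2) \<le> ln (cmod (z j)) / (real j * ln 2)"
        by (intro divide_right_mono) auto
      moreover have "(ln K + \<beta> * real j * ln 2) / (real j * ln 2) = \<beta> + ln K / ln 2 * (1 / real j)"
        using elim(2) by (simp add: field_simps)
      ultimately show ?case using z unfolding log2rate_def by simp
    qed
  qed
  finally show ?thesis .
qed

context lacunary_wavelet_series
begin

lemma scale_between:
  assumes "l 0 < j"
  shows "\<exists>n. l n < j \<and> j \<le> l (Suc n)"
proof -
  define m where "m = (LEAST m. j \<le> l m)"
  have ex: "j \<le> l j" by (rule scale_ge)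
  have m: "j \<le> l m" unfolding m_def by (rule LeastI, rule ex)
  then obtain n where n: "m = Suc n" using assms by (cases m) auto
  have "\<not> j \<le> l n" using not_less_Least[of n "\<lambda>m. j \<le> l m"] n unfolding m_def by simp
  then have "l n < j \<and> j \<le> l (Suc n)" using m n by simp
  then show ?thesis by blast
qed

text \<open>\<open>Pop\<close> at \<open>j\<close> stops at generation \<open>j - 1\<close>. Hence
  it is constant for \<open>j\<close> from \<open>l n + 1\<close> to \<open>l (Suc n)\<close>, both
  included, and its scaling part is 0.\<close>

lemma Pop_series:
  assumes "l n < j" "j \<le> l (Suc n)"
  shows "Pop \<phi> \<psi> series j x = (\<Sum>i\<le>n. piece i x)"
proof -
  have mono: "l a < l b \<longleftrightarrow> a < b" "l a \<le> l b \<longleftrightarrow> a \<le> b" for a b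
    using strict_mono_less[OF strict_mono_scale] strict_mono_less_eq[OF strict_mono_scale] by blast+
  have "(\<Sum>i<j. Qop \<psi> series i x) = (\<Sum>i\<in>l ` {..n}. Qop \<psi> series i x)"
  proof (rule sum.mono_neutral_right)
    show "l ` {..n} \<subseteq> {..<j}" using assms(1) mono(2) by (auto intro: le_less_trans)
    show "\<forall>i\<in>{..<j} - l ` {..n}. Qop \<psi> series i x = 0"
    proof
      fix i assume i: "i \<in> {..<j} - l ` {..n}"
      have "i \<notin> range l"
      proof
        assume "i \<in> range l"
        then obtain k where k: "i = l k" by blast
        then have "l k < l (Suc n)" using i assms(2) by auto
        then have "k \<le> n" using mono(1) by simp
        then show False using i k by auto
      qed
      then show "Qop \<psi> series i x = 0" by (rule Qop_series(2))
    qed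
  qed simp
  also have "\<dots> = (\<Sum>i\<le>n. piece i x)"
    by (subst sum.reindex) (auto simp: Qop_series(1) intro: inj_on_subset[OF strict_mono_imp_inj_on[OF strict_mono_scale]])
  finally show ?thesis unfolding Pop_def by (simp add: scoef_series)
qed

lemma Rop_series:
  assumes "l n < j" "j \<le> l (Suc n)"
  shows "Rop \<psi> series j x = (\<Sum>i. piece (i + Suc n) x)"
proof -
  \<comment> \<open>\<open>g i\<close> is the position of generation \<open>l (i + Suc n)\<close> in
    the series of \<open>Rop\<close>, whose indices are shifted by \<open>j\<close>.\<close>
  define g where "g = (\<lambda>i. l (i + Suc n) - j)"
  have mono: "l a < l b \<longleftrightarrow> a < b" "l a \<le> l b \<longleftrightarrow> a \<le> b" for a b
    using strict_mono_less[OF strict_mono_scale] strict_mono_less_eq[OF strict_mono_scale] by blast+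
  have gj: "g i + j = l (i + Suc n)" for i
  proof -
    have "l (Suc n) \<le> l (i + Suc n)" using mono(2) by simp
    then show ?thesis unfolding g_def using assms(2) by simp
  qed
  have "strict_mono g"
  proof (rule strict_monoI)
    fix a b :: nat assume "a < b"
    then have "l (a + Suc n) < l (b + Suc n)" using mono(1) by simp
    then show "g a < g b" using gj[of a] gj[of b] by linarith
  qed
  then have "(\<Sum>i. Qop \<psi> series (g i + j) x) = (\<Sum>i. Qop \<psi> series (i + j) x)"
  proof (rule suminf_mono_reindex)
    fix t assume t: "t \<notin> range g"
    have "t + j \<notin> range l"
    proof
      assume "t + j \<in> range l"
      then obtain k where k: "t + j = l k" by blast
      then have "l n < l k" using assms(1) by linarith
      then obtain i where "k = i + Suc n" using mono(1) by (metis Suc_leI add.commute le_Suc_ex)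
      then have "t = g i" using gj[of i] k by simp
      then show False using t by blast
    qed
    then show "Qop \<psi> series (t + j) x = 0" by (rule Qop_series(2))
  qed
  then show ?thesis unfolding Rop_def gj Qop_series(1) by simp
qed

lemma piece_le_c: "cmod (piece n x) \<le> B * c n"
proof -
  have "B * (c n * indicator (supports n) x) \<le> B * c n"
    using B_pos c_pos[of n] by (simp add: indicator_def)
  then show ?thesis using piece_le[of n x] by linarith
qed

text \<open>The last piece in \<open>Pop\<close> stays the same up to \<open>j = l (Suc n)\<close>.
  Since \<open>\<beta> > 0\<close>, its coefficient must match \<open>2 powr (\<beta> * j)\<close>
  at this right end of the block, which explains the index \<open>Suc n\<close> in
  \<open>c\<close>.\<close>

lemma cantor_subset_Eplus_pos:
  assumes \<beta>: "0 < \<beta>" and c: "\<And>n. c n = 2 powr (\<beta> * real (l (Suc n)))"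
    and growth: "\<And>n. c n \<le> q * c (Suc n)" and q: "q * (1 + \<eta> / (2 * B)) \<le> \<eta> / (2 * B)"
  shows "{x. x $ ax \<in> cantor} \<subseteq> Eplus \<phi> \<psi> \<beta> series"
proof clarify
  fix x :: "real^'n" assume x: "x $ ax \<in> cantor"
  have "eventually (\<lambda>j. \<eta> / 2 * 2 powr (\<beta> * real j) \<le> cmod (Pop \<phi> \<psi> series j x)) sequentially"
    using eventually_gt_at_top[of "l 0"]
  proof eventually_elim
    case (elim j)
    then obtain n where n: "l n < j" "j \<le> l (Suc n)" using scale_between by blast
    have "\<eta> / 2 * 2 powr (\<beta> * real j) \<le> \<eta> / 2 * c n"
      unfolding c using n(2) \<beta> \<eta>_pos by (intro mult_left_mono powr_mono) auto
    also have "\<dots> \<le> cmod (\<Sum>i\<le>n. piece i x)"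
      by (rule head_dominates[where a = "\<lambda>i. piece i x" and c = c, OF piece_ge_cantor[OF x] piece_le_c less_imp_le[OF c_pos] growth B_pos \<eta>_pos q])
    finally show ?case unfolding Pop_series[OF n] .
  qed
  then show "x \<in> Eplus \<phi> \<psi> \<beta> series"
    unfolding Eplus_def using \<beta> \<eta>_pos Liminf_log2rate_ge[of "\<eta> / 2"] by simp
qed

text \<open>For \<open>j\<close> between \<open>l n\<close> and \<open>l (Suc n)\<close> the
  remainder is dominated by piece \<open>Suc n\<close>. Since \<open>\<beta> < 0\<close>, the
  required size is largest at the left end \<open>l n\<close>, which fixes the coefficient of that
  piece.\<close>

lemma cantor_subset_Eplus_neg:
  assumes \<beta>: "\<beta> < 0" and c: "\<And>n. c (Suc n) = 2 powr (\<beta> * real (l n))"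
    and growth: "\<And>n. c (Suc (Suc n)) \<le> q * c (Suc n)"
    and q: "0 < q" "q * (1 + \<eta> / (2 * B)) \<le> \<eta> / (2 * B)"
  shows "{x. x $ ax \<in> cantor} \<subseteq> Eplus \<phi> \<psi> \<beta> series"
proof clarify
  fix x :: "real^'n" assume x: "x $ ax \<in> cantor"
  \<comment> \<open>The coefficients are only known to decay from index 1 on, so
    \<open>tail_dominates\<close> is started at \<open>Suc n\<close>.\<close>
  have growth': "c (Suc i) \<le> q * c i" if "Suc n \<le> i" for i n
    using that growth by (cases i) auto
  have dom: "summable (\<lambda>i. piece (i + Suc n) x)" "\<eta> / 2 * c (Suc n) \<le> cmod (\<Sum>i. piece (i + Suc n) x)" for n
    using tail_dominates[where a = "\<lambda>i. piece i x" and c = c and n = "Suc n",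
        OF piece_ge_cantor[OF x] piece_le_c less_imp_le[OF c_pos] growth'[of n] B_pos \<eta>_pos q] by auto
  have "eventually (\<lambda>j. \<eta> / 2 * 2 powr (\<beta> * real j) \<le> cmod (Rop \<psi> series j x)) sequentially"
    using eventually_gt_at_top[of "l 0"]
  proof eventually_elim
    case (elim j)
    then obtain n where n: "l n < j" "j \<le> l (Suc n)" using scale_between by blast
    have "\<beta> * real j \<le> \<beta> * real (l n)" using n(1) \<beta> by (intro mult_left_mono_neg) auto
    then have "2 powr (\<beta> * real j) \<le> c (Suc n)" unfolding c by (rule powr_mono) simp
    then have "\<eta> / 2 * 2 powr (\<beta> * real j) \<le> \<eta> / 2 * c (Suc n)"
      using \<eta>_pos by (intro mult_left_mono) auto
    also have "\<dots> \<le> cmod (\<Sum>i. piece (i + Suc n) x)" by (rule dom(2)) 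
    finally show ?case unfolding Rop_series[OF n] .
  qed
  \<comment> \<open>Summability of the tail after the first piece gives that of all pieces, and the
    generations outside \<open>range l\<close> add only zeros.\<close>
  moreover have "convergent (\<lambda>j. Pop \<phi> \<psi> series j x)"
  proof -
    have "summable (\<lambda>i. piece i x)"
      using dom(1)[of 0] summable_Suc_iff[of "\<lambda>i. piece i x"] by simp
    then have "summable (\<lambda>n. Qop \<psi> series (l n) x)" unfolding Qop_series(1) .
    then have "summable (\<lambda>j. Qop \<psi> series j x)"
      using summable_mono_reindex[OF strict_mono_scale, of "\<lambda>j. Qop \<psi> series j x"] Qop_series(2) by simp
    then have "convergent (\<lambda>j. \<Sum>i<j. Qop \<psi> series i x)" by (simp add: summable_iff_convergent)
    then show ?thesis unfolding Pop_def by (simp add: scoef_series)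
  qed
  ultimately show "x \<in> Eplus \<phi> \<psi> \<beta> series"
    unfolding Eplus_def using \<beta> \<eta>_pos Liminf_log2rate_ge[of "\<eta> / 2"] by simp
qed

end

subsection \<open>Choice of the scales\<close>

text \<open>A state \<open>(l, b)\<close> records the scale and the logarithm of the number of nodes. Branching happens
  only once \<open>b\<close> has become negligible against \<open>l\<close>, and then the scale jumps by the factor \<open>1 + g\<close>.\<close>

definition next_state :: "real \<Rightarrow> real \<Rightarrow> real \<Rightarrow> nat \<Rightarrow> nat \<times> nat \<Rightarrow> nat \<times> nat" where
  "next_state \<theta> g \<kappa> m = (\<lambda>(l, b). if real b \<le> \<kappa> * real l
     then (l + m + nat \<lceil>g * real l\<rceil>, b + nat \<lfloor>\<theta> * real l\<rfloor>) else (l + m, b))"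

text \<open>Iterate \<open>next_state\<close> from \<open>(0, 0)\<close>; the final disjunction
  lists its two kinds of step. The condition \<open>\<theta> \<le> g\<close> makes the jump of the
  scale long enough for the new children.\<close>

lemma exists_scales:
  fixes \<theta> g \<kappa> :: real and m :: nat
  assumes \<theta>: "0 < \<theta>" "\<theta> \<le> g" and \<kappa>: "0 < \<kappa>" and m: "1 \<le> m"
  obtains l e :: "nat \<Rightarrow> nat" where
    "l 0 = 0"
    "\<And>n. l n + m + e n \<le> l (Suc n)"
    "\<And>N. \<exists>n\<ge>N. \<theta> * real (l n) - 1 \<le> real (e n)"
    "\<And>n. (real (\<Sum>i<n. e i) \<le> \<kappa> * real (l n) \<and> real (e n) \<le> \<theta> * real (l n)
           \<and> (1 + g) * real (l n) \<le> real (l (Suc n)) \<and> real (l (Suc n)) \<le> (1 + g) * real (l n) + real m + 1)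
         \<or> (e n = 0 \<and> l (Suc n) = l n + m)"
proof -
  define st where "st = rec_nat (0, 0) (\<lambda>_. next_state \<theta> g \<kappa> m)"
  define l b where "l = (\<lambda>n. fst (st n))" and "b = (\<lambda>n. snd (st n))"
  define e where "e = (\<lambda>n. b (Suc n) - b n)"
  have st_Suc: "st (Suc n) = next_state \<theta> g \<kappa> m (l n, b n)" for n
    unfolding st_def l_def b_def by simp
  have Suc: "l (Suc n) = fst (next_state \<theta> g \<kappa> m (l n, b n))" "b (Suc n) = snd (next_state \<theta> g \<kappa> m (l n, b n))" for n
    using arg_cong[OF st_Suc[of n], of fst] arg_cong[OF st_Suc[of n], of snd] by (simp_all only: l_def b_def)
  have zero: "l 0 = 0" "b 0 = 0" unfolding l_def b_def st_def by simp_all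
  have special: "l (Suc n) = l n + m + nat \<lceil>g * real (l n)\<rceil>" "b (Suc n) = b n + nat \<lfloor>\<theta> * real (l n)\<rfloor>"
    if "real (b n) \<le> \<kappa> * real (l n)" for n
    using that by (simp_all add: Suc next_state_def)
  have plain: "l (Suc n) = l n + m" "b (Suc n) = b n" if "\<not> real (b n) \<le> \<kappa> * real (l n)" for n
    using that by (simp_all add: Suc next_state_def)
  have b_mono: "b n \<le> b (Suc n)" for n using special(2)[of n] plain(2)[of n] by fastforce
  have sum_e: "(\<Sum>i<n. e i) = b n" for n
    by (induction n) (use b_mono zero in \<open>auto simp: e_def\<close>)
  have ge: "g * real (l n) \<ge> 0" for n using \<theta> by simp
  have floor_le: "nat \<lfloor>\<theta> * real (l n)\<rfloor> \<le> nat \<lceil>g * real (l n)\<rceil>" for n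
  proof (rule nat_mono)
    have "\<theta> * real (l n) \<le> g * real (l n)" using \<theta> by (intro mult_right_mono) auto
    then show "\<lfloor>\<theta> * real (l n)\<rfloor> \<le> \<lceil>g * real (l n)\<rceil>"
      using floor_mono floor_le_ceiling order_trans by blast
  qed
  have e_special: "e n = nat \<lfloor>\<theta> * real (l n)\<rfloor>" if "real (b n) \<le> \<kappa> * real (l n)" for n
    unfolding e_def using special(2)[OF that] by simp
  have step: "l n + m + e n \<le> l (Suc n)" for n
  proof (cases "real (b n) \<le> \<kappa> * real (l n)")
    case True
    then show ?thesis using special(1)[OF True] e_special[OF True] floor_le[of n] by simp
  next
    case False
    then show ?thesis using plain[OF False] by (simp add: e_def)
  qed
  have l_ge: "n \<le> l n" for n
  proof (induction n)
    case (Suc n)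
    then show ?case using step[of n] m by linarith
  qed simp
  \<comment> \<open>Branching recurs forever: without it \<open>b\<close> would stay constant while
    \<open>l\<close> tends to infinity, and the condition for branching would be met.\<close>
  have inf: "\<exists>n\<ge>N. real (b n) \<le> \<kappa> * real (l n)" for N
  proof (rule ccontr)
    assume no: "\<not> ?thesis"
    have b: "b n = b N" if "N \<le> n" for n
      using that by (induction n rule: dec_induct) (use no plain(2) in auto)
    obtain k :: nat where k: "real (b N) / \<kappa> \<le> real k" using real_arch_simple by blast
    have "real k \<le> real (l (max N k))" using l_ge[of "max N k"] by simp
    then have "real (b N) / \<kappa> \<le> real (l (max N k))" using k by linarith
    then have "real (b N) \<le> \<kappa> * real (l (max N k))" using \<kappa> by (simp add: pos_divide_le_eq mult.commute)
    then show False using no b[of "max N k"] by (metis max.cobounded1)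
  qed
  show ?thesis
  proof (rule that)
    show "l 0 = 0" by (rule zero)
    show "l n + m + e n \<le> l (Suc n)" for n by (rule step)
    show "\<exists>n\<ge>N. \<theta> * real (l n) - 1 \<le> real (e n)" for N
    proof -
      obtain n where n: "N \<le> n" "real (b n) \<le> \<kappa> * real (l n)" using inf by blast
      have "0 \<le> \<theta> * real (l n)" using \<theta> by simp
      then have "\<theta> * real (l n) - 1 \<le> real (e n)" unfolding e_special[OF n(2)] by linarith
      then show ?thesis using n(1) by blast
    qed
    show "(real (\<Sum>i<n. e i) \<le> \<kappa> * real (l n) \<and> real (e n) \<le> \<theta> * real (l n)
           \<and> (1 + g) * real (l n) \<le> real (l (Suc n)) \<and> real (l (Suc n)) \<le> (1 + g) * real (l n) + real m + 1)
         \<or> (e n = 0 \<and> l (Suc n) = l n + m)" for n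
    proof (cases "real (b n) \<le> \<kappa> * real (l n)")
      case True
      have "real (nat \<lceil>g * real (l n)\<rceil>) = real_of_int \<lceil>g * real (l n)\<rceil>"
        using ge[of n] by simp
      then have "g * real (l n) \<le> real (nat \<lceil>g * real (l n)\<rceil>)" "real (nat \<lceil>g * real (l n)\<rceil>) \<le> g * real (l n) + 1"
        by linarith+
      moreover have "real (e n) \<le> \<theta> * real (l n)"
        unfolding e_special[OF True] using \<theta> by (intro of_nat_floor) simp
      ultimately show ?thesis using True unfolding sum_e special(1)[OF True] by (simp add: algebra_simps)
    next
      case False
      then show ?thesis using plain[OF False] by (simp add: e_def)
    qed
  qed
qed

text \<open>It is used with \<open>A = 1 - s * p\<close> and \<open>v = \<beta> * p\<close>, and
  \<open>1 + g\<close> is the factor by which the scale jumps.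
  \<open>A - v < \<theta> / (1 + \<theta>)\<close> is the gain in dimension,
  \<open>(\<kappa> + \<theta>) / (1 + g) < A - v\<close> keeps the nodes sparse enough after a jump,
  and the last two inequalities are the Besov condition at a branching step for either sign of
  \<open>v\<close>.\<close>

lemma exists_rates:
  fixes A v :: real
  assumes A: "0 < A" "A < 1" and v: "A - v < 1" "0 < A - v" "v \<noteq> 0"
  obtains \<theta> g \<kappa> :: real where "0 < \<theta>" "0 < \<kappa>" "\<theta> \<le> g" "A - v < \<theta> / (1 + \<theta>)" "(\<kappa> + \<theta>) / (1 + g) < A - v"
    "0 < v \<longrightarrow> v * (1 + g) + \<kappa> < A" "v < 0 \<longrightarrow> \<kappa> + \<theta> + v < A * (1 + g)"
proof -
  define D where "D = A - v"
  have D: "0 < D" "D < 1" unfolding D_def using v by auto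
  have \<theta>D: "D < \<theta> / (1 + \<theta>)" if "D / (1 - D) < \<theta>" for \<theta>
  proof -
    have "0 < \<theta>" using that D by (smt (verit) divide_pos_pos)
    then show ?thesis using that D by (simp add: field_simps)
  qed
  show ?thesis
  proof (cases "0 < v")
    case True
    \<comment> \<open>This is where \<open>A < 1\<close>, that is \<open>s * p > 0\<close>, enters:
      it leaves room for the jump factor \<open>a = 1 + g\<close> between \<open>1 / (1 - D)\<close>
      and \<open>A / v\<close>.\<close>
    have "v < A * (1 - D)"
    proof -
      have "A * (1 - D) - v = (1 - A) * D" unfolding D_def by (simp add: algebra_simps)
      moreover have "0 < (1 - A) * D" using A D by simp
      ultimately show ?thesis by linarith
    qed
    then have "1 / (1 - D) < A / v" using True D by (simp add: field_simps)
    then obtain a where a: "1 / (1 - D) < a" "a < A / v" using dense by blast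
    have "0 < 1 / (1 - D)" using D by simp
    then have a0: "0 < a" using a(1) by linarith
    have aD: "1 < a * (1 - D)" using a(1) D by (simp add: pos_divide_less_eq)
    have 1: "D / (1 - D) < a * D" using aD D by (simp add: pos_divide_less_eq mult.commute)
    have "D < (a - 1) * (1 - D)" using aD by (simp add: algebra_simps)
    then have 2: "D / (1 - D) < a - 1" using D by (subst pos_divide_less_eq) auto
    \<comment> \<open>The lower bound gives the gain in dimension. Below \<open>a * D\<close> the
      nodes stay sparse after the jump, and below \<open>a - 1 = g\<close> the children fit.\<close>
    obtain \<theta> where \<theta>: "D / (1 - D) < \<theta>" "\<theta> < min (a * D) (a - 1)" using dense 1 2 by (metis min_less_iff_conj)
    define \<kappa> where "\<kappa> = min (a * D - \<theta>) (A - v * a) / 2"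
    have va: "v * a < A" using a(2) True by (simp add: pos_less_divide_eq mult.commute)
    have \<kappa>: "0 < \<kappa>" "\<kappa> < a * D - \<theta>" "\<kappa> < A - v * a" unfolding \<kappa>_def using \<theta>(2) va by auto
    have "0 < D / (1 - D)" using D by simp
    show ?thesis
    proof (rule that[of \<theta> \<kappa> "a - 1"])
      show "0 < \<theta>" using \<theta>(1) \<open>0 < D / (1 - D)\<close> by linarith
      show "A - v < \<theta> / (1 + \<theta>)" using \<theta>D[OF \<theta>(1)] unfolding D_def .
      show "(\<kappa> + \<theta>) / (1 + (a - 1)) < A - v"
        using \<kappa>(2) a0 unfolding D_def[symmetric] by (simp add: pos_divide_less_eq mult.commute)
    qed (use \<kappa> \<theta> True in auto)
  next
    case False
    then have v0: "v < 0" using v(3) by simp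
    define \<theta> where "\<theta> = D / (1 - D) + 1"
    have "0 < D / (1 - D)" using D by simp
    then have \<theta>: "0 < \<theta>" "D / (1 - D) < \<theta>" unfolding \<theta>_def by auto
    \<comment> \<open>For negative \<open>v\<close> nothing bounds \<open>g\<close> from above. Its
      three summands serve \<open>\<theta> \<le> g\<close>, the inequality with \<open>A\<close> and
      the inequality with \<open>D\<close>, in this order.\<close>
    define g where "g = \<theta> + (1 + \<theta>) / A + (1 + \<theta>) / D"
    have pos: "0 < (1 + \<theta>) / A" "0 < (1 + \<theta>) / D" using \<theta> A D by auto
    show ?thesis
    proof (rule that[of \<theta> 1 g])
      show "A - v < \<theta> / (1 + \<theta>)" using \<theta>D[OF \<theta>(2)] unfolding D_def .
      show "\<theta> \<le> g" unfolding g_def using pos by simp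
      have "1 + \<theta> = D * ((1 + \<theta>) / D)" using D by simp
      also have "\<dots> < D * (1 + g)" unfolding g_def using pos \<theta> D by (intro mult_strict_left_mono) auto
      finally show "(1 + \<theta>) / (1 + g) < A - v"
        using pos \<theta> unfolding D_def[symmetric] g_def by (simp add: pos_divide_less_eq)
      have "1 + \<theta> = A * ((1 + \<theta>) / A)" using A by simp
      also have "\<dots> < A * (1 + g)" unfolding g_def using pos \<theta> A by (intro mult_strict_left_mono) auto
      finally show "v < 0 \<longrightarrow> 1 + \<theta> + v < A * (1 + g)" using v0 by simp
    qed (use \<theta> False in auto)
  qed
qed

section \<open>Functions whose level sets exceed the dimension bound when
  \<open>s * p < 1\<close>\<close>

lemma mra_wavelets_nonzero:
  fixes \<psi> :: "nat \<Rightarrow> real^'n::finite \<Rightarrow> complex"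
  assumes "mra_wavelets \<phi> \<psi>"
  shows "\<exists>x. \<psi> 1 x \<noteq> 0"
proof (rule ccontr)
  assume "\<not> ?thesis"
  then have "wav \<psi> 1 0 0 = (\<lambda>x. 0)" unfolding wav_def by auto
  then have "l2_inner (wav \<psi> 1 0 0) (wav \<psi> 1 0 0) = 0" unfolding l2_inner_def by simp
  moreover have "(1 :: nat, 0, 0) \<in> {1..2^CARD('n) - 1} \<times> (UNIV::int set) \<times> (UNIV::(int^'n) set)"
  proof -
    have "2 ^ 1 \<le> (2::nat) ^ CARD('n)" by (intro power_increasing) (auto simp: Suc_le_eq)
    then show ?thesis by auto
  qed
  ultimately show False using assms unfolding mra_wavelets_def ONB_family_def by fastforce
qed

text \<open>The one-sided interval of dyadic length is the shape of the cells of the tree, with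
  \<open>u = z $ ax\<close>.\<close>

lemma continuous_lower_bound:
  fixes g :: "real^'n::finite \<Rightarrow> complex"
  assumes card: "CARD('n) = 1" and cont: "continuous_on UNIV g" and nz: "g z \<noteq> 0"
  obtains r \<eta> where "0 < \<eta>"
    "\<And>x. z $ ax \<le> x $ ax \<Longrightarrow> x $ ax \<le> z $ ax + 1 / 2 ^ r \<Longrightarrow> \<eta> \<le> cmod (g x)"
proof -
  let ?\<eta> = "cmod (g z) / 2"
  have \<eta>: "0 < ?\<eta>" using nz by simp
  then obtain d where d: "0 < d" "\<And>x. dist x z < d \<Longrightarrow> dist (g x) (g z) < ?\<eta>"
    using cont unfolding continuous_on_iff by (metis UNIV_I)
  obtain r where r: "(1/2) ^ r < d" using real_arch_pow_inv[OF d(1), of "1/2"] by auto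
  show ?thesis
  proof (rule that[OF \<eta>, of r])
    fix x assume "z $ ax \<le> x $ ax" "x $ ax \<le> z $ ax + 1 / 2 ^ r"
    then have "dist x z < d"
      using r unfolding dist_eq_abs_nth[OF card, of x z ax] by (simp add: power_one_over)
    then have "cmod (g x - g z) < ?\<eta>" using d(2) by (simp add: dist_norm)
    then show "?\<eta> \<le> cmod (g x)" using norm_triangle_ineq2[of "g z" "g x"] by (simp add: norm_minus_commute)
  qed
qed

text \<open>The wavelet fixes \<open>R\<close>, \<open>B\<close>, \<open>\<eta>\<close>,
  \<open>r\<close> and \<open>w\<close>; the ratio needed for domination then fixes the plain
  increment \<open>m\<close>; \<open>exists_rates\<close> and \<open>exists_scales\<close> give the
  tree. What remains is to check \<open>decay\<close> and \<open>thin\<close>, with coefficients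
  that depend on the sign of \<open>\<beta>\<close>.\<close>

lemma exists_slow_growth:
  fixes \<phi> :: "real^'n::finite \<Rightarrow> complex" and \<psi> :: "nat \<Rightarrow> real^'n \<Rightarrow> complex"
  assumes mra: "mra_wavelets \<phi> \<psi>" and card: "CARD('n) = 1"
    and supp: "compact_support \<phi>" "compact_support (\<psi> 1)"
    and smooth: "smooth_decay r' \<phi>" "smooth_decay r' (\<psi> 1)"
    and p: "1 \<le> p" and s: "0 < s" "0 < 1 - s * p" and \<beta>: "- s < \<beta>" "\<beta> < 1 / p - s" "\<beta> \<noteq> 0"
  shows "\<exists>f. besov \<phi> \<psi> s p 1 f \<and> ereal (1 - s * p - \<beta> * p) < packing_dim (Eplus \<phi> \<psi> \<beta> f)"
proof -
  obtain ax :: 'n where True by blast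
  have cont: "continuous_on UNIV \<phi>" "continuous_on UNIV (\<psi> 1)"
    using smooth by (blast intro: smooth_decay_continuous)+
  obtain R B where R: "0 < R" and B: "0 < B"
    and bnd: "\<And>g x. g \<in> {\<phi>, \<psi> 1} \<Longrightarrow> cmod (g x) \<le> B \<and> (g x \<noteq> 0 \<longrightarrow> norm x \<le> R)"
  proof -
    have "\<exists>R B. 0 < R \<and> 0 < B \<and> (\<forall>i\<in>{0, 1 :: nat}. \<forall>x. cmod ((\<lambda>i. if i = 0 then \<phi> else \<psi> 1) i x) \<le> B
        \<and> ((\<lambda>i. if i = 0 then \<phi> else \<psi> 1) i x \<noteq> 0 \<longrightarrow> norm x \<le> R))"
      by (rule uniform_support_bound) (use supp smooth in auto)
    then show ?thesis using that by auto
  qed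
  obtain z where z: "\<psi> 1 z \<noteq> 0" using mra_wavelets_nonzero[OF mra] by blast
  obtain r \<eta> where \<eta>: "0 < \<eta>"
    "\<And>x. z $ ax \<le> x $ ax \<Longrightarrow> x $ ax \<le> z $ ax + 1 / 2 ^ r \<Longrightarrow> \<eta> \<le> cmod (\<psi> 1 x)"
    using continuous_lower_bound[OF card cont(2) z, of ax] by blast
  obtain w where w: "1 \<le> w" "2 * R < 2 ^ w"
  proof -
    obtain w' where "2 * R < 2 ^ w'" using real_arch_pow[of 2 "2 * R"] by auto
    also have "(2::real) ^ w' \<le> 2 ^ Suc w'" by (intro power_increasing) auto
    finally show ?thesis using that[of "Suc w'"] by simp
  qed
  define v where "v = \<beta> * p"
  define A where "A = 1 - s * p"
  have Av: "0 < A" "A < 1" "A - v < 1" "0 < A - v" "v \<noteq> 0"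
  proof -
    show "0 < A" "A < 1" unfolding A_def using s p by auto
    have "0 < (s + \<beta>) * p" using \<beta>(1) p by (intro mult_pos_pos) auto
    then show "A - v < 1" unfolding A_def v_def by (simp add: algebra_simps)
    have "\<beta> * p < (1 / p - s) * p" using \<beta>(2) p by (intro mult_strict_right_mono) auto
    then show "0 < A - v" unfolding A_def v_def using p by (simp add: algebra_simps)
    show "v \<noteq> 0" unfolding v_def using \<beta>(3) p by simp
  qed
  obtain \<theta> g \<kappa>' where rates: "0 < \<theta>" "0 < \<kappa>'" "\<theta> \<le> g" "A - v < \<theta> / (1 + \<theta>)" "(\<kappa>' + \<theta>) / (1 + g) < A - v"
    "0 < v \<longrightarrow> v * (1 + g) + \<kappa>' < A" "v < 0 \<longrightarrow> \<kappa>' + \<theta> + v < A * (1 + g)"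
    using exists_rates[OF Av] by metis
  \<comment> \<open>The logarithm \<open>b n\<close> of the bound on the number of nodes will stay
    below \<open>D * l n\<close>: a branching step starts from
    \<open>b n \<le> \<kappa>' * l n\<close>, adds at most \<open>\<theta> * l n\<close>, and
    multiplies the scale by at least \<open>1 + g\<close>.\<close>
  define D where "D = (\<kappa>' + \<theta>) / (1 + g)"
  \<comment> \<open>The slack in the tightest constraint: \<open>A - v - D\<close> serves the plain
    steps, the other term the branching steps, whose form depends on the sign of
    \<open>v\<close>.\<close>
  define \<kappa> where "\<kappa> = min (A - v - D) (if 0 < v then A - v * (1 + g) - \<kappa>' else A * (1 + g) - (\<kappa>' + \<theta> + v))"
  have \<kappa>: "0 < \<kappa>" "\<kappa> \<le> A - v - D"
    "0 < v \<Longrightarrow> \<kappa> \<le> A - v * (1 + g) - \<kappa>'" "v < 0 \<Longrightarrow> \<kappa> \<le> A * (1 + g) - (\<kappa>' + \<theta> + v)"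
    unfolding \<kappa>_def D_def using rates(5-7) Av(5) by auto
  have D0: "0 < D" unfolding D_def using rates(1-3) by simp
  define \<delta> where "\<delta> = \<eta> / (2 * B)"
  have \<delta>: "0 < \<delta>" unfolding \<delta>_def using \<eta> B by simp
  \<comment> \<open>\<open>\<delta> / (1 + \<delta>)\<close> is the largest \<open>q\<close> with
    \<open>q * (1 + \<delta>) \<le> \<delta>\<close>, the condition under which one piece dominates
    all earlier or all later ones.\<close>
  obtain m0 :: nat where m0: "(2 powr (- \<bar>\<beta>\<bar>)) ^ m0 < \<delta> / (1 + \<delta>)"
  proof -
    have "2 powr (- \<bar>\<beta>\<bar>) < (1::real)" using \<beta>(3) by (simp add: powr_less_one)
    then show ?thesis using real_arch_pow_inv[of "\<delta> / (1 + \<delta>)" "2 powr (- \<bar>\<beta>\<bar>)"] \<delta> that by auto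
  qed
  \<comment> \<open>\<open>r + w\<close> is the room that the tree needs at each step, and
    \<open>m0\<close> generations bring the ratio of consecutive coefficients down to
    \<open>q\<close>.\<close>
  define m where "m = r + w + m0"
  have m: "1 \<le> m" "r + w \<le> m" unfolding m_def using w by auto
  define q where "q = 2 powr (- \<bar>\<beta>\<bar> * real m)"
  have q: "0 < q" "q * (1 + \<eta> / (2 * B)) \<le> \<eta> / (2 * B)"
  proof -
    show "0 < q" unfolding q_def by simp
    have "- \<bar>\<beta>\<bar> * real m \<le> - \<bar>\<beta>\<bar> * real m0" unfolding m_def by (intro mult_left_mono_neg) auto
    then have "q \<le> (2 powr (- \<bar>\<beta>\<bar>)) ^ m0" unfolding q_def by (simp add: powr_power mult.commute)
    then have "q \<le> \<delta> / (1 + \<delta>)" using m0 by simp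
    then show "q * (1 + \<eta> / (2 * B)) \<le> \<eta> / (2 * B)"
      using \<delta> unfolding \<delta>_def[symmetric] by (simp add: pos_le_divide_eq)
  qed
  obtain l e where l0: "l 0 = 0" and step: "\<And>n. l n + m + e n \<le> l (Suc n)"
    and branch: "\<And>N. \<exists>n\<ge>N. \<theta> * real (l n) - 1 \<le> real (e n)"
    and cases: "\<And>n. (real (\<Sum>i<n. e i) \<le> \<kappa>' * real (l n) \<and> real (e n) \<le> \<theta> * real (l n)
           \<and> (1 + g) * real (l n) \<le> real (l (Suc n)) \<and> real (l (Suc n)) \<le> (1 + g) * real (l n) + real m + 1)
         \<or> (e n = 0 \<and> l (Suc n) = l n + m)"
    using exists_scales[OF rates(1,3,2) m(1)] by metis
  define b where "b = (\<lambda>n. real (\<Sum>i<n. e i))"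
  have b_Suc: "b (Suc n) = b n + real (e n)" for n unfolding b_def by simp
  have b_cases: "(b n \<le> \<kappa>' * real (l n) \<and> real (e n) \<le> \<theta> * real (l n)
           \<and> (1 + g) * real (l n) \<le> real (l (Suc n)) \<and> real (l (Suc n)) \<le> (1 + g) * real (l n) + real m + 1)
         \<or> (e n = 0 \<and> l (Suc n) = l n + m)" for n
    unfolding b_def by (rule cases)
  interpret dyadic_tree l e r w "z $ ax"
    by unfold_locales (use step m w(1) in \<open>auto intro: order_trans[OF _ step] simp: m_def\<close>)
  have g1: "0 < 1 + g" using rates by linarith
  have bD: "b n \<le> D * real (l n)" for n
  proof (induction n)
    case 0
    then show ?case by (simp add: b_def l0)
  next
    case (Suc n)
    from b_cases[of n] show ?case
    proof
      assume sp: "b n \<le> \<kappa>' * real (l n) \<and> real (e n) \<le> \<theta> * real (l n)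
           \<and> (1 + g) * real (l n) \<le> real (l (Suc n)) \<and> real (l (Suc n)) \<le> (1 + g) * real (l n) + real m + 1"
      then have "b (Suc n) \<le> (\<kappa>' + \<theta>) * real (l n)" unfolding b_Suc by (simp add: algebra_simps)
      also have "\<dots> = D * ((1 + g) * real (l n))" unfolding D_def using g1 by simp
      also have "\<dots> \<le> D * real (l (Suc n))" using sp D0 by (intro mult_left_mono) auto
      finally show ?thesis .
    next
      assume pl: "e n = 0 \<and> l (Suc n) = l n + m"
      then have "b (Suc n) \<le> D * real (l n)" using Suc unfolding b_Suc by simp
      also have "\<dots> \<le> D * real (l (Suc n))" using pl D0 by (intro mult_left_mono) auto
      finally show ?thesis .
    qed
  qed
  have \<kappa>l: "\<kappa> * real n \<le> \<kappa> * real (l n)" for n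
    using scale_ge[of n] \<kappa>(1) by (intro mult_left_mono) auto
  \<comment> \<open>\<open>D \<le> A - v - \<kappa>\<close> and \<open>A - v < 1\<close> give
    \<open>D \<le> 1 - \<kappa>\<close>.\<close>
  have thin: "b n - real (l n) \<le> - \<kappa> * real n" for n
  proof -
    have "b n \<le> (1 - \<kappa>) * real (l n)"
      using order_trans[OF bD[of n] mult_right_mono[of D "1 - \<kappa>" "real (l n)"]] \<kappa>(2) Av(3) by simp
    then show ?thesis using \<kappa>l[of n] by (simp add: algebra_simps)
  qed
  have series: "\<exists>f. besov \<phi> \<psi> s p 1 f \<and> {x. x $ ax \<in> cantor} \<subseteq> Eplus \<phi> \<psi> \<beta> f"
  proof (cases "0 < \<beta>")
    case True
    then have v0: "0 < v" unfolding v_def using p by simp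
    define c where "c = (\<lambda>n. 2 powr (\<beta> * real (l (Suc n))))"
    \<comment> \<open>This is the exponent in \<open>decay\<close>. At a branching step the jump
      makes \<open>c n\<close> large and the slack is that of \<open>\<kappa>(3)\<close>, the
      rounding costing \<open>v * (m + 1)\<close>; at a plain step \<open>b n \<le> D * l n\<close>
      leaves the slack of \<open>\<kappa>(2)\<close>.\<close>
    have dec: "v * real (l (Suc n)) + b n - A * real (l n) \<le> v * (real m + 1) - \<kappa> * real n" for n
      using b_cases[of n]
    proof
      assume sp: "b n \<le> \<kappa>' * real (l n) \<and> real (e n) \<le> \<theta> * real (l n)
           \<and> (1 + g) * real (l n) \<le> real (l (Suc n)) \<and> real (l (Suc n)) \<le> (1 + g) * real (l n) + real m + 1"
      have "v * real (l (Suc n)) \<le> v * ((1 + g) * real (l n) + real m + 1)"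
        using sp v0 by (intro mult_left_mono) auto
      moreover have "\<kappa> * real (l n) \<le> (A - v * (1 + g) - \<kappa>') * real (l n)"
        using \<kappa>(3)[OF v0] by (intro mult_right_mono) auto
      ultimately show ?thesis using sp \<kappa>l[of n] by (simp add: algebra_simps)
    next
      assume pl: "e n = 0 \<and> l (Suc n) = l n + m"
      have "\<kappa> * real (l n) \<le> (A - v - D) * real (l n)"
        using \<kappa>(2) by (intro mult_right_mono) auto
      then show ?thesis using pl bD[of n] \<kappa>l[of n] v0 by (simp add: algebra_simps)
    qed
    interpret lacunary_wavelet_series l e r w "z $ ax" \<phi> \<psi> ax c p s B R \<eta> "2 powr (v * (real m + 1))" \<kappa>
    proof unfold_locales
      show "c n powr p * 2 powr (real (\<Sum>i<n. e i) - (1 - s * p) * real (l n))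
          \<le> 2 powr (v * (real m + 1)) * 2 powr (- \<kappa> * real n)" for n
      proof -
        have "c n powr p = 2 powr (v * real (l (Suc n)))"
          unfolding c_def v_def by (simp add: powr_powr mult_ac)
        then show ?thesis
          using dec[of n] unfolding b_def A_def by (simp only: powr_add[symmetric]) (intro powr_mono; simp)
      qed
      show "2 powr (real (\<Sum>i<n. e i) - real (l n)) \<le> 2 powr (v * (real m + 1)) * 2 powr (- \<kappa> * real n)" for n
      proof -
        have "0 \<le> v * (real m + 1)" using v0 by simp
        then show ?thesis
          using thin[of n] unfolding b_def by (simp only: powr_add[symmetric]) (intro powr_mono; linarith)
      qed
    qed (use card mra cont bnd R B \<eta> w p s \<kappa> in \<open>auto simp: c_def\<close>)
    have growth: "c n \<le> q * c (Suc n)" for n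
    proof -
      have "real (l (Suc n)) + real m \<le> real (l (Suc (Suc n)))" using step[of "Suc n"] by simp
      then have "\<beta> * (real (l (Suc n)) + real m) \<le> \<beta> * real (l (Suc (Suc n)))" using True by simp
      then show ?thesis unfolding q_def c_def using True
        by (simp only: powr_add[symmetric]) (intro powr_mono; simp add: algebra_simps)
    qed
    show ?thesis
      using besov_series cantor_subset_Eplus_pos[OF True _ growth q(2)] unfolding c_def by blast
  next
    case False
    then have \<beta>0: "\<beta> < 0" using \<beta>(3) by simp
    then have v0: "v < 0" unfolding v_def using p by (simp add: mult_neg_pos)
    \<comment> \<open>The subtraction is truncated, so \<open>c 0 = c 1\<close>. For
      \<open>n > 0\<close> the coefficient belongs to the start of the block on which piece
      \<open>n\<close> dominates the remainder.\<close>
    define c where "c = (\<lambda>n. 2 powr (\<beta> * real (l (n - 1))))"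
    \<comment> \<open>The step from \<open>i\<close> to \<open>n = Suc i\<close> is estimated in
      terms of \<open>l i \<ge> i = n - 1\<close>, which costs one \<open>\<kappa>\<close>. For
      \<open>n = 0\<close> the left side is 0.\<close>
    have dec: "v * real (l (n - 1)) + b n - A * real (l n) \<le> \<kappa> - \<kappa> * real n" for n
    proof (cases n)
      case 0
      then show ?thesis using \<kappa>(1) by (simp add: b_def l0)
    next
      case (Suc i)
      have "v * real (l i) + b (Suc i) - A * real (l (Suc i)) \<le> - \<kappa> * real (l i)"
        using b_cases[of i]
      proof
        assume sp: "b i \<le> \<kappa>' * real (l i) \<and> real (e i) \<le> \<theta> * real (l i)
           \<and> (1 + g) * real (l i) \<le> real (l (Suc i)) \<and> real (l (Suc i)) \<le> (1 + g) * real (l i) + real m + 1"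
        have "A * ((1 + g) * real (l i)) \<le> A * real (l (Suc i))"
          using sp Av(1) by (intro mult_left_mono) auto
        moreover have "\<kappa> * real (l i) \<le> (A * (1 + g) - (\<kappa>' + \<theta> + v)) * real (l i)"
          using \<kappa>(4)[OF v0] by (intro mult_right_mono) auto
        ultimately show ?thesis using sp unfolding b_Suc by (simp add: algebra_simps)
      next
        assume pl: "e i = 0 \<and> l (Suc i) = l i + m"
        have "\<kappa> * real (l i) \<le> (A - v - D) * real (l i)"
          using \<kappa>(2) by (intro mult_right_mono) auto
        moreover have "0 \<le> A * real m" using Av(1) by simp
        ultimately show ?thesis using pl bD[of i] unfolding b_Suc by (simp add: algebra_simps)
      qed
      then show ?thesis using \<kappa>l[of i] Suc by (simp add: algebra_simps)
    qed
    interpret lacunary_wavelet_series l e r w "z $ ax" \<phi> \<psi> ax c p s B R \<eta> "2 powr \<kappa>" \<kappa>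
    proof unfold_locales
      show "c n powr p * 2 powr (real (\<Sum>i<n. e i) - (1 - s * p) * real (l n)) \<le> 2 powr \<kappa> * 2 powr (- \<kappa> * real n)" for n
      proof -
        have "c n powr p = 2 powr (v * real (l (n - 1)))"
          unfolding c_def v_def by (simp add: powr_powr mult_ac)
        then show ?thesis
          using dec[of n] unfolding b_def A_def by (simp only: powr_add[symmetric]) (intro powr_mono; simp)
      qed
      show "2 powr (real (\<Sum>i<n. e i) - real (l n)) \<le> 2 powr \<kappa> * 2 powr (- \<kappa> * real n)" for n
        using thin[of n] \<kappa>(1) unfolding b_def by (simp only: powr_add[symmetric]) (intro powr_mono; simp)
    qed (use card mra cont bnd R B \<eta> w p s \<kappa> in \<open>auto simp: c_def\<close>)
    have growth: "c (Suc (Suc n)) \<le> q * c (Suc n)" for n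
    proof -
      have "real (l n) + real m \<le> real (l (Suc n))" using step[of n] by simp
      then have "\<beta> * real (l (Suc n)) \<le> \<beta> * (real (l n) + real m)" using \<beta>0 by simp
      then show ?thesis unfolding q_def c_def using \<beta>0
        by (simp only: powr_add[symmetric]) (intro powr_mono; simp add: algebra_simps)
    qed
    show ?thesis
      using besov_series cantor_subset_Eplus_neg[OF \<beta>0 _ growth q] unfolding c_def by fastforce
  qed
  then obtain f where f: "besov \<phi> \<psi> s p 1 f" "{x. x $ ax \<in> cantor} \<subseteq> Eplus \<phi> \<psi> \<beta> f" by blast
  have "ereal (1 - s * p - \<beta> * p) < ereal (\<theta> / (1 + \<theta>))"
    using rates(4) unfolding A_def v_def by simp
  also have "\<dots> \<le> packing_dim (Eplus \<phi> \<psi> \<beta> f)"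
    by (rule packing_dim_ge[OF card rates(1) branch f(2)])
  finally show ?thesis using f(1) by blast
qed

theorem theorem1p3:
  fixes \<phi> :: "real^'n::finite \<Rightarrow> complex"
    and \<psi> :: "nat \<Rightarrow> real^'n \<Rightarrow> complex"
    and p :: real
  assumes mra: "mra_wavelets \<phi> \<psi>"
    and supp_phi: "compact_support \<phi>"
    and supp_psi: "\<forall>i\<in>{1..2^CARD('n) - 1}. compact_support (\<psi> i)"
    and p: "1 \<le> p"
  shows
    "(CARD('n) = 1 \<longrightarrow>
       (\<forall>s \<beta>. smooth_decay (nat \<lfloor>s\<rfloor> + 1) \<phi> \<and>
              (\<forall>i\<in>{1..2^CARD('n) - 1}. smooth_decay (nat \<lfloor>s\<rfloor> + 1) (\<psi> i)) \<and>
              0 < s \<and> 1 - s * p > 0 \<and> - s < \<beta> \<and> \<beta> < 1 / p - s \<and> \<beta> \<noteq> 0 \<longrightarrow>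
          (\<exists>f. besov \<phi> \<psi> s p 1 f \<and>
               packing_dim (Eplus \<phi> \<psi> \<beta> f) > ereal (1 - s * p - \<beta> * p)))) \<and>
     (\<forall>s \<beta> f. smooth_decay (nat \<lfloor>s\<rfloor> + 1) \<phi> \<and>
              (\<forall>i\<in>{1..2^CARD('n) - 1}. smooth_decay (nat \<lfloor>s\<rfloor> + 1) (\<psi> i)) \<and>
              0 \<le> s \<and> real CARD('n) - s * p < 0 \<and>
              - s < \<beta> \<and> \<beta> < real CARD('n) / p - s \<and> \<beta> \<noteq> 0 \<and>
              besov \<phi> \<psi> s p \<infinity> f \<longrightarrow>
          packing_dim (Eplus \<phi> \<psi> \<beta> f) \<le> ereal (real CARD('n) - s * p - \<beta> * p))"
proof (intro conjI impI allI; elim conjE)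
  fix s \<beta> :: real
  assume card: "CARD('n) = 1" and *: "smooth_decay (nat \<lfloor>s\<rfloor> + 1) \<phi>"
    "\<forall>i\<in>{1..2^CARD('n) - 1}. smooth_decay (nat \<lfloor>s\<rfloor> + 1) (\<psi> i)"
    "0 < s" "1 - s * p > 0" "- s < \<beta>" "\<beta> < 1 / p - s" "\<beta> \<noteq> 0"
  have "1 \<in> {1..2^CARD('n) - 1 :: nat}" using card by simp
  then show "\<exists>f. besov \<phi> \<psi> s p 1 f \<and> packing_dim (Eplus \<phi> \<psi> \<beta> f) > ereal (1 - s * p - \<beta> * p)"
    using * supp_psi by (intro exists_slow_growth[OF mra card supp_phi _ *(1)] p) blast+
next
  fix s \<beta> f
  assume "\<forall>i\<in>{1..2^CARD('n) - 1}. smooth_decay (nat \<lfloor>s\<rfloor> + 1) (\<psi> i)"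
    "real CARD('n) - s * p < 0" "\<beta> < real CARD('n) / p - s" "besov \<phi> \<psi> s p \<infinity> f"
  then show "packing_dim (Eplus \<phi> \<psi> \<beta> f) \<le> ereal (real CARD('n) - s * p - \<beta> * p)"
    using supp_psi p by (intro packing_dim_Eplus_le) auto
qed

end
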